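(* Let $(X,\|\cdot\|)$ be a finite dimensional normed space and let $m\in\{1,\ldots,\dim X-1\}$. Assume that $W\in\mathbf G_m(X)$, that $\mu$ is a density contractor on $W$ with respect to $\mathcal H^m_{\|\cdot\|}$, and that $A\subset X$ is Borel measurable and countably $(\mathcal H^m_{\|\cdot\|},m)$ rectifiable. Then $$\int_{\mathrm{Hom}_m(X,X)}\mathcal H^m_{\|\cdot\|}(\pi(A))\,d\mu(\pi)\le\mathcal H^m_{\|\cdot\|}(A),$$ with equality when $A\subset W$, and the integrand $\pi\mapsto\mathcal H^m_{\|\cdot\|}(\pi(A))$, on $\mathrm{Hom}_m(X,X)$, is Borel measurable.
   Context: $\mathbf G_m(X)$ is the set of $m$-dimensional linear subspaces of $X$. $\mathcal H^m_{\|\cdot\|}$ is the $m$-dimensional Hausdorff measure on $X$ associated with the metric $\|x-y\|$, computed with weights $\alpha(m)2^{-m}(\mathrm{diam}\,E)^m$, where $\alpha(m)$ is the Lebesgue measure of the Euclidean unit ball of $\mathbf R^m$. A set $A$ is countably $(\mathcal H^m_{\|\cdot\|},m)$ rectifiable if $\mathcal H^m_{\|\cdot\|}$-almost all of $A$ is contained in the union of countably many Lipschitz images of bounded subsets of $\mathbf R^m$. $\mathrm{Hom}_m(X,X)$ is the (metric) space of linear maps $\pi:X\to X$ with $\mathrm{rank}\,\pi\le m$, and $\mathrm{Hom}(X,W)$ is the set of linear maps $\pi:X\to X$ with $\mathrm{im}\,\pi\subset W$. A density contractor on $W\in\mathbf G_m(X)$ with respect to $\mathcal H^m_{\|\cdot\|}$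 is a Borel probability measure $\mu$ on $\mathrm{Hom}_m(X,X)$ such that (1) $\mu(\mathrm{Hom}_m(X,X)\setminus\mathrm{Hom}(X,W))=0$; (2) for every $V\in\mathbf G_m(X)$ and every Borel $A\subset V$, $\int_{\mathrm{Hom}_m(X,X)}\mathcal H^m_{\|\cdot\|}(\pi(A))\,d\mu(\pi)\le\mathcal H^m_{\|\cdot\|}(A)$, with equality when $V=W$. *)

theory Defs
  imports "HOL-Analysis.Analysis" "HOL-Probability.Probability_Measure"
begin

text \<open>
  Hausdorff measure is an outer measure defined on all sets: images \<open>\<pi>(A)\<close> of Borel sets need not
  be Borel. The constant \<open>unit_ball_vol m\<close> is the Lebesgue measure of the Euclidean unit ball of
  \<open>\<real>\<^sup>m\<close> (see \<open>emeasure_ball\<close>). Covering sets are required to be bounded because \<open>diameter\<close> has no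
  meaningful value on unbounded sets. The definition is intended for \<open>m \<ge> 1\<close>, where the
  empty set has weight 0.
\<close>

definition hausdorff_delta :: "nat \<Rightarrow> real \<Rightarrow> 'a::metric_space set \<Rightarrow> ennreal" where
  "hausdorff_delta m \<delta> A =
     (INF E \<in> {E :: nat \<Rightarrow> 'a set. A \<subseteq> (\<Union>i. E i) \<and> (\<forall>i. bounded (E i) \<and> diameter (E i) \<le> \<delta>)}.
        \<Sum>i. ennreal (unit_ball_vol (real m) / 2 ^ m * diameter (E i) ^ m))"

definition hausdorff_measure :: "nat \<Rightarrow> 'a::metric_space set \<Rightarrow> ennreal" where
  "hausdorff_measure m A = (SUP \<delta> \<in> {0<..}. hausdorff_delta m \<delta> A)"

definition grassmannian :: "nat \<Rightarrow> 'a::real_vector set set" where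
  "grassmannian m = {V. subspace V \<and> dim V = m}"

text \<open>
  All notions below are meant for finite dimensional \<open>'a\<close>. There every linear endomorphism is
  bounded, so the type \<open>'a \<Rightarrow>\<^sub>L 'a\<close> consists of all of them; its metric is the operator norm.
\<close>

definition Hom_rank :: "nat \<Rightarrow> ('a::real_normed_vector \<Rightarrow>\<^sub>L 'a) set" where
  "Hom_rank m = {\<pi>. dim (range (blinfun_apply \<pi>)) \<le> m}"

definition Hom_into :: "'a::real_normed_vector set \<Rightarrow> ('a \<Rightarrow>\<^sub>L 'a) set" where
  "Hom_into W = {\<pi>. range (blinfun_apply \<pi>) \<subseteq> W}"

definition density_contractor ::
  "nat \<Rightarrow> 'a::real_normed_vector set \<Rightarrow> ('a \<Rightarrow>\<^sub>L 'a) measure \<Rightarrow> bool" where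
  "density_contractor m W \<mu> \<longleftrightarrow>
     prob_space \<mu> \<and>
     space \<mu> = Hom_rank m \<and>
     sets \<mu> = sets (restrict_space borel (Hom_rank m)) \<and>
     emeasure \<mu> (Hom_rank m - Hom_into W) = 0 \<and>
     (\<forall>V \<in> grassmannian m. \<forall>A \<in> sets borel. A \<subseteq> V \<longrightarrow>
        (\<integral>\<^sup>+\<pi>. hausdorff_measure m (blinfun_apply \<pi> ` A) \<partial>\<mu>) \<le> hausdorff_measure m A \<and>
        (V = W \<longrightarrow>
          (\<integral>\<^sup>+\<pi>. hausdorff_measure m (blinfun_apply \<pi> ` A) \<partial>\<mu>) = hausdorff_measure m A))"

text \<open>
  Countable \<open>(\<H>\<^sup>m, m)\<close> rectifiability, where \<open>\<real>\<^sup>m\<close> is \<open>real ^ 'm\<close> and \<open>m = CARD('m)\<close>. Some of the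
  sets \<open>E k\<close> may be empty, so finite families are included.
\<close>

definition countably_rectifiable :: "'m::finite itself \<Rightarrow> 'a::metric_space set \<Rightarrow> bool" where
  "countably_rectifiable _ A \<longleftrightarrow>
     (\<exists>(E :: nat \<Rightarrow> (real ^ 'm) set) (f :: nat \<Rightarrow> real ^ 'm \<Rightarrow> 'a).
        (\<forall>k. bounded (E k) \<and> (\<exists>L. L-lipschitz_on (E k) (f k))) \<and>
        hausdorff_measure CARD('m) (A - (\<Union>k. f k ` E k)) = 0)"

end

theory Submission imports Defs begin

text \<open>
  Write \<open>\<H>\<close> for \<open>m\<close>-dimensional Hausdorff measure. For a Lipschitz map \<open>f\<close> from a subset of \<open>\<real>\<^sup>m\<close> to \<open>X\<close>
  that is injective on \<open>S\<close>, the area formula expresses \<open>\<H>(f(S))\<close> as the integral over \<open>S\<close> of a Jacobian that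
  depends only on the derivative of \<open>f\<close>: the measure \<open>J(L)\<close> of the image of the unit cube under the derivative
  \<open>L\<close>. For a linear map \<open>\<pi>\<close>, the measure of \<open>\<pi>(f(S))\<close> is at most the integral of \<open>J(\<pi> \<circ> L)\<close>. The hypothesis
  on \<open>\<mu>\<close>, applied to the image of an injective \<open>L\<close>, says that the mean of \<open>J(\<pi> \<circ> L)\<close> over \<open>\<pi>\<close> is at
  most \<open>J(L)\<close>; for other \<open>L\<close> both sides vanish. Exchanging the integrals gives the inequality for Lipschitz images, and a rectifiable set is a
  disjoint union of Borel subsets of Lipschitz images up to a null set. The equality for subsets of \<open>W\<close> is
  part of the definition of a density contractor.

  The area formula is replaced by an approximation that avoids derivatives. By \<open>lipschitz_affine_pieces\<close>, a
  Lipschitz map is affine up to a small relative error on each of countably many closed sets that cover almost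
  everything. Its source is Lebesgue's density theorem (\<open>negligible_density_gap\<close>): applied to
  the Radon-Nikodym density of the increments, the theorem yields approximate slopes along the coordinate axes
  (\<open>lipschitz_real_line_slopes\<close>), and the fact that porous sets are null turns these into approximate linear maps
  (\<open>partial_to_total_increment\<close>). On a piece,
  Hausdorff measure is compared with that of the linear image, which is a constant multiple of Lebesgue
  measure by uniqueness of translation invariant measures (\<open>hausdorff_measure_linear_image\<close>). Pieces on which the
  linear map is nearly degenerate have thin images of small measure (\<open>hausdorff_measure_thin_image\<close>), both for
  \<open>f\<close> and for \<open>\<pi> \<circ> f\<close>. The resulting errors vanish for each \<open>\<pi>\<close> as the pieces become more accurate, and
  Fatou's lemma yields the inequality (\<open>density_contractor_lipschitz_image\<close>).

  Measurability of the integrand holds because a cover of \<open>\<pi>(C)\<close>, for compact \<open>C\<close>, by open sets also covers the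
  images under linear maps close to \<open>\<pi>\<close>, and because a Borel rectifiable set is a countable union of compact
  sets up to a null set.
\<close>

section \<open>Hausdorff measure on Borel sets\<close>

lemma hausdorff_delta_le_cover:
  assumes "A \<subseteq> (\<Union>i. E i)" "\<And>i. bounded (E i)" "\<And>i. diameter (E i) \<le> \<delta>"
  shows "hausdorff_delta m \<delta> A \<le> (\<Sum>i. ennreal (unit_ball_vol (real m) / 2 ^ m * diameter (E i) ^ m))"
  unfolding hausdorff_delta_def by (rule INF_lower) (use assms in auto)

lemma hausdorff_delta_cover_less:
  assumes "hausdorff_delta m \<delta> A < t"
  obtains E where "A \<subseteq> (\<Union>i. E i)" "\<And>i. bounded (E i)" "\<And>i. diameter (E i) \<le> \<delta>"
    "(\<Sum>i. ennreal (unit_ball_vol (real m) / 2 ^ m * diameter (E i) ^ m)) < t"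
  using assms unfolding hausdorff_delta_def INF_less_iff by blast

lemma hausdorff_delta_antimono: "\<delta> \<le> \<delta>' \<Longrightarrow> hausdorff_delta m \<delta>' A \<le> hausdorff_delta m \<delta> A"
  unfolding hausdorff_delta_def by (rule INF_superset_mono) (auto intro: order_trans)

lemma hausdorff_delta_mono: "A \<subseteq> B \<Longrightarrow> hausdorff_delta m \<delta> A \<le> hausdorff_delta m \<delta> B"
  unfolding hausdorff_delta_def by (rule INF_superset_mono) auto

lemma hausdorff_delta_le_measure: "0 < \<delta> \<Longrightarrow> hausdorff_delta m \<delta> A \<le> hausdorff_measure m A"
  unfolding hausdorff_measure_def by (rule SUP_upper) auto

lemma hausdorff_measure_mono: "A \<subseteq> B \<Longrightarrow> hausdorff_measure m A \<le> hausdorff_measure m B"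
  unfolding hausdorff_measure_def by (rule SUP_mono') (rule hausdorff_delta_mono)

text \<open>The supremum over all scales runs along \<open>1 / (n + 1)\<close>; in this form monotone convergence applies.\<close>

lemma hausdorff_measure_seq: "hausdorff_measure m A = (SUP n. hausdorff_delta m (inverse (real (Suc n))) A)"
proof (rule antisym)
  show "hausdorff_measure m A \<le> (SUP n. hausdorff_delta m (inverse (real (Suc n))) A)"
    unfolding hausdorff_measure_def
  proof (rule SUP_least)
    fix \<delta> :: real assume "\<delta> \<in> {0<..}"
    then obtain n where "inverse (real (Suc n)) < \<delta>" using reals_Archimedean by auto
    then have "hausdorff_delta m \<delta> A \<le> hausdorff_delta m (inverse (real (Suc n))) A"
      by (intro hausdorff_delta_antimono) auto
    also have "\<dots> \<le> (SUP n. hausdorff_delta m (inverse (real (Suc n))) A)" by (rule SUP_upper) auto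
    finally show "hausdorff_delta m \<delta> A \<le> \<dots>" .
  qed
  show "(SUP n. hausdorff_delta m (inverse (real (Suc n))) A) \<le> hausdorff_measure m A"
    by (intro SUP_least hausdorff_delta_le_measure) auto
qed

lemma incseq_hausdorff_delta: "incseq (\<lambda>n. hausdorff_delta m (inverse (real (Suc n))) A)"
  by (intro incseq_SucI hausdorff_delta_antimono) (auto simp: field_simps)

lemma diameter_le_dist:
  assumes "0 \<le> c" "\<And>x y. x \<in> S \<Longrightarrow> y \<in> S \<Longrightarrow> dist x y \<le> c"
  shows "diameter S \<le> c"
  using assms unfolding diameter_def by (auto intro!: cSUP_least)

lemma hausdorff_measure_empty: "0 < m \<Longrightarrow> hausdorff_measure m {} = 0"
proof -
  assume "0 < m"
  then have "hausdorff_delta m \<delta> {} \<le> 0" if "\<delta> > 0" for \<delta>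
    using hausdorff_delta_le_cover[of "{}" "\<lambda>_. {}" \<delta> m] that by (simp add: zero_power)
  then show ?thesis unfolding hausdorff_measure_def by (intro antisym SUP_least) auto
qed

lemma suminf_ennreal_half_powers:
  assumes "0 < e" shows "(\<Sum>i. ennreal (e * (1/2) ^ Suc i)) = ennreal e"
proof (rule suminf_ennreal_eq)
  show "(\<lambda>i. e * (1/2) ^ Suc i) sums e" using sums_mult[OF power_half_series, of e] by simp
qed (use assms in simp)

lemma disjoint_family_natI:
  assumes "\<And>i j :: nat. i < j \<Longrightarrow> A i \<inter> A j = {}"
  shows "disjoint_family A"
  unfolding disjoint_family_on_def
proof (intro ballI impI)
  fix i j :: nat assume "i \<noteq> j"
  then show "A i \<inter> A j = {}" using assms[of i j] assms[of j i] by (cases "i < j") auto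
qed

lemma hausdorff_delta_UN:
  "hausdorff_delta m \<delta> (\<Union>i::nat. A i) \<le> (\<Sum>i. hausdorff_delta m \<delta> (A i))"
proof (rule ennreal_le_epsilon)
  fix e :: real assume e: "0 < e" and fin: "(\<Sum>i. hausdorff_delta m \<delta> (A i)) < top"
  let ?w = "\<lambda>E. ennreal (unit_ball_vol (real m) / 2 ^ m * diameter E ^ m)"
  define P where "P i E \<longleftrightarrow> A i \<subseteq> (\<Union>j::nat. E j) \<and> (\<forall>j. bounded (E j)) \<and> (\<forall>j. diameter (E j) \<le> \<delta>) \<and>
      (\<Sum>j. ?w (E j)) < hausdorff_delta m \<delta> (A i) + ennreal (e * (1/2) ^ Suc i)" for i E
  have "\<exists>E. P i E" for i
  proof -
    have "hausdorff_delta m \<delta> (A i) < top"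
    proof (rule ccontr)
      assume "\<not> hausdorff_delta m \<delta> (A i) < top"
      then have "hausdorff_delta m \<delta> (A i) = top" using top.not_eq_extremum by blast
      moreover have "hausdorff_delta m \<delta> (A i) \<le> (\<Sum>i. hausdorff_delta m \<delta> (A i))"
        using sum_le_suminf[OF summableI, of "{i}" "\<lambda>i. hausdorff_delta m \<delta> (A i)"] by simp
      ultimately show False using fin by (simp add: top_unique)
    qed
    moreover have "0 < ennreal (e * (1/2) ^ Suc i)" using e by simp
    ultimately have "hausdorff_delta m \<delta> (A i) < hausdorff_delta m \<delta> (A i) + ennreal (e * (1/2) ^ Suc i)"
      by (simp add: ennreal_add_left_cancel_less less_top)
    then show ?thesis by (rule hausdorff_delta_cover_less) (auto simp: P_def)
  qed
  then obtain E where "\<And>i. P i (E i)" by metis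
  then have E: "\<And>i. A i \<subseteq> (\<Union>j::nat. E i j)" "\<And>i j. bounded (E i j)" "\<And>i j. diameter (E i j) \<le> \<delta>"
      "\<And>i. (\<Sum>j. ?w (E i j)) < hausdorff_delta m \<delta> (A i) + ennreal (e * (1/2) ^ Suc i)"
    unfolding P_def by blast+
  define F where "F k = (case prod_decode k of (i, j) \<Rightarrow> E i j)" for k
  have "(\<Union>i. A i) \<subseteq> (\<Union>k. F k)"
  proof
    fix x assume "x \<in> (\<Union>i. A i)"
    then obtain i j where "x \<in> E i j" using E(1) by blast
    then have "x \<in> F (prod_encode (i, j))" by (simp add: F_def)
    then show "x \<in> (\<Union>k. F k)" by blast
  qed
  then have "hausdorff_delta m \<delta> (\<Union>i. A i) \<le> (\<Sum>k. ?w (F k))"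
    by (rule hausdorff_delta_le_cover) (auto simp: F_def E(2,3) split: prod.split)
  also have "(\<Sum>k. ?w (F k)) = (\<Sum>i. \<Sum>j. ?w (E i j))"
    unfolding F_def case_prod_unfold
    by (rule suminf_ennreal_2dimen[of "\<lambda>i. \<Sum>j. ?w (E i j)" "\<lambda>p. ?w (E (fst p) (snd p))", unfolded fst_conv snd_conv, OF refl])
  also have "\<dots> \<le> (\<Sum>i. hausdorff_delta m \<delta> (A i) + ennreal (e * (1/2) ^ Suc i))"
    by (rule suminf_le[OF less_imp_le[OF E(4)] summableI summableI])
  also have "\<dots> = (\<Sum>i. hausdorff_delta m \<delta> (A i)) + (\<Sum>i. ennreal (e * (1/2) ^ Suc i))"
    by (rule suminf_add[OF summableI summableI, symmetric])
  also have "(\<Sum>i. ennreal (e * (1/2) ^ Suc i)) = ennreal e" using e by (rule suminf_ennreal_half_powers)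
  finally show "hausdorff_delta m \<delta> (\<Union>i. A i) \<le> (\<Sum>i. hausdorff_delta m \<delta> (A i)) + ennreal e" .
qed

lemma hausdorff_measure_UN:
  "hausdorff_measure m (\<Union>i::nat. A i) \<le> (\<Sum>i. hausdorff_measure m (A i))"
  unfolding hausdorff_measure_def[of m "\<Union>i::nat. A i"]
proof (rule SUP_least)
  fix \<delta> :: real assume "\<delta> \<in> {0<..}"
  then show "hausdorff_delta m \<delta> (\<Union>i::nat. A i) \<le> (\<Sum>i. hausdorff_measure m (A i))"
    by (intro order_trans[OF hausdorff_delta_UN] suminf_le summableI hausdorff_delta_le_measure) auto
qed

lemma hausdorff_measure_Un:
  assumes "0 < m" shows "hausdorff_measure m (A \<union> B) \<le> hausdorff_measure m A + hausdorff_measure m B"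
proof -
  let ?D = "\<lambda>i::nat. if i = 0 then A else if i = 1 then B else {}"
  have U: "(\<Union>i. ?D i) = A \<union> B" by (auto split: if_splits)
  have S: "(\<Sum>i. hausdorff_measure m (?D i)) = (\<Sum>i\<in>{0,1}. hausdorff_measure m (?D i))"
    by (rule suminf_finite) (auto simp: hausdorff_measure_empty assms)
  have "(\<Sum>i\<in>{0,1::nat}. hausdorff_measure m (?D i)) = hausdorff_measure m A + hausdorff_measure m B" by simp
  then show ?thesis using hausdorff_measure_UN[of m ?D] unfolding U S by (rule ord_le_eq_trans[rotated])
qed

lemma hausdorff_measure_UN_null:
  assumes "\<And>i::nat. hausdorff_measure m (A i) = 0"
  shows "hausdorff_measure m (\<Union>i. A i) = 0"
  using hausdorff_measure_UN[of m A] unfolding assms by simp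

text \<open>Every estimate between Hausdorff measures below is an instance of this comparison. It relates two maps
  on a common parameter set, and not a map with its argument, so that it covers Lipschitz maps, inverses
  of expanding maps, and maps that are close to each other.\<close>

lemma hausdorff_measure_compare:
  fixes g :: "'p \<Rightarrow> 'b::metric_space" and h :: "'p \<Rightarrow> 'c::metric_space"
  assumes C: "0 < C" and le: "\<And>x y. x \<in> S \<Longrightarrow> y \<in> S \<Longrightarrow> dist (g x) (g y) \<le> C * dist (h x) (h y)"
  shows "hausdorff_measure m (g ` S) \<le> ennreal (C ^ m) * hausdorff_measure m (h ` S)"
  unfolding hausdorff_measure_def[of m "g ` S"]
proof (rule SUP_least)
  fix \<delta>' :: real assume "\<delta>' \<in> {0<..}"
  define \<delta> where "\<delta> = \<delta>' / C"
  have \<delta>: "\<delta> > 0" using C \<open>\<delta>' \<in> {0<..}\<close> by (auto simp: \<delta>_def)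
  let ?w = "\<lambda>E. unit_ball_vol (real m) / 2 ^ m * diameter E ^ m"
  have cp: "0 < ennreal (C ^ m)" using C by simp
  have "hausdorff_delta m \<delta>' (g ` S) / ennreal (C ^ m) \<le> hausdorff_delta m \<delta> (h ` S)"
    unfolding hausdorff_delta_def[of m \<delta>]
  proof (rule INF_greatest, safe)
    fix E :: "nat \<Rightarrow> 'c set"
    assume E: "h ` S \<subseteq> (\<Union>i. E i)" "\<forall>i. bounded (E i) \<and> diameter (E i) \<le> \<delta>"
    define F where "F i = g ` (S \<inter> h -` E i)" for i
    have dF: "dist u v \<le> C * diameter (E i)" if "u \<in> F i" "v \<in> F i" for u v i
    proof -
      obtain x y where xy: "x \<in> S" "y \<in> S" "h x \<in> E i" "h y \<in> E i" "u = g x" "v = g y"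
        using \<open>u \<in> F i\<close> \<open>v \<in> F i\<close> unfolding F_def by blast
      then have "dist u v \<le> C * dist (h x) (h y)" using le by simp
      also have "\<dots> \<le> C * diameter (E i)"
        using xy E(2) C by (intro mult_left_mono diameter_bounded_bound) auto
      finally show ?thesis .
    qed
    have bF: "bounded (F i)" for i
      unfolding bounded_two_points using dF by blast
    have diF: "diameter (F i) \<le> C * diameter (E i)" for i
      using dF E(2) C by (intro diameter_le_dist) (auto intro!: mult_nonneg_nonneg diameter_ge_0)
    have "hausdorff_delta m \<delta>' (g ` S) \<le> (\<Sum>i. ennreal (?w (F i)))"
    proof (rule hausdorff_delta_le_cover)
      show "g ` S \<subseteq> (\<Union>i. F i)"
      proof safe
        fix x assume "x \<in> S"
        then obtain i where "h x \<in> E i" using E(1) by blast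
        then have "g x \<in> F i" using \<open>x \<in> S\<close> by (auto simp: F_def)
        then show "g x \<in> (\<Union>i. F i)" by blast
      qed
      have "C * diameter (E i) \<le> C * \<delta>" for i using E(2) C by (intro mult_left_mono) auto
      then show "diameter (F i) \<le> \<delta>'" for i using diF[of i] C by (force simp: \<delta>_def intro: order_trans)
    qed (rule bF)
    also have "\<dots> \<le> (\<Sum>i. ennreal (C ^ m) * ennreal (?w (E i)))"
    proof (intro suminf_le summableI)
      fix i
      have "diameter (F i) ^ m \<le> (C * diameter (E i)) ^ m"
        by (rule power_mono[OF diF]) (rule diameter_ge_0[OF bF])
      then have "?w (F i) \<le> C ^ m * ?w (E i)"
        using mult_left_mono[of "diameter (F i) ^ m" "(C * diameter (E i)) ^ m" "unit_ball_vol (real m) / 2 ^ m"]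
        by (simp add: power_mult_distrib mult.left_commute)
      then show "ennreal (?w (F i)) \<le> ennreal (C ^ m) * ennreal (?w (E i))"
        using C by (subst ennreal_mult'[symmetric]) (auto intro: ennreal_leI)
    qed
    also have "\<dots> = ennreal (C ^ m) * (\<Sum>i. ennreal (?w (E i)))"
      by simp
    finally show "hausdorff_delta m \<delta>' (g ` S) / ennreal (C ^ m) \<le> (\<Sum>i. ennreal (?w (E i)))"
      using cp by (subst divide_le_posI_ennreal) (auto simp: mult.commute)
  qed
  also have "\<dots> \<le> hausdorff_measure m (h ` S)" using \<delta> by (rule hausdorff_delta_le_measure)
  finally have "ennreal (C ^ m) * (hausdorff_delta m \<delta>' (g ` S) / ennreal (C ^ m)) \<le>
      ennreal (C ^ m) * hausdorff_measure m (h ` S)"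
    by (intro mult_left_mono) auto
  also have "ennreal (C ^ m) * (hausdorff_delta m \<delta>' (g ` S) / ennreal (C ^ m)) = hausdorff_delta m \<delta>' (g ` S)"
    by (subst ennreal_times_divide, subst mult.commute, rule mult_divide_eq_ennreal) (use C in auto)
  finally show "hausdorff_delta m \<delta>' (g ` S) \<le> ennreal (C ^ m) * hausdorff_measure m (h ` S)" .
qed

text \<open>At scales below the distance of the two sets, no covering set meets both of them.\<close>

lemma hausdorff_measure_separated:
  fixes A B :: "'a::metric_space set"
  assumes m: "0 < m" and d: "0 < d" and sep: "\<And>x y. x \<in> A \<Longrightarrow> y \<in> B \<Longrightarrow> d \<le> dist x y"
  shows "hausdorff_measure m A + hausdorff_measure m B \<le> hausdorff_measure m (A \<union> B)"
proof -
  let ?w = "\<lambda>E. ennreal (unit_ball_vol (real m) / 2 ^ m * diameter E ^ m)"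
  have *: "hausdorff_delta m \<delta> A + hausdorff_delta m \<delta> B \<le> hausdorff_delta m \<delta> (A \<union> B)" if "\<delta> < d" "\<delta> > 0" for \<delta>
    unfolding hausdorff_delta_def[of m \<delta> "A \<union> B"]
  proof (rule INF_greatest, safe)
    fix E :: "nat \<Rightarrow> 'a set"
    assume E: "A \<union> B \<subseteq> (\<Union>i. E i)" "\<forall>i. bounded (E i) \<and> diameter (E i) \<le> \<delta>"
    let ?F = "\<lambda>D i. if E i \<inter> D = {} then {} else E i"
    have "hausdorff_delta m \<delta> D \<le> (\<Sum>i. ?w (?F D i))" if "D \<subseteq> A \<union> B" for D
      using that E \<open>\<delta> > 0\<close> by (intro hausdorff_delta_le_cover) (auto split: if_splits, fastforce)
    then have "hausdorff_delta m \<delta> A + hausdorff_delta m \<delta> B \<le> (\<Sum>i. ?w (?F A i)) + (\<Sum>i. ?w (?F B i))"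
      by (intro add_mono) auto
    also have "\<dots> = (\<Sum>i. ?w (?F A i) + ?w (?F B i))" by (intro suminf_add summableI)
    also have "\<dots> \<le> (\<Sum>i. ?w (E i))"
    proof (intro suminf_le summableI)
      fix i
      have "E i \<inter> A = {} \<or> E i \<inter> B = {}"
      proof (rule ccontr)
        assume "\<not> ?thesis"
        then obtain x y where xy: "x \<in> E i" "x \<in> A" "y \<in> E i" "y \<in> B" by blast
        then have "dist x y \<le> \<delta>" using E(2) diameter_bounded_bound[of "E i" x y] by (meson order_trans)
        then show False using sep[OF xy(2,4)] \<open>\<delta> < d\<close> by simp
      qed
      then show "?w (?F A i) + ?w (?F B i) \<le> ?w (E i)" using m by (auto simp: zero_power)
    qed
    finally show "hausdorff_delta m \<delta> A + hausdorff_delta m \<delta> B \<le> (\<Sum>i. ?w (E i))" .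
  qed
  have "hausdorff_measure m A + hausdorff_measure m B =
     (SUP n. hausdorff_delta m (inverse (real (Suc n))) A + hausdorff_delta m (inverse (real (Suc n))) B)"
    unfolding hausdorff_measure_seq by (rule ennreal_SUP_add[symmetric]) (rule incseq_hausdorff_delta)+
  also have "\<dots> \<le> hausdorff_measure m (A \<union> B)"
  proof (rule SUP_least)
    fix n
    define \<delta> where "\<delta> = min (inverse (real (Suc n))) (d / 2)"
    have "\<delta> > 0" "\<delta> < d" "\<delta> \<le> inverse (real (Suc n))" using d by (auto simp: \<delta>_def min_def)
    then have "hausdorff_delta m (inverse (real (Suc n))) A + hausdorff_delta m (inverse (real (Suc n))) B
       \<le> hausdorff_delta m \<delta> A + hausdorff_delta m \<delta> B"
      by (intro add_mono hausdorff_delta_antimono)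
    also have "\<dots> \<le> hausdorff_delta m \<delta> (A \<union> B)" by (rule *) fact+
    also have "\<dots> \<le> hausdorff_measure m (A \<union> B)" by (rule hausdorff_delta_le_measure) fact
    finally show "hausdorff_delta m (inverse (real (Suc n))) A + hausdorff_delta m (inverse (real (Suc n))) B \<le> \<dots>" .
  qed
  finally show ?thesis .
qed

text \<open>Caratheodory's argument. The part of \<open>A\<close> at distance at least \<open>1 / (n + 1)\<close> from \<open>C\<close> is separated
  from \<open>C\<close>. What is missing from \<open>A - C\<close> are the shells \<open>R k\<close> with \<open>k \<ge> n\<close>. Shells whose indices differ by
  at least two are separated, so the even ones and the odd ones each have summable measure when \<open>A\<close> has
  finite measure, and the missing part tends to zero.\<close>

lemma hausdorff_measure_closed_split:
  fixes C A :: "'a::metric_space set"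
  assumes m: "0 < m" and C: "closed C"
  shows "hausdorff_measure m (A \<inter> C) + hausdorff_measure m (A - C) \<le> hausdorff_measure m A"
proof (cases "C = {} \<or> hausdorff_measure m A = top")
  case True then show ?thesis using hausdorff_measure_empty[OF m, where 'a='a] by auto
next
  case False
  then have C0: "C \<noteq> {}" and fin: "hausdorff_measure m A < top" by (auto simp: less_top)
  define D where "D n = {x \<in> A. inverse (real (Suc n)) \<le> infdist x C}" for n
  define R where "R k = {x \<in> A. inverse (real (Suc (Suc k))) \<le> infdist x C \<and> infdist x C < inverse (real (Suc k))}" for k
  have posd: "infdist x C > 0" if "x \<notin> C" for x
    using that C C0 by (metis in_closed_iff_infdist_zero infdist_nonneg order_le_less)
  have AD: "hausdorff_measure m (A \<inter> C) + hausdorff_measure m (D n) \<le> hausdorff_measure m A" for n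
  proof -
    have "hausdorff_measure m (A \<inter> C) + hausdorff_measure m (D n) \<le> hausdorff_measure m ((A \<inter> C) \<union> D n)"
    proof (rule hausdorff_measure_separated[OF m, of "inverse (real (Suc n))"])
      fix x y assume "x \<in> A \<inter> C" "y \<in> D n"
      then show "inverse (real (Suc n)) \<le> dist x y"
        using infdist_le[of x C y] by (auto simp: D_def dist_commute)
    qed simp
    also have "\<dots> \<le> hausdorff_measure m A" by (rule hausdorff_measure_mono) (auto simp: D_def)
    finally show ?thesis .
  qed
  have fin_sum: "(\<Sum>k<n. hausdorff_measure m (R (2 * k + p))) \<le> hausdorff_measure m (\<Union>k<n. R (2 * k + p))" for n p
  proof (induction n)
    case (Suc n)
    show ?case
    proof (cases "n = 0")
      case False
      define q where "q = 2 * (n - 1) + p"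
      let ?d = "inverse (real (Suc (Suc q))) - inverse (real (Suc (Suc (Suc q))))"
      have d: "0 < ?d" by (simp add: less_imp_inverse_less)
      have "(\<Sum>k<Suc n. hausdorff_measure m (R (2 * k + p))) \<le>
        hausdorff_measure m (\<Union>k<n. R (2 * k + p)) + hausdorff_measure m (R (2 * n + p))"
        using Suc by (simp add: add_mono)
      also have "\<dots> \<le> hausdorff_measure m ((\<Union>k<n. R (2 * k + p)) \<union> R (2 * n + p))"
      proof (rule hausdorff_measure_separated[OF m d])
        fix x y assume "x \<in> (\<Union>k<n. R (2 * k + p))" and y: "y \<in> R (2 * n + p)"
        then obtain k where k: "k < n" "x \<in> R (2 * k + p)" by blast
        have "inverse (real (Suc (Suc q))) \<le> inverse (real (Suc (Suc (2 * k + p))))"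
          using k(1) by (intro le_imp_inverse_le) (auto simp: q_def)
        moreover have "inverse (real (Suc (2 * n + p))) \<le> inverse (real (Suc (Suc (Suc q))))"
          using False by (intro le_imp_inverse_le) (auto simp: q_def)
        ultimately show "?d \<le> dist x y"
          using k(2) y infdist_triangle[of x C y] unfolding R_def mem_Collect_eq by linarith
      qed
      also have "(\<Union>k<n. R (2 * k + p)) \<union> R (2 * n + p) = (\<Union>k<Suc n. R (2 * k + p))"
        by (auto simp: less_Suc_eq)
      finally show ?thesis .
    qed (simp add: lessThan_Suc)
  qed simp
  have half: "(\<Sum>k. hausdorff_measure m (R (2 * k + p))) \<le> hausdorff_measure m A" for p
    by (intro suminf_le_const summableI order_trans[OF fin_sum] hausdorff_measure_mono) (auto simp: R_def)
  have tail: "hausdorff_measure m (A - C) \<le> hausdorff_measure m (D n) + (\<Sum>k. hausdorff_measure m (R (k + n)))" for n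
  proof -
    have "A - C \<subseteq> D n \<union> (\<Union>k. R (k + n))"
    proof
      fix x assume x: "x \<in> A - C"
      show "x \<in> D n \<union> (\<Union>k. R (k + n))"
      proof (cases "x \<in> D n")
        case False
        then have lt: "infdist x C < inverse (real (Suc n))" using x by (auto simp: D_def)
        have "\<exists>N. inverse (real (Suc N)) \<le> infdist x C"
          using reals_Archimedean[OF posd[of x]] x by (auto intro: less_imp_le)
        define N where "N = (LEAST N. inverse (real (Suc N)) \<le> infdist x C)"
        have N: "inverse (real (Suc N)) \<le> infdist x C"
          unfolding N_def using \<open>\<exists>N. _\<close> by (rule LeastI_ex)
        have "n < N"
        proof (rule ccontr)
          assume "\<not> n < N"
          then have "inverse (real (Suc n)) \<le> inverse (real (Suc N))" by (intro le_imp_inverse_le) auto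
          then show False using N lt by linarith
        qed
        have "\<not> inverse (real (Suc (N - 1))) \<le> infdist x C"
          using not_less_Least[of "N - 1" "\<lambda>N. inverse (real (Suc N)) \<le> infdist x C", folded N_def] \<open>n < N\<close>
          by linarith
        then have "x \<in> R (N - 1)" using N x \<open>n < N\<close> by (auto simp: R_def)
        then have "x \<in> R ((N - 1 - n) + n)" using \<open>n < N\<close> by simp
        then show ?thesis by blast
      qed simp
    qed
    then have "hausdorff_measure m (A - C) \<le> hausdorff_measure m (D n \<union> (\<Union>k. R (k + n)))"
      by (rule hausdorff_measure_mono)
    also have "\<dots> \<le> hausdorff_measure m (D n) + (\<Sum>k. hausdorff_measure m (R (k + n)))"
      by (intro order_trans[OF hausdorff_measure_Un[OF m]] add_mono hausdorff_measure_UN order_refl)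
    finally show ?thesis .
  qed
  have "(\<Sum>k. hausdorff_measure m (R k)) < top"
  proof -
    have "(\<Sum>k<n. hausdorff_measure m (R k)) \<le>
        (\<Sum>k. hausdorff_measure m (R (2 * k))) + (\<Sum>k. hausdorff_measure m (R (2 * k + 1)))" for n
    proof -
      have "(\<Sum>k<n. hausdorff_measure m (R k)) \<le> (\<Sum>k<2 * n. hausdorff_measure m (R k))"
        by (rule sum_mono2) auto
      also have "\<dots> = (\<Sum>k<n. hausdorff_measure m (R (2 * k))) + (\<Sum>k<n. hausdorff_measure m (R (2 * k + 1)))"
        by (induction n) (auto simp: algebra_simps)
      also have "\<dots> \<le> (\<Sum>k. hausdorff_measure m (R (2 * k))) + (\<Sum>k. hausdorff_measure m (R (2 * k + 1)))"
        by (intro add_mono sum_le_suminf summableI) auto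
      finally show ?thesis .
    qed
    then have "(\<Sum>k. hausdorff_measure m (R k)) \<le>
        (\<Sum>k. hausdorff_measure m (R (2 * k))) + (\<Sum>k. hausdorff_measure m (R (2 * k + 1)))"
      by (intro suminf_le_const summableI)
    also have "\<dots> \<le> hausdorff_measure m A + hausdorff_measure m A"
      using half[of 0] half[of 1] by (intro add_mono) auto
    also have "\<dots> < top" using fin by simp
    finally show ?thesis .
  qed
  then have tail0: "(\<lambda>n. \<Sum>k. hausdorff_measure m (R (k + n))) \<longlonglongrightarrow> 0"
  proof -
    let ?r = "\<lambda>k. enn2real (hausdorff_measure m (R k))"
    have eq: "hausdorff_measure m (R k) = ennreal (?r k)" for k
    proof -
      have "hausdorff_measure m (R k) \<le> hausdorff_measure m A" by (rule hausdorff_measure_mono) (auto simp: R_def)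
      then have "hausdorff_measure m (R k) < top" using fin by (rule le_less_trans)
      then show ?thesis by (rule ennreal_enn2real[symmetric])
    qed
    have "(\<Sum>k. ennreal (?r k)) \<noteq> top" using \<open>(\<Sum>k. hausdorff_measure m (R k)) < top\<close> unfolding eq[symmetric] by simp
    then have sm: "summable ?r" by (intro summable_suminf_not_top) auto
    have "(\<lambda>n. \<Sum>k. ?r (k + n)) \<longlonglongrightarrow> 0" by (rule suminf_exist_split2) fact
    then have "(\<lambda>n. ennreal (\<Sum>k. ?r (k + n))) \<longlonglongrightarrow> ennreal 0" by (rule tendsto_ennrealI)
    moreover have "ennreal (\<Sum>k. ?r (k + n)) = (\<Sum>k. hausdorff_measure m (R (k + n)))" for n
    proof -
      have "(\<Sum>k. ennreal (?r (k + n))) = ennreal (\<Sum>k. ?r (k + n))"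
        using sm by (intro suminf_ennreal2) (auto intro: summable_ignore_initial_segment)
      then show ?thesis unfolding eq[symmetric] by simp
    qed
    ultimately show ?thesis by simp
  qed
  have "hausdorff_measure m (A \<inter> C) + hausdorff_measure m (A - C) \<le>
      hausdorff_measure m A + (\<Sum>k. hausdorff_measure m (R (k + n)))" for n
  proof -
    have "hausdorff_measure m (A \<inter> C) + hausdorff_measure m (A - C) \<le>
       hausdorff_measure m (A \<inter> C) + (hausdorff_measure m (D n) + (\<Sum>k. hausdorff_measure m (R (k + n))))"
      by (intro add_mono tail order_refl)
    also have "\<dots> \<le> hausdorff_measure m A + (\<Sum>k. hausdorff_measure m (R (k + n)))"
      using AD[of n] by (simp add: add.assoc[symmetric] add_mono)
    finally show ?thesis .
  qed
  moreover have "(\<lambda>n. hausdorff_measure m A + (\<Sum>k. hausdorff_measure m (R (k + n)))) \<longlonglongrightarrow> hausdorff_measure m A + 0"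
    by (intro tendsto_add tendsto_const tail0)
  ultimately show ?thesis by (intro LIMSEQ_le_const[where X = "\<lambda>n. hausdorff_measure m A + (\<Sum>k. hausdorff_measure m (R (k + n)))"]) auto
qed

text \<open>Hausdorff measure is only an outer measure on arbitrary sets. This is its restriction to the Borel sets as a
  measure, for which the library's continuity and additivity theorems are available.\<close>

definition hausdorff_borel :: "nat \<Rightarrow> 'a::metric_space measure" where
  "hausdorff_borel m = measure_of UNIV (sets borel) (hausdorff_measure m)"

lemma space_hausdorff_borel [simp]: "space (hausdorff_borel m) = UNIV"
  by (simp add: hausdorff_borel_def)

lemma sets_hausdorff_borel [simp, measurable_cong]: "sets (hausdorff_borel m) = sets borel"
  using sets.sigma_sets_eq[of borel] by (simp add: hausdorff_borel_def)

lemma emeasure_hausdorff_borel: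
  fixes A :: "'a::metric_space set"
  assumes m: "0 < m" and A: "A \<in> sets borel"
  shows "emeasure (hausdorff_borel m) A = hausdorff_measure m A"
proof -
  let ?f = "hausdorff_measure m :: 'a set \<Rightarrow> ennreal"
  let ?L = "lambda_system (UNIV :: 'a set) (Pow UNIV) ?f"
  interpret P: sigma_algebra "UNIV :: 'a set" "Pow UNIV" by (rule sigma_algebra_Pow)
  have oms: "outer_measure_space (Pow UNIV) ?f"
    unfolding outer_measure_space_def positive_def increasing_def countably_subadditive_def
    by (auto intro: hausdorff_measure_empty[OF m] hausdorff_measure_mono hausdorff_measure_UN)
  have ms: "measure_space UNIV ?L ?f" using oms by (rule P.caratheodory_lemma)
  then have sa: "sigma_algebra UNIV ?L" by (simp add: measure_space_def)
  have "closed C \<Longrightarrow> C \<in> ?L" for C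
    unfolding P.lambda_system_eq
  proof safe
    fix X :: "'a set" assume "closed C"
    have "?f X \<le> ?f (X \<inter> C) + ?f (X - C)"
      using hausdorff_measure_Un[OF m, of "X \<inter> C" "X - C"] by (simp add: Int_Diff_Un)
    then show "?f (X \<inter> C) + ?f (X - C) = ?f X"
      using hausdorff_measure_closed_split[OF m \<open>closed C\<close>, of X] by (rule antisym[rotated])
  qed auto
  then have "sigma_sets UNIV (Collect closed) \<subseteq> ?L"
    by (intro sigma_algebra.sigma_sets_subset[OF sa]) auto
  then have sub: "sets borel \<subseteq> ?L" by (simp add: borel_eq_closed)
  have "measure_space UNIV (sets borel) ?f"
    using ms _ sub by (rule measure_down) (use sets.sigma_algebra_axioms[of borel] in simp)
  then show ?thesis
    using A by (intro emeasure_measure_of_sigma[of UNIV "sets borel" ?f, folded hausdorff_borel_def])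
      (auto simp: measure_space_def)
qed

section \<open>Density, porosity and null sets\<close>

text \<open>A set that misses a fixed proportion of arbitrarily small balls around each of its points is null. Let \<open>s\<close>
  be its outer measure; if \<open>s\<close> is positive, take an open \<open>T\<close> around it such that \<open>q\<close> times its measure is below \<open>s\<close>. By Vitali's theorem,
  disjoint balls inside \<open>T\<close> cover almost all of the set, and in each of them it occupies at most the
  proportion \<open>q\<close>; so its outer measure is at most \<open>q\<close> times the measure of \<open>T\<close>. Outer measure is
  used because the exceptional sets of the applications are not known to be measurable.\<close>

lemma negligible_density_gap_bounded:
  fixes S :: "'n::euclidean_space set"
  assumes q: "0 \<le> q" "q < 1" and S: "bounded S"
    and gap: "\<And>x r. x \<in> S \<Longrightarrow> 0 < r \<Longrightarrow> \<exists>d U. 0 < d \<and> d \<le> r \<and> U \<in> sets lebesgue \<and> S \<inter> ball x d \<subseteq> U \<and>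
      emeasure lebesgue U \<le> ennreal q * emeasure lebesgue (ball x d)"
  shows "negligible S"
proof -
  define Q where "Q = {measure lebesgue T | T. open T \<and> S \<subseteq> T \<and> T \<in> lmeasurable}"
  define s where "s = Inf Q"
  obtain a where a: "S \<subseteq> ball 0 a" using S bounded_subset_ballD by blast
  have Qne: "Q \<noteq> {}" unfolding Q_def using a by (auto intro!: exI[of _ "ball 0 a"])
  have Qbd: "bdd_below Q" by (rule bdd_belowI[of _ 0]) (auto simp: Q_def)
  have s0: "0 \<le> s" unfolding s_def by (rule cInf_greatest[OF Qne]) (auto simp: Q_def)
  have ex: "\<exists>T. open T \<and> S \<subseteq> T \<and> T \<in> lmeasurable \<and> measure lebesgue T < s + e" if "e > 0" for e
    using cInf_lessD[OF Qne, of "s + e"] that unfolding s_def Q_def by auto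
  show ?thesis
  proof (cases "s = 0")
    case True
    show ?thesis unfolding negligible_outer
    proof (intro allI impI)
      fix e :: real assume "e > 0"
      then show "\<exists>T. S \<subseteq> T \<and> T \<in> lmeasurable \<and> measure lebesgue T < e"
        using ex[of e] True by auto
    qed
  next
    case False
    then have s: "0 < s" using s0 by simp
    obtain T where T: "open T" "S \<subseteq> T" "T \<in> lmeasurable" "measure lebesgue T < s + (1 - q) * s / 2"
      using ex[of "(1 - q) * s / 2"] s q by auto
    have qT: "q * measure lebesgue T < s"
    proof -
      have "q * measure lebesgue T \<le> q * (s + (1 - q) * s / 2)" using T(4) q by (intro mult_left_mono) auto
      also have "\<dots> < s"
      proof -
        have "0 < (1 - q) * (1 - q / 2) * s" using q s by (intro mult_pos_pos) auto
        also have "\<dots> = s - q * (s + (1 - q) * s / 2)" by (simp add: field_simps)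
        finally show ?thesis by simp
      qed
      finally show ?thesis .
    qed
    define K where "K = {p. fst p \<in> S \<and> 0 < snd p \<and> ball (fst p) (snd p) \<subseteq> T \<and>
        (\<exists>U. U \<in> sets lebesgue \<and> S \<inter> ball (fst p) (snd p) \<subseteq> U \<and>
          emeasure lebesgue U \<le> ennreal q * emeasure lebesgue (ball (fst p) (snd p)))}"
    obtain C where C: "countable C" "C \<subseteq> K"
       and disj: "pairwise (\<lambda>i j. disjnt (ball (fst i) (snd i)) (ball (fst j) (snd j))) C"
       and neg: "negligible (S - (\<Union>i \<in> C. ball (fst i) (snd i)))"
    proof (rule Vitali_covering_theorem_balls[of S K fst snd])
      fix x and d :: real assume x: "x \<in> S" and d: "0 < d"
      obtain k where k: "0 < k" "ball x k \<subseteq> T" using T(1,2) x openE by blast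
      obtain r U where r: "0 < r" "r \<le> min (d / 2) k" "U \<in> sets lebesgue" "S \<inter> ball x r \<subseteq> U"
          "emeasure lebesgue U \<le> ennreal q * emeasure lebesgue (ball x r)"
        using gap[OF x, of "min (d / 2) k"] d k by auto
      have "ball x r \<subseteq> T" using r k by (meson subset_ball min.boundedE order_trans)
      then have "(x, r) \<in> K" unfolding K_def using r x by auto
      then show "\<exists>i. i \<in> K \<and> x \<in> ball (fst i) (snd i) \<and> snd i < d"
        using r d by (intro exI[of _ "(x, r)"]) auto
    qed
    have "\<forall>p\<in>C. \<exists>U. U \<in> sets lebesgue \<and> S \<inter> ball (fst p) (snd p) \<subseteq> U \<and>
          emeasure lebesgue U \<le> ennreal q * emeasure lebesgue (ball (fst p) (snd p))"
      using C(2) unfolding K_def by blast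
    then obtain U where U: "\<And>p. p \<in> C \<Longrightarrow> U p \<in> sets lebesgue"
        "\<And>p. p \<in> C \<Longrightarrow> S \<inter> ball (fst p) (snd p) \<subseteq> U p"
        "\<And>p. p \<in> C \<Longrightarrow> emeasure lebesgue (U p) \<le> ennreal q * emeasure lebesgue (ball (fst p) (snd p))"
      by (metis (no_types, lifting))
    define V where "V p = U p \<inter> ball (fst p) (snd p)" for p
    have dfb: "disjoint_family_on (\<lambda>p. ball (fst p) (snd p)) C"
      using disj unfolding disjoint_family_on_def pairwise_def disjnt_def by blast
    then have dfV: "disjoint_family_on V C" unfolding disjoint_family_on_def V_def by blast
    have Vm: "V p \<in> sets lebesgue" if "p \<in> C" for p using U(1)[OF that] by (auto simp: V_def)
    have "emeasure lebesgue (\<Union>p\<in>C. V p) = (\<integral>\<^sup>+p. emeasure lebesgue (V p) \<partial>count_space C)"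
      by (rule emeasure_UN_countable[OF Vm C(1) dfV])
    also have "\<dots> \<le> (\<integral>\<^sup>+p. ennreal q * emeasure lebesgue (ball (fst p) (snd p)) \<partial>count_space C)"
    proof (rule nn_integral_mono)
      fix p assume "p \<in> space (count_space C)"
      then have p: "p \<in> C" by simp
      have "emeasure lebesgue (V p) \<le> emeasure lebesgue (U p)"
        by (rule emeasure_mono) (auto simp: V_def U(1)[OF p])
      then show "emeasure lebesgue (V p) \<le> ennreal q * emeasure lebesgue (ball (fst p) (snd p))"
        using U(3)[OF p] by (rule order_trans)
    qed
    also have "\<dots> = ennreal q * (\<integral>\<^sup>+p. emeasure lebesgue (ball (fst p) (snd p)) \<partial>count_space C)"
      by (rule nn_integral_cmult) simp
    also have "(\<integral>\<^sup>+p. emeasure lebesgue (ball (fst p) (snd p)) \<partial>count_space C) =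
        emeasure lebesgue (\<Union>p\<in>C. ball (fst p) (snd p))"
      by (rule emeasure_UN_countable[symmetric, OF _ C(1) dfb]) auto
    also have "\<dots> \<le> emeasure lebesgue T"
      using C(2) T(3) by (intro emeasure_mono) (auto simp: K_def fmeasurableD)
    also have "emeasure lebesgue T = ennreal (measure lebesgue T)"
      using T(3) by (rule emeasure_eq_measure2)
    also have "ennreal q * ennreal (measure lebesgue T) = ennreal (q * measure lebesgue T)"
      using q by (simp add: ennreal_mult)
    finally have V1: "emeasure lebesgue (\<Union>p\<in>C. V p) \<le> ennreal (q * measure lebesgue T)"
      by (simp add: mult_left_mono)
    have Vs: "(\<Union>p\<in>C. V p) \<in> sets lebesgue" using Vm C(1) by (intro sets.countable_UN') auto
    have VL: "(\<Union>p\<in>C. V p) \<in> lmeasurable"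
      using Vs V1 by (intro fmeasurableI) (auto intro: le_less_trans)
    define N where "N = S - (\<Union>i \<in> C. ball (fst i) (snd i))"
    have NL: "N \<in> lmeasurable" "measure lebesgue N = 0"
      using neg unfolding N_def by (auto simp: negligible_imp_measurable negligible_imp_measure0)
    have VN: "(\<Union>p\<in>C. V p) \<union> N \<in> lmeasurable" using VL NL by blast
    have "measure lebesgue ((\<Union>p\<in>C. V p) \<union> N) \<le> measure lebesgue (\<Union>p\<in>C. V p) + measure lebesgue N"
      using VL NL by (intro measure_Un_le) (auto simp: fmeasurableD)
    also have "\<dots> \<le> q * measure lebesgue T"
      using V1 NL q VL by (simp add: emeasure_eq_measure2)
    finally have M1: "measure lebesgue ((\<Union>p\<in>C. V p) \<union> N) < s" using qT by simp
    have SM: "S \<subseteq> (\<Union>p\<in>C. V p) \<union> N" using U(2) unfolding V_def N_def by blast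
    let ?X = "(\<Union>p\<in>C. V p) \<union> N"
    obtain T' where T': "open T'" "?X \<subseteq> T'" "T' - ?X \<in> lmeasurable"
        "emeasure lebesgue (T' - ?X) < ennreal (s - measure lebesgue ?X)"
      using sets_lebesgue_outer_open[OF fmeasurableD[OF VN], of "s - measure lebesgue ?X"] M1 by auto
    have T'eq: "T' = ?X \<union> (T' - ?X)" using T'(2) by blast
    have T'm: "T' \<in> lmeasurable" by (subst T'eq) (rule fmeasurable.Un[OF VN T'(3)])
    have "measure lebesgue T' \<le> measure lebesgue ?X + measure lebesgue (T' - ?X)"
      by (subst T'eq) (rule measure_Un_le; use VN T'(3) in \<open>auto dest: fmeasurableD\<close>)
    also have "measure lebesgue (T' - ?X) < s - measure lebesgue ?X"
      using T'(3,4) M1 by (simp add: emeasure_eq_measure2 ennreal_less_iff)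
    finally have T's: "measure lebesgue T' < s" by simp
    have "measure lebesgue T' \<in> Q" unfolding Q_def using T'(1,2) T'm SM by blast
    then have "s \<le> measure lebesgue T'" unfolding s_def by (rule cInf_lower[OF _ Qbd])
    then show ?thesis using T's by simp
  qed
qed

lemma negligible_density_gap:
  fixes S :: "'n::euclidean_space set"
  assumes q: "0 \<le> q" "q < 1"
    and gap: "\<And>x r. x \<in> S \<Longrightarrow> 0 < r \<Longrightarrow> \<exists>d U. 0 < d \<and> d \<le> r \<and> U \<in> sets lebesgue \<and> S \<inter> ball x d \<subseteq> U \<and>
      emeasure lebesgue U \<le> ennreal q * emeasure lebesgue (ball x d)"
  shows "negligible S"
proof -
  have "negligible (S \<inter> ball 0 (real n))" for n
  proof (rule negligible_density_gap_bounded[OF q])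
    show "bounded (S \<inter> ball 0 (real n))" by (meson bounded_Int bounded_ball)
    fix x :: 'n and r :: real assume "x \<in> S \<inter> ball 0 (real n)" "0 < r"
    then obtain d U where "0 < d" "d \<le> r" "U \<in> sets lebesgue" "S \<inter> ball x d \<subseteq> U"
       "emeasure lebesgue U \<le> ennreal q * emeasure lebesgue (ball x d)"
      using gap[of x r] by auto
    then show "\<exists>d U. 0 < d \<and> d \<le> r \<and> U \<in> sets lebesgue \<and> S \<inter> ball 0 (real n) \<inter> ball x d \<subseteq> U \<and>
      emeasure lebesgue U \<le> ennreal q * emeasure lebesgue (ball x d)" by blast
  qed
  then have "negligible (\<Union>n. S \<inter> ball 0 (real n))" by (intro negligible_countable_Union) auto
  moreover have "S \<subseteq> (\<Union>n. S \<inter> ball 0 (real n))"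
    using reals_Archimedean2 by fastforce
  ultimately show ?thesis by (rule negligible_subset)
qed

text \<open>A hole of relative size \<open>c\<close> at \<open>x + h\<close> fills a fixed proportion of the ball of radius
  \<open>(1 + c) * norm h\<close> around \<open>x\<close>.\<close>

lemma negligible_porous:
  fixes A :: "'n::euclidean_space set"
  assumes c: "0 < c"
  shows "negligible {x\<in>A. \<forall>r>0. \<exists>h. 0 < norm h \<and> norm h < r \<and> ball (x + h) (c * norm h) \<inter> A = {}}"
proof (rule negligible_density_gap)
  define k where "k = (c / (1 + c)) ^ DIM('n)"
  have k: "0 < k" "k \<le> 1" using c by (auto simp: k_def power_le_one)
  show "0 \<le> 1 - k" "1 - k < 1" using k by auto
  fix x and r :: real
  assume x: "x \<in> {x\<in>A. \<forall>r>0. \<exists>h. 0 < norm h \<and> norm h < r \<and> ball (x + h) (c * norm h) \<inter> A = {}}" and r: "0 < r"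
  have "0 < r / (1 + c)" using r c by simp
  then obtain h where h: "0 < norm h" "norm h < r / (1 + c)" "ball (x + h) (c * norm h) \<inter> A = {}"
    using x by blast
  define d where "d = (1 + c) * norm h"
  have d: "0 < d" unfolding d_def using h(1) c by (intro mult_pos_pos) auto
  have dr: "d \<le> r" using h c by (auto simp: d_def field_simps)
  have sub: "ball (x + h) (c * norm h) \<subseteq> ball x d"
  proof
    fix y assume "y \<in> ball (x + h) (c * norm h)"
    then have "dist (x + h) y < c * norm h" by simp
    moreover have "dist x y \<le> dist x (x + h) + dist (x + h) y" by (rule dist_triangle)
    moreover have "dist x (x + h) = norm h" by (simp add: dist_norm)
    ultimately have "dist x y < norm h + c * norm h" by linarith
    then show "y \<in> ball x d" by (simp add: d_def algebra_simps)
  qed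
  let ?U = "ball x d - ball (x + h) (c * norm h)"
  let ?v = "unit_ball_vol (real DIM('n))"
  have e1: "emeasure lborel (ball y t) = ennreal (?v * t ^ DIM('n))" if "0 \<le> t" for y :: 'n and t
    using that by (simp add: emeasure_ball)
  have fb: "emeasure lborel (ball (x + h) (c * norm h)) < top"
    using emeasure_bounded_finite[OF bounded_ball] by simp
  have "emeasure lebesgue ?U = emeasure lebesgue (ball x d) - emeasure lebesgue (ball (x + h) (c * norm h))"
    using sub fb by (intro emeasure_Diff) auto
  also have "\<dots> = ennreal (?v * d ^ DIM('n)) - ennreal (?v * (c * norm h) ^ DIM('n))"
    using c d by (simp add: e1)
  also have "\<dots> = ennreal (?v * d ^ DIM('n) - ?v * (c * norm h) ^ DIM('n))"
    using c by (intro ennreal_minus) auto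
  also have "(c * norm h) ^ DIM('n) = k * d ^ DIM('n)"
    unfolding k_def d_def power_mult_distrib[symmetric] using c by simp
  also have "?v * d ^ DIM('n) - ?v * (k * d ^ DIM('n)) = (1 - k) * (?v * d ^ DIM('n))"
    by (simp add: algebra_simps)
  also have "ennreal \<dots> = ennreal (1 - k) * emeasure lebesgue (ball x d)"
    using k d by (simp add: e1 ennreal_mult)
  finally have "emeasure lebesgue ?U \<le> ennreal (1 - k) * emeasure lebesgue (ball x d)" by simp
  moreover have "{x\<in>A. \<forall>r>0. \<exists>h. 0 < norm h \<and> norm h < r \<and> ball (x + h) (c * norm h) \<inter> A = {}} \<inter> ball x d \<subseteq> ?U"
    using h(3) by blast
  ultimately show "\<exists>d U. 0 < d \<and> d \<le> r \<and> U \<in> sets lebesgue \<and>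
      {x\<in>A. \<forall>r>0. \<exists>h. 0 < norm h \<and> norm h < r \<and> ball (x + h) (c * norm h) \<inter> A = {}} \<inter> ball x d \<subseteq> U \<and>
      emeasure lebesgue U \<le> ennreal (1 - k) * emeasure lebesgue (ball x d)"
    using d dr by (intro exI[of _ d] exI[of _ ?U]) auto
qed

lemma ennreal_le_of_add_le:
  fixes a b c d :: ennreal
  assumes "a + c \<le> d" "d = b + c" "c \<noteq> top"
  shows "a \<le> b"
  using assms by (auto simp: add.commute ennreal_add_left_cancel_le)

text \<open>Lebesgue's density theorem, in the form that almost every point of \<open>A\<close> has a scale below which the
  complement of \<open>A\<close> occupies less than the proportion \<open>c\<close> of each ball.\<close>

lemma negligible_not_density_points:
  fixes A :: "'n::euclidean_space set"
  assumes c: "0 < c" "c < 1" and A: "A \<in> sets lebesgue"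
  shows "negligible {x\<in>A. \<forall>r>0. \<exists>d. 0 < d \<and> d \<le> r \<and>
     ennreal c * emeasure lebesgue (ball x d) \<le> emeasure lebesgue (ball x d - A)}" (is "negligible ?P")
proof (rule negligible_density_gap)
  show "0 \<le> 1 - c" "1 - c < 1" using c by auto
  fix x and r :: real assume x: "x \<in> ?P" and r: "0 < r"
  then obtain d where d: "0 < d" "d \<le> r" "ennreal c * emeasure lebesgue (ball x d) \<le> emeasure lebesgue (ball x d - A)"
    by blast
  let ?b = "emeasure lebesgue (ball x d)"
  have fin: "?b < top" using emeasure_bounded_finite[of "ball x d"] by simp
  have "?b = emeasure lebesgue (ball x d \<inter> A) + emeasure lebesgue (ball x d - A)"
    using A by (subst plus_emeasure) (auto simp: Int_Diff_Un)
  then have "emeasure lebesgue (ball x d \<inter> A) + ennreal c * ?b \<le> ?b"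
    using d(3) by (metis add_left_mono)
  moreover have "?b = ennreal (1 - c) * ?b + ennreal c * ?b"
    using c by (simp flip: distrib_right ennreal_plus)
  moreover have "ennreal c * ?b \<noteq> top" using fin by (simp add: ennreal_mult_eq_top_iff)
  ultimately have "emeasure lebesgue (ball x d \<inter> A) \<le> ennreal (1 - c) * ?b"
    by (rule ennreal_le_of_add_le)
  then show "\<exists>d U. 0 < d \<and> d \<le> r \<and> U \<in> sets lebesgue \<and> ?P \<inter> ball x d \<subseteq> U \<and>
      emeasure lebesgue U \<le> ennreal (1 - c) * emeasure lebesgue (ball x d)"
    using d A by (intro exI[of _ d] exI[of _ "ball x d \<inter> A"]) auto
qed

text \<open>Fubini's theorem without a choice of coordinates: average the translates of \<open>N\<close> along \<open>t *\<^sub>R e\<close> for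
  \<open>t\<close> in the unit interval, and exchange the order of integration.\<close>

lemma null_set_of_null_lines:
  fixes N :: "'n::euclidean_space set"
  assumes N: "N \<in> sets borel" and lines: "\<And>x. {t. x + t *\<^sub>R e \<in> N} \<in> null_sets lborel"
  shows "N \<in> null_sets lborel"
proof -
  let ?g = "\<lambda>t x. indicator {0..1::real} t * indicator N (x + t *\<^sub>R e) :: ennreal"
  have meas: "(\<lambda>p. ?g (snd p) (fst p)) \<in> borel_measurable (lborel \<Otimes>\<^sub>M lborel)"
    using N by measurable
  have shift: "(\<integral>\<^sup>+x. indicator N (x + t *\<^sub>R e) \<partial>lborel) = emeasure lborel N" for t
  proof -
    have "emeasure lborel N = (\<integral>\<^sup>+x. indicator N x \<partial>distr lborel borel ((+) (t *\<^sub>R e)))"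
      using N by (simp add: lborel_distr_plus)
    also have "\<dots> = (\<integral>\<^sup>+x. indicator N (t *\<^sub>R e + x) \<partial>lborel)"
      using N by (intro nn_integral_distr) auto
    finally show ?thesis by (simp add: add.commute)
  qed
  have "emeasure lborel N = (\<integral>\<^sup>+t. indicator {0..1::real} t * emeasure lborel N \<partial>lborel)"
    by (simp add: nn_integral_multc)
  also have "\<dots> = (\<integral>\<^sup>+t. \<integral>\<^sup>+x. ?g t x \<partial>lborel \<partial>lborel)"
    using N by (intro nn_integral_cong) (simp add: shift nn_integral_cmult)
  also have "\<dots> = (\<integral>\<^sup>+x. \<integral>\<^sup>+t. ?g t x \<partial>lborel \<partial>lborel)"
    using lborel_pair.Fubini'[of "\<lambda>x t. ?g t x"] meas by (simp add: case_prod_unfold)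
  also have "\<dots> = (\<integral>\<^sup>+x. 0 \<partial>(lborel :: 'n measure))"
  proof (intro nn_integral_cong)
    fix x :: 'n
    have "(\<integral>\<^sup>+t. ?g t x \<partial>lborel) \<le> (\<integral>\<^sup>+t. indicator {t. x + t *\<^sub>R e \<in> N} t \<partial>lborel)"
      by (intro nn_integral_mono) (auto simp: indicator_def)
    also have "\<dots> = emeasure lborel {t. x + t *\<^sub>R e \<in> N}"
      using lines[of x] by (intro nn_integral_indicator) auto
    also have "\<dots> = 0" using lines[of x] by auto
    finally show "(\<integral>\<^sup>+t. ?g t x \<partial>lborel) = 0" by simp
  qed
  finally show ?thesis using N by (intro null_setsI) auto
qed

section \<open>Coordinates in finite dimensional normed spaces\<close>

text \<open>In a normed space the coordinates with respect to finitely many independent vectors are bounded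
  functionals. The induction step uses that a vector \<open>x\<close> outside \<open>span B\<close> has positive distance from it: if
  elements of the span converge to \<open>x\<close>, their coefficients are Cauchy by the induction hypothesis, and
  then the limit lies in the span.\<close>

lemma independent_coeff_bound:
  fixes B :: "'a::real_normed_vector set"
  assumes "finite B" "independent B"
  shows "\<exists>K>0. \<forall>c. \<forall>b\<in>B. \<bar>c b\<bar> \<le> K * norm (\<Sum>b\<in>B. c b *\<^sub>R b)"
  using assms
proof (induction B rule: finite_induct)
  case empty
  show ?case by (rule exI[of _ 1]) auto
next
  case (insert x B)
  then have ind: "independent B" and x: "x \<notin> span B" by (auto simp: independent_insert)
  then obtain K where K: "K > 0" "\<And>c b. b \<in> B \<Longrightarrow> \<bar>c b\<bar> \<le> K * norm (\<Sum>b\<in>B. c b *\<^sub>R b)"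
    using insert.IH by blast
  have "\<exists>d>0. \<forall>v\<in>span B. d \<le> norm (x - v)"
  proof (rule ccontr)
    assume "\<not> ?thesis"
    then have "\<forall>n. \<exists>v\<in>span B. norm (x - v) < inverse (real (Suc n))"
      by (metis inverse_positive_iff_positive not_le of_nat_0_less_iff zero_less_Suc)
    then obtain v where v: "\<And>n. v n \<in> span B" "\<And>n. norm (x - v n) < inverse (real (Suc n))" by metis
    have "\<forall>n. \<exists>c. v n = (\<Sum>b\<in>B. c b *\<^sub>R b)"
      using v(1) insert.hyps(1) by (auto simp: span_finite)
    then obtain c where c: "\<And>n. v n = (\<Sum>b\<in>B. c n b *\<^sub>R b)" by metis
    have vx: "v \<longlonglongrightarrow> x"
    proof (rule metric_LIMSEQ_I)
      fix r :: real assume "0 < r"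
      then obtain N where N: "inverse (real (Suc N)) < r" using reals_Archimedean by blast
      have "dist (v n) x < r" if "N \<le> n" for n
      proof -
        have "inverse (real (Suc n)) \<le> inverse (real (Suc N))" using that by (intro le_imp_inverse_le) auto
        then have "norm (x - v n) < r" using v(2)[of n] N by linarith
        then show ?thesis by (simp add: dist_norm norm_minus_commute)
      qed
      then show "\<exists>N. \<forall>n\<ge>N. dist (v n) x < r" by blast
    qed
    then have Cv: "Cauchy v" by (rule LIMSEQ_imp_Cauchy)
    have "convergent (\<lambda>n. c n b)" if b: "b \<in> B" for b
    proof -
      have "Cauchy (\<lambda>n. c n b)"
      proof (rule CauchyI)
        fix e :: real assume "0 < e"
        then obtain N where N: "\<And>n k. n \<ge> N \<Longrightarrow> k \<ge> N \<Longrightarrow> norm (v n - v k) < e / K"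
          using Cv K(1) CauchyD[of v "e / K"] by (metis divide_pos_pos)
        have "norm (c n b - c k b) < e" if "n \<ge> N" "k \<ge> N" for n k
        proof -
          have "\<bar>c n b - c k b\<bar> \<le> K * norm (\<Sum>b\<in>B. (c n b - c k b) *\<^sub>R b)"
            by (rule K(2)[OF b, of "\<lambda>b. c n b - c k b"])
          also have "(\<Sum>b\<in>B. (c n b - c k b) *\<^sub>R b) = v n - v k"
            by (simp add: c scaleR_left_diff_distrib sum_subtractf)
          also have "K * norm (v n - v k) < K * (e / K)" using N[OF that] K(1) by (intro mult_strict_left_mono)
          finally show ?thesis using K(1) by simp
        qed
        then show "\<exists>M. \<forall>n\<ge>M. \<forall>k\<ge>M. norm (c n b - c k b) < e" by blast
      qed
      then show ?thesis by (rule Cauchy_convergent)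
    qed
    then have "\<forall>b\<in>B. \<exists>l. (\<lambda>n. c n b) \<longlonglongrightarrow> l" unfolding convergent_def by blast
    then obtain l where l: "\<And>b. b \<in> B \<Longrightarrow> (\<lambda>n. c n b) \<longlonglongrightarrow> l b" by metis
    have "(\<lambda>n. \<Sum>b\<in>B. c n b *\<^sub>R b) \<longlonglongrightarrow> (\<Sum>b\<in>B. l b *\<^sub>R b)"
      by (intro tendsto_sum tendsto_scaleR l tendsto_const)
    then have "v \<longlonglongrightarrow> (\<Sum>b\<in>B. l b *\<^sub>R b)" unfolding c[symmetric] .
    then have "x = (\<Sum>b\<in>B. l b *\<^sub>R b)" using vx LIMSEQ_unique by blast
    then have "x \<in> span B" by (simp add: span_sum span_scale span_base)
    then show False using x by blast
  qed
  then obtain d where d: "d > 0" "\<And>v. v \<in> span B \<Longrightarrow> d \<le> norm (x - v)" by blast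
  define K' where "K' = 1 / d + K * (1 + norm x / d)"
  have K': "K' > 0" "1 / d \<le> K'" "K * (1 + norm x / d) \<le> K'"
    using d K by (auto simp: K'_def add_pos_nonneg)
  have main: "\<bar>c b\<bar> \<le> K' * norm (\<Sum>b\<in>insert x B. c b *\<^sub>R b)" if b: "b \<in> insert x B" for c b
  proof -
    define w where "w = (\<Sum>b\<in>B. c b *\<^sub>R b)"
    define u where "u = c x *\<^sub>R x + w"
    have sum_eq: "(\<Sum>b\<in>insert x B. c b *\<^sub>R b) = u" using insert.hyps by (simp add: u_def w_def)
    have w: "w \<in> span B" unfolding w_def by (intro span_sum span_scale span_base)
    have cx: "\<bar>c x\<bar> \<le> norm u / d"
    proof (cases "c x = 0")
      case False
      have "- (inverse (c x) *\<^sub>R w) \<in> span B" using w by (intro span_neg span_scale)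
      then have "d \<le> norm (x - - (inverse (c x) *\<^sub>R w))" by (rule d(2))
      also have "x - - (inverse (c x) *\<^sub>R w) = inverse (c x) *\<^sub>R u"
        using False by (simp add: u_def scaleR_right_distrib)
      also have "norm \<dots> = norm u / \<bar>c x\<bar>" by (simp add: divide_inverse)
      finally show ?thesis using False d(1) by (simp add: field_simps)
    qed (use d in auto)
    show ?thesis
    proof (cases "b = x")
      case True
      have "norm u / d \<le> K' * norm u" using mult_right_mono[OF K'(2), of "norm u"] by simp
      then show ?thesis unfolding sum_eq using cx True by simp
    next
      case False
      then have "\<bar>c b\<bar> \<le> K * norm w" unfolding w_def using K(2) b by blast
      also have "norm w \<le> norm u + \<bar>c x\<bar> * norm x"
        using norm_triangle_ineq4[of u "c x *\<^sub>R x"] by (simp add: u_def)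
      also have "\<dots> \<le> norm u + norm u / d * norm x" using cx by (intro add_mono mult_right_mono) auto
      also have "\<dots> = (1 + norm x / d) * norm u" by (simp add: algebra_simps)
      finally have "\<bar>c b\<bar> \<le> K * (1 + norm x / d) * norm u" using K(1) by (simp add: mult.assoc)
      also have "\<dots> \<le> K' * norm u" using K'(3) by (intro mult_right_mono) auto
      finally show ?thesis unfolding sum_eq .
    qed
  qed
  show ?case using K'(1) main by blast
qed

lemma finite_dimensional_coordinates:
  fixes B0 :: "'a::real_normed_vector set"
  assumes B0: "finite B0" "span B0 = UNIV"
  shows "\<exists>(B :: 'a set) (\<phi> :: 'a \<Rightarrow> 'a \<Rightarrow> real) K. finite B \<and> 0 < K \<and> (\<forall>x. x = (\<Sum>b\<in>B. \<phi> b x *\<^sub>R b)) \<and>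
    (\<forall>b\<in>B. \<forall>x y. \<bar>\<phi> b x - \<phi> b y\<bar> \<le> K * norm (x - y))"
proof -
  obtain B where B: "B \<subseteq> B0" "independent B" "B0 \<subseteq> span B"
    by (rule maximal_independent_subset[of B0])
  have fin: "finite B" using B(1) B0(1) finite_subset by blast
  have sp: "span B = UNIV"
    using B(3) B0(2) by (metis span_mono span_span top.extremum_uniqueI)
  obtain K where K: "K > 0" "\<And>c b. b \<in> B \<Longrightarrow> \<bar>c b\<bar> \<le> K * norm (\<Sum>b\<in>B. c b *\<^sub>R b)"
    using independent_coeff_bound[OF fin B(2)] by blast
  define \<phi> where "\<phi> b x = representation B x b" for b x
  have eq: "x = (\<Sum>b\<in>B. \<phi> b x *\<^sub>R b)" for x
    unfolding \<phi>_def using sum_representation_eq[OF B(2) _ fin subset_refl] sp by auto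
  have "\<bar>\<phi> b x - \<phi> b y\<bar> \<le> K * norm (x - y)" if "b \<in> B" for b x y
  proof -
    have "\<bar>\<phi> b x - \<phi> b y\<bar> \<le> K * norm (\<Sum>b\<in>B. (\<phi> b x - \<phi> b y) *\<^sub>R b)"
      by (rule K(2)[OF that, of "\<lambda>b. \<phi> b x - \<phi> b y"])
    also have "(\<Sum>b\<in>B. (\<phi> b x - \<phi> b y) *\<^sub>R b) = x - y"
      unfolding scaleR_left_diff_distrib sum_subtractf eq[symmetric] ..
    finally show ?thesis .
  qed
  then have "finite B \<and> 0 < K \<and> (\<forall>x. x = (\<Sum>b\<in>B. \<phi> b x *\<^sub>R b)) \<and>
    (\<forall>b\<in>B. \<forall>x y. \<bar>\<phi> b x - \<phi> b y\<bar> \<le> K * norm (x - y))"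
    using fin K(1) eq by simp
  then show ?thesis by (intro exI)
qed

section \<open>Approximate slopes of Lipschitz curves\<close>

lemma continuous_on_increment_bound:
  fixes F :: "real \<Rightarrow> real"
  assumes C: "0 < C" and F: "\<And>x y. x \<le> y \<Longrightarrow> F x \<le> F y" "\<And>x y. x \<le> y \<Longrightarrow> F y - F x \<le> C * (y - x)"
  shows "continuous_on UNIV F"
proof (rule lipschitz_on_continuous_on[of C], rule lipschitz_onI)
  fix x y :: real
  show "dist (F x) (F y) \<le> C * dist x y"
    using F(1)[of x y] F(2)[of x y] F(1)[of y x] F(2)[of y x]
    by (cases "x \<le> y") (auto simp: dist_real_def)
qed (use C in simp)

text \<open>The measure with distribution function \<open>F\<close> and the one with the complementary distribution function
  \<open>C * x - F x\<close> add up to \<open>C\<close> times Lebesgue measure, since they do so on intervals.\<close>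

lemma interval_measure_le_lborel:
  fixes F :: "real \<Rightarrow> real"
  assumes C: "0 < C" and F: "\<And>x y. x \<le> y \<Longrightarrow> F x \<le> F y" "\<And>x y. x \<le> y \<Longrightarrow> F y - F x \<le> C * (y - x)"
    and B: "B \<in> sets borel"
  shows "emeasure (interval_measure F) B \<le> ennreal C * emeasure lborel B"
proof -
  define G where "G x = C * x - F x" for x
  have G: "x \<le> y \<Longrightarrow> G x \<le> G y" for x y using F(2)[of x y] by (simp add: G_def algebra_simps)
  have contF: "continuous_on UNIV F" by (rule continuous_on_increment_bound[OF C F])
  have contG: "continuous_on UNIV G" unfolding G_def by (intro continuous_intros contF)
  have rcF: "continuous (at_right a) F" for a
    using contF by (simp add: continuous_on_eq_continuous_at continuous_at_imp_continuous_at_within)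
  have rcG: "continuous (at_right a) G" for a
    using contG by (simp add: continuous_on_eq_continuous_at continuous_at_imp_continuous_at_within)
  let ?f = "interval_measure F" and ?g = "interval_measure G"
  \<comment> \<open>The sum of the two measures, normalised to agree with Lebesgue measure on intervals.\<close>
  define N where "N = measure_of UNIV (sets borel) (\<lambda>B. (emeasure ?f B + emeasure ?g B) / ennreal C)"
  have sN: "sets N = sets borel" unfolding N_def using sets.sigma_sets_eq[of borel] by simp
  have eN: "emeasure N B = (emeasure ?f B + emeasure ?g B) / ennreal C" if "B \<in> sets borel" for B
    unfolding N_def
  proof (rule emeasure_measure_of_sigma)
    show "sigma_algebra UNIV (sets (borel :: real measure))" using sets.sigma_algebra_axioms[of borel] by simp
    show "positive (sets borel) (\<lambda>B. (emeasure ?f B + emeasure ?g B) / ennreal C)"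
      by (simp add: positive_def)
    show "countably_additive (sets borel) (\<lambda>B. (emeasure ?f B + emeasure ?g B) / ennreal C)"
    proof (rule countably_additiveI)
      fix A :: "nat \<Rightarrow> real set"
      assume A: "range A \<subseteq> sets borel" "disjoint_family A"
      have "(\<Sum>i. (emeasure ?f (A i) + emeasure ?g (A i)) / ennreal C) =
         (\<Sum>i. emeasure ?f (A i) + emeasure ?g (A i)) / ennreal C"
        unfolding divide_ennreal_def by (rule ennreal_suminf_multc)
      also have "(\<Sum>i. emeasure ?f (A i) + emeasure ?g (A i)) = (\<Sum>i. emeasure ?f (A i)) + (\<Sum>i. emeasure ?g (A i))"
        by (rule suminf_add[OF summableI summableI, symmetric])
      also have "(\<Sum>i. emeasure ?f (A i)) = emeasure ?f (\<Union>i. A i)" using A by (intro suminf_emeasure) auto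
      also have "(\<Sum>i. emeasure ?g (A i)) = emeasure ?g (\<Union>i. A i)" using A by (intro suminf_emeasure) auto
      finally show "(\<Sum>i. (emeasure ?f (A i) + emeasure ?g (A i)) / ennreal C) =
         (emeasure ?f (\<Union>i. A i) + emeasure ?g (\<Union>i. A i)) / ennreal C" .
    qed
  qed fact
  have Ioo: "emeasure (interval_measure H) {a<..<b} = ennreal (H b - H a)"
    if "a \<le> b" "\<And>x y. x \<le> y \<Longrightarrow> H x \<le> H y" "continuous_on UNIV H" for H :: "real \<Rightarrow> real" and a b
  proof -
    have pt: "emeasure (interval_measure H) {c} = 0" for c
      using emeasure_interval_measure_Icc[OF order_refl that(2,3), of c] by simp
    have "{a..b} = {a<..<b} \<union> ({a} \<union> {b})" using that(1) by auto
    moreover have "emeasure (interval_measure H) ({a<..<b} \<union> ({a} \<union> {b})) = emeasure (interval_measure H) {a<..<b}"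
    proof (rule emeasure_Un_null_set)
      show "{a} \<union> {b} \<in> null_sets (interval_measure H)" by (intro null_sets.Un) (auto simp: pt null_sets_def)
    qed simp
    ultimately show ?thesis using emeasure_interval_measure_Icc[OF that] by metis
  qed
  have "lborel = N"
  proof (rule lborel_eqI)
    fix l u :: real assume lu: "\<And>b. b \<in> Basis \<Longrightarrow> l \<bullet> b \<le> u \<bullet> b"
    then have "l \<le> u" by simp
    then have "emeasure N {l<..<u} = (ennreal (F u - F l) + ennreal (G u - G l)) / ennreal C"
      by (simp add: eN Ioo F G contF contG)
    also have "ennreal (F u - F l) + ennreal (G u - G l) = ennreal (C * (u - l))"
      using F(1)[OF \<open>l \<le> u\<close>] G[OF \<open>l \<le> u\<close>] by (subst ennreal_plus[symmetric]) (auto simp: G_def algebra_simps)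
    also have "ennreal (C * (u - l)) / ennreal C = ennreal (u - l)"
      using C \<open>l \<le> u\<close> by (subst divide_ennreal) auto
    finally show "emeasure N (box l u) = (\<Prod>b\<in>Basis. (u - l) \<bullet> b)" by simp
  qed (rule sN)
  then have "ennreal C * emeasure lborel B = ennreal C * ((emeasure ?f B + emeasure ?g B) / ennreal C)"
    using eN[OF B] by simp
  also have "\<dots> = emeasure ?f B + emeasure ?g B"
    by (subst ennreal_times_divide, subst mult.commute, rule mult_divide_eq_ennreal) (use C in auto)
  finally show ?thesis by simp
qed

text \<open>A weak form of Lebesgue's differentiation theorem: at almost every point, some rational number is a slope
  up to the error \<open>e\<close>. Adding \<open>M * x\<close> makes \<open>g\<close> increasing, so its increments are a measure with a
  density \<open>\<rho>\<close> with respect to Lebesgue measure. At a density point of the set \<open>A a\<close> where \<open>\<rho>\<close> is close to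
  \<open>a\<close>, small increments are close to \<open>a\<close> times the length, because the part of the interval outside
  \<open>A a\<close> is short and carries at most \<open>C\<close> times its length.\<close>

lemma lipschitz_real_line_slopes:
  fixes g :: "real \<Rightarrow> real"
  assumes lip: "\<And>x y. \<bar>g x - g y\<bar> \<le> M * \<bar>x - y\<bar>" and M: "M \<in> \<rat>" and e: "0 < e"
  shows "negligible {x. \<not> (\<exists>a\<in>\<rat>. \<exists>r>0. \<forall>t. \<bar>t\<bar> \<le> r \<longrightarrow> \<bar>g (x + t) - g x - a * t\<bar> \<le> e * \<bar>t\<bar>)}"
proof -
  have M0: "0 \<le> M" using lip[of 0 1] by simp
  define C where "C = 2 * M + 1"
  have C: "0 < C" using M0 by (simp add: C_def)
  define F where "F x = g x + M * x" for x
  have F1: "F x \<le> F y" if "x \<le> y" for x y using lip[of x y] that by (auto simp: F_def algebra_simps abs_if split: if_splits)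
  have F2: "F y - F x \<le> C * (y - x)" if "x \<le> y" for x y
    using lip[of y x] that by (auto simp: F_def C_def algebra_simps abs_if split: if_splits)
  have contF: "continuous_on UNIV F" by (rule continuous_on_increment_bound[OF C F1 F2])
  define \<nu> where "\<nu> = interval_measure F"
  have sets_nu: "sets \<nu> = sets lborel" by (simp add: \<nu>_def)
  have le: "emeasure \<nu> B \<le> ennreal C * emeasure lborel B" if "B \<in> sets borel" for B
    unfolding \<nu>_def by (rule interval_measure_le_lborel[OF C F1 F2 that])
  have Icc: "emeasure \<nu> {a..b} = ennreal (F b - F a)" if "a \<le> b" for a b
    unfolding \<nu>_def using emeasure_interval_measure_Icc[OF that F1 contF] by simp
  have "absolutely_continuous lborel \<nu>"
    unfolding absolutely_continuous_def
  proof
    fix N :: "real set" assume "N \<in> null_sets lborel"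
    then have N: "N \<in> sets borel" "emeasure lborel N = 0" by auto
    then show "N \<in> null_sets \<nu>" using le[OF N(1)] sets_nu by (auto simp: null_sets_def)
  qed
  then obtain \<rho> where \<rho>: "\<rho> \<in> borel_measurable lborel" "density lborel \<rho> = \<nu>"
    using sigma_finite_lborel sigma_finite_measure.Radon_Nikodym sets_nu by blast
  have nu_int: "emeasure \<nu> B = (\<integral>\<^sup>+x. \<rho> x * indicator B x \<partial>lborel)" if "B \<in> sets borel" for B
    using \<rho> that by (auto simp: emeasure_density \<rho>(2)[symmetric])
  define e' where "e' = e / 3"
  have e': "0 < e'" using e by (simp add: e'_def)
  \<comment> \<open>For \<open>a < e'\<close> the lower bound is the trivial one, as \<open>ennreal\<close> truncates at zero.\<close>
  define A where "A a = {x. ennreal (a - e') \<le> \<rho> x \<and> \<rho> x \<le> ennreal (a + e')}" for a :: real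
  have A: "A a \<in> sets borel" for a
  proof -
    have [measurable]: "\<rho> \<in> borel_measurable borel" using \<rho>(1) by simp
    show ?thesis unfolding A_def by measurable
  qed
  define I where "I = {x. \<rho> x = \<infinity>}"
  have Im: "I \<in> sets borel"
  proof -
    have [measurable]: "\<rho> \<in> borel_measurable borel" using \<rho>(1) by simp
    show ?thesis unfolding I_def by measurable
  qed
  have "emeasure lborel (I \<inter> {-real n..real n}) = 0" for n
  proof (rule ccontr)
    let ?J = "I \<inter> {-real n..real n}"
    assume nz: "emeasure lborel ?J \<noteq> 0"
    have "\<infinity> * emeasure lborel ?J = (\<integral>\<^sup>+x. \<infinity> * indicator ?J x \<partial>lborel)"
      using Im by (intro nn_integral_cmult_indicator[symmetric]) auto
    also have "\<dots> \<le> (\<integral>\<^sup>+x. \<rho> x * indicator ?J x \<partial>lborel)"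
      by (intro nn_integral_mono) (auto simp: I_def indicator_def)
    also have "\<dots> = emeasure \<nu> ?J" using Im by (intro nu_int[symmetric]) auto
    also have "\<dots> \<le> emeasure \<nu> {-real n..real n}" by (intro emeasure_mono) (auto simp: \<nu>_def)
    also have "\<dots> < \<infinity>" by (simp add: Icc)
    finally show False using nz by (simp add: ennreal_top_mult)
  qed
  then have "negligible (\<Union>n. I \<inter> {-real n..real n})"
    using Im by (intro negligible_countable_Union) (auto simp: negligible_iff_null_sets null_sets_def)
  moreover have "I \<subseteq> (\<Union>n. I \<inter> {-real n..real n})"
  proof
    fix x assume "x \<in> I"
    obtain n where "\<bar>x\<bar> < real n" using reals_Archimedean2 by blast
    then show "x \<in> (\<Union>n. I \<inter> {-real n..real n})" using \<open>x \<in> I\<close> by (auto intro!: exI[of _ n])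
  qed
  ultimately have negI: "negligible I" by (rule negligible_subset)
  \<comment> \<open>Chosen so that the part of an interval of length \<open>d\<close> outside \<open>A a\<close>, of length at most \<open>4 * c a * d\<close> by the
    density in the ball of radius \<open>2 * d\<close>, changes the increment by at most \<open>e' * d\<close>.\<close>
  define c where "c a = e' / (4 * (C + \<bar>a\<bar> + e'))" for a
  have c: "0 < c a" "c a < 1" "4 * c a * (C + \<bar>a\<bar> + e') = e'" for a
  proof -
    have pos: "0 < C + \<bar>a\<bar> + e'" using e' C by linarith
    then show "0 < c a" using e' by (simp add: c_def)
    have "4 * (e' / (4 * p)) * p = e'" if "0 < p" for p using that by simp
    then show "4 * c a * (C + \<bar>a\<bar> + e') = e'" unfolding c_def using pos by blast
    have "e' < 4 * (C + \<bar>a\<bar> + e')" using e' C by simp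
    then show "c a < 1" using pos by (simp add: c_def)
  qed
  define P where "P a = {x\<in>A a. \<forall>r>0. \<exists>d. 0 < d \<and> d \<le> r \<and>
     ennreal (c a) * emeasure lebesgue (ball x d) \<le> emeasure lebesgue (ball x d - A a)}" for a
  have negP: "negligible (P a)" for a
    unfolding P_def using A[of a] by (intro negligible_not_density_points c) auto
  have good: "\<exists>r>0. \<forall>t. \<bar>t\<bar> \<le> r \<longrightarrow> \<bar>g (x + t) - g x - (a - M) * t\<bar> \<le> e * \<bar>t\<bar>"
    if x: "x \<in> A a" "x \<notin> P a" and a: "0 \<le> a" for x a
  proof -
    obtain r where r: "r > 0" and dens: "\<And>d. 0 < d \<Longrightarrow> d \<le> r \<Longrightarrow>
       emeasure lebesgue (ball x d - A a) < ennreal (c a) * emeasure lebesgue (ball x d)"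
      using x unfolding P_def mem_Collect_eq by (meson not_le)
    have key: "\<bar>F v - F u - a * (v - u)\<bar> \<le> e * (v - u)"
      if uv: "u \<le> v" "x \<in> {u, v}" "v - u \<le> r / 2" for u v
    proof (cases "u = v")
      case False
      define d where "d = v - u"
      have d: "0 < d" "d \<le> r / 2" using uv False by (auto simp: d_def)
      let ?J = "{u..v}"
      define b where "b = emeasure lborel (?J - A a)"
      have "b \<le> emeasure lborel (ball x (2 * d) - A a)"
        unfolding b_def using A[of a] uv d by (intro emeasure_mono) (auto simp: dist_real_def d_def)
      also have "\<dots> = emeasure lebesgue (ball x (2 * d) - A a)" using A[of a] by simp
      also have "\<dots> \<le> ennreal (c a) * emeasure lebesgue (ball x (2 * d))"
        using dens[of "2 * d"] d by (simp add: less_imp_le)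
      also have "\<dots> = ennreal (4 * c a * d)"
        using d c[of a] by (simp add: ball_eq_greaterThanLessThan ennreal_mult[symmetric])
      finally have bb: "b \<le> ennreal (4 * c a * d)" .
      then have bfin: "b \<noteq> top" by (auto simp: top_unique)
      define \<beta> where "\<beta> = enn2real b"
      have b\<beta>: "b = ennreal \<beta>" "0 \<le> \<beta>" using bfin by (auto simp: \<beta>_def ennreal_enn2real_if)
      have \<beta>: "\<beta> \<le> 4 * c a * d" using bb d c[of a] unfolding b\<beta> by simp
      have split: "emeasure lborel (?J \<inter> A a) + b = ennreal d"
      proof -
        have "emeasure lborel (?J \<inter> A a) + emeasure lborel (?J - A a) = emeasure lborel ?J"
          using A[of a] by (subst plus_emeasure) (auto simp: Int_Diff_Un)
        then show ?thesis using uv(1) by (simp add: b_def d_def)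
      qed
      define \<alpha> where "\<alpha> = d - \<beta>"
      have a\<alpha>: "emeasure lborel (?J \<inter> A a) = ennreal \<alpha>" "0 \<le> \<alpha>"
      proof -
        have "emeasure lborel (?J \<inter> A a) \<noteq> top" using split by (auto)
        then obtain z where z: "emeasure lborel (?J \<inter> A a) = ennreal z" "0 \<le> z"
          by (metis ennreal_cases)
        then have "ennreal (z + \<beta>) = ennreal d" using split b\<beta> by (simp add: ennreal_plus)
        then have "z + \<beta> = d" using z b\<beta> d by (subst (asm) ennreal_inj) auto
        then show "emeasure lborel (?J \<inter> A a) = ennreal \<alpha>" "0 \<le> \<alpha>" using z by (auto simp: \<alpha>_def)
      qed
      have JA: "?J \<inter> A a \<in> sets borel" using A[of a] by auto
      have lower: "ennreal (a - e') * ennreal \<alpha> \<le> ennreal (F v - F u)"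
      proof -
        have "ennreal (a - e') * ennreal \<alpha> = (\<integral>\<^sup>+y. ennreal (a - e') * indicator (?J \<inter> A a) y \<partial>lborel)"
          using JA by (simp add: nn_integral_cmult_indicator a\<alpha>)
        also have "\<dots> \<le> (\<integral>\<^sup>+y. \<rho> y * indicator (?J \<inter> A a) y \<partial>lborel)"
          by (intro nn_integral_mono) (auto simp: A_def indicator_def)
        also have "\<dots> = emeasure \<nu> (?J \<inter> A a)" using JA by (rule nu_int[symmetric])
        also have "\<dots> \<le> emeasure \<nu> ?J" by (intro emeasure_mono) (auto simp: \<nu>_def)
        also have "\<dots> = ennreal (F v - F u)" using uv(1) by (rule Icc)
        finally show ?thesis .
      qed
      have upper: "ennreal (F v - F u) \<le> ennreal (a + e') * ennreal \<alpha> + ennreal C * ennreal \<beta>"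
      proof -
        have "ennreal (F v - F u) = emeasure \<nu> ?J" using uv(1) by (rule Icc[symmetric])
        also have "\<dots> = emeasure \<nu> (?J \<inter> A a) + emeasure \<nu> (?J - A a)"
          using A[of a] by (subst plus_emeasure) (auto simp: Int_Diff_Un \<nu>_def)
        also have "emeasure \<nu> (?J - A a) \<le> ennreal C * ennreal \<beta>"
          using le[of "?J - A a"] A[of a] by (simp add: b_def[symmetric] b\<beta>)
        also have "emeasure \<nu> (?J \<inter> A a) = (\<integral>\<^sup>+y. \<rho> y * indicator (?J \<inter> A a) y \<partial>lborel)" using JA by (rule nu_int)
        also have "\<dots> \<le> (\<integral>\<^sup>+y. ennreal (a + e') * indicator (?J \<inter> A a) y \<partial>lborel)"
          by (intro nn_integral_mono) (auto simp: A_def indicator_def)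
        also have "\<dots> = ennreal (a + e') * ennreal \<alpha>"
          using JA by (simp add: nn_integral_cmult_indicator a\<alpha>)
        finally show ?thesis by (simp add: add_mono)
      qed
      have Fuv: "0 \<le> F v - F u" using F1[OF uv(1)] by simp
      have lower': "(a - e') * \<alpha> \<le> F v - F u"
      proof (cases "0 \<le> a - e'")
        case True
        then show ?thesis using lower a\<alpha>(2) Fuv by (simp add: ennreal_mult[symmetric])
      next
        case False
        then have "(a - e') * \<alpha> \<le> 0" using a\<alpha>(2) by (intro mult_nonpos_nonneg) auto
        then show ?thesis using Fuv by linarith
      qed
      have upper': "F v - F u \<le> (a + e') * \<alpha> + C * \<beta>"
      proof -
        have "ennreal (F v - F u) \<le> ennreal ((a + e') * \<alpha> + C * \<beta>)"
          using upper a\<alpha>(2) b\<beta>(2) C a e' by (simp add: ennreal_mult ennreal_plus)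
        then show ?thesis using a\<alpha>(2) b\<beta>(2) C a e' by (subst (asm) ennreal_le_iff) auto
      qed
      have "\<beta> * (C + a + e') \<le> (4 * c a * d) * (C + a + e')"
        using \<beta> C e' a by (intro mult_right_mono) auto
      also have "\<dots> = d * (4 * c a * (C + \<bar>a\<bar> + e'))" using a by simp
      also have "\<dots> = d * e'" by (simp only: c(3))
      finally have "\<beta> * (C + a + e') \<le> d * e'" .
      then have f1: "C * \<beta> + a * \<beta> + e' * \<beta> \<le> e' * d" by (simp add: distrib_left mult.commute)
      have f2: "0 \<le> C * \<beta>" "0 \<le> a * \<beta>" "0 \<le> e' * \<beta>" using b\<beta>(2) C a e' by auto
      have f3: "F v - F u \<le> a * d + e' * d - a * \<beta> - e' * \<beta> + C * \<beta>"
        using upper' unfolding \<alpha>_def distrib_right right_diff_distrib by linarith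
      have f4: "a * d - e' * d - a * \<beta> + e' * \<beta> \<le> F v - F u"
        using lower' unfolding \<alpha>_def left_diff_distrib right_diff_distrib by linarith
      have f5: "e * d = 3 * (e' * d)" "0 \<le> e' * d" using e' d by (auto simp: e'_def)
      have "F v - F u - a * d \<le> e * d" using f1 f2 f3 f5 by linarith
      moreover have "- (F v - F u - a * d) \<le> e * d" using f1 f2 f4 f5 by linarith
      ultimately show ?thesis unfolding d_def[symmetric] by (simp add: abs_le_iff)
    qed simp
    show ?thesis
    proof (intro exI conjI allI impI)
      show "0 < r / 2" using r by simp
      fix t :: real assume t: "\<bar>t\<bar> \<le> r / 2"
      have Fg: "F (x + t) - F x - a * t = g (x + t) - g x - (a - M) * t" by (simp add: F_def algebra_simps)
      show "\<bar>g (x + t) - g x - (a - M) * t\<bar> \<le> e * \<bar>t\<bar>"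
      proof (cases "0 \<le> t")
        case True
        then show ?thesis using key[of x "x + t"] t unfolding Fg[symmetric] by simp
      next
        case False
        then show ?thesis using key[of "x + t" x] t unfolding Fg[symmetric] by (simp add: algebra_simps abs_minus_commute)
      qed
    qed
  qed
  have "negligible (I \<union> (\<Union>a\<in>\<rat>. P a))"
    using negI negP countable_rat by (intro negligible_Un negligible_countable_Union) auto
  then show ?thesis
  proof (rule negligible_subset, safe)
    fix x assume no: "\<not> (\<exists>a\<in>\<rat>. \<exists>r>0. \<forall>t. \<bar>t\<bar> \<le> r \<longrightarrow> \<bar>g (x + t) - g x - a * t\<bar> \<le> e * \<bar>t\<bar>)"
      and xP: "x \<notin> (\<Union>a\<in>\<rat>. P a)"
    show "x \<in> I"
    proof (rule ccontr)
      assume "x \<notin> I"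
      then obtain z where z: "\<rho> x = ennreal z" "0 \<le> z" unfolding I_def by (cases "\<rho> x") auto
      obtain a where a: "a \<in> \<rat>" "z < a" "a < z + e'" using Rats_dense_in_real[of z "z + e'"] e' by auto
      have "ennreal (a - e') \<le> ennreal z" by (rule ennreal_leI) (use a in linarith)
      moreover have "ennreal z \<le> ennreal (a + e')" by (rule ennreal_leI) (use a e' in linarith)
      ultimately have "x \<in> A a" unfolding A_def using z by simp
      then obtain r where "r > 0" "\<forall>t. \<bar>t\<bar> \<le> r \<longrightarrow> \<bar>g (x + t) - g x - (a - M) * t\<bar> \<le> e * \<bar>t\<bar>"
        using good[of x a] xP a z by auto
      then show False using no a(1) M Rats_diff by blast
    qed
  qed
qed

text \<open>One countable set of slopes serves all Lipschitz curves: the vectors with rational coordinates.\<close>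

lemma lipschitz_curve_slopes:
  fixes B0 :: "'a::real_normed_vector set"
  assumes B0: "finite B0" "span B0 = UNIV"
  shows "\<exists>D :: 'a set. countable D \<and>
    (\<forall>M e (\<gamma> :: real \<Rightarrow> 'a). 0 < e \<longrightarrow> (\<forall>x y. norm (\<gamma> x - \<gamma> y) \<le> M * \<bar>x - y\<bar>) \<longrightarrow>
      negligible {x. \<not> (\<exists>d\<in>D. \<exists>r>0. \<forall>t. \<bar>t\<bar> \<le> r \<longrightarrow> norm (\<gamma> (x + t) - \<gamma> x - t *\<^sub>R d) \<le> e * \<bar>t\<bar>)})"
proof -
  obtain B :: "'a set" and \<phi> K where B: "finite B" "K > 0" and B3: "\<forall>x. x = (\<Sum>b\<in>B. \<phi> b x *\<^sub>R b)"
      and B4: "\<forall>b\<in>B. \<forall>x y. \<bar>\<phi> b x - \<phi> b y\<bar> \<le> K * norm (x - y)"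
    using finite_dimensional_coordinates[OF B0] by (elim exE conjE)
  define D where "D = (\<lambda>a. \<Sum>b\<in>B. a b *\<^sub>R b) ` (B \<rightarrow>\<^sub>E \<rat>)"
  have cD: "countable D" unfolding D_def
    using B(1) countable_rat by (intro countable_image countable_PiE) auto
  have "negligible {x. \<not> (\<exists>d\<in>D. \<exists>r>0. \<forall>t. \<bar>t\<bar> \<le> r \<longrightarrow> norm (\<gamma> (x + t) - \<gamma> x - t *\<^sub>R d) \<le> e * \<bar>t\<bar>)}"
    if e: "0 < e" and lip: "\<And>x y. norm (\<gamma> x - \<gamma> y) \<le> M * \<bar>x - y\<bar>" for M e and \<gamma> :: "real \<Rightarrow> 'a"
  proof -
    define s where "s = (\<Sum>b\<in>B. norm b) + 1"
    have s: "0 < s" unfolding s_def by (simp add: sum_nonneg add_nonneg_pos)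
    define e' where "e' = e / s"
    have e': "0 < e'" using e s by (simp add: e'_def)
    obtain M' where M': "M' \<in> \<rat>" "K * M < M'" using Rats_dense_in_real[of "K * M" "K * M + 1"] by auto
    define N where "N b = {x. \<not> (\<exists>a\<in>\<rat>. \<exists>r>0. \<forall>t. \<bar>t\<bar> \<le> r \<longrightarrow> \<bar>\<phi> b (\<gamma> (x + t)) - \<phi> b (\<gamma> x) - a * t\<bar> \<le> e' * \<bar>t\<bar>)}" for b
    have "negligible (N b)" if b: "b \<in> B" for b
      unfolding N_def
    proof (rule lipschitz_real_line_slopes[OF _ M'(1) e'])
      fix x y :: real
      have "\<bar>\<phi> b (\<gamma> x) - \<phi> b (\<gamma> y)\<bar> \<le> K * norm (\<gamma> x - \<gamma> y)" using B4 b by blast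
      also have "\<dots> \<le> K * (M * \<bar>x - y\<bar>)" using lip B(2) by (intro mult_left_mono) auto
      also have "\<dots> \<le> M' * \<bar>x - y\<bar>" unfolding mult.assoc[symmetric] using M'(2) by (intro mult_right_mono) auto
      finally show "\<bar>\<phi> b (\<gamma> x) - \<phi> b (\<gamma> y)\<bar> \<le> M' * \<bar>x - y\<bar>" .
    qed
    then have "negligible (\<Union>b\<in>B. N b)" using B(1) by (intro negligible_Union) auto
    then show ?thesis
    proof (rule negligible_subset, safe)
      fix x assume no: "\<not> (\<exists>d\<in>D. \<exists>r>0. \<forall>t. \<bar>t\<bar> \<le> r \<longrightarrow> norm (\<gamma> (x + t) - \<gamma> x - t *\<^sub>R d) \<le> e * \<bar>t\<bar>)"
      show "x \<in> (\<Union>b\<in>B. N b)"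
      proof (rule ccontr)
        assume "x \<notin> (\<Union>b\<in>B. N b)"
        then have "\<forall>b\<in>B. \<exists>a r. a \<in> \<rat> \<and> 0 < r \<and> (\<forall>t. \<bar>t\<bar> \<le> r \<longrightarrow> \<bar>\<phi> b (\<gamma> (x + t)) - \<phi> b (\<gamma> x) - a * t\<bar> \<le> e' * \<bar>t\<bar>)"
          unfolding N_def by blast
        then obtain a r where ar: "\<And>b. b \<in> B \<Longrightarrow> a b \<in> \<rat>" "\<And>b. b \<in> B \<Longrightarrow> 0 < r b"
           "\<And>b t. b \<in> B \<Longrightarrow> \<bar>t\<bar> \<le> r b \<Longrightarrow> \<bar>\<phi> b (\<gamma> (x + t)) - \<phi> b (\<gamma> x) - a b * t\<bar> \<le> e' * \<bar>t\<bar>"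
          by metis
        define d where "d = (\<Sum>b\<in>B. a b *\<^sub>R b)"
        have "d = (\<Sum>b\<in>B. restrict a B b *\<^sub>R b)" unfolding d_def by (intro sum.cong) auto
        moreover have "restrict a B \<in> B \<rightarrow>\<^sub>E \<rat>" using ar(1) by auto
        ultimately have dD: "d \<in> D" unfolding D_def by blast
        define R where "R = Min (insert 1 (r ` B))"
        have R: "0 < R" "\<And>b. b \<in> B \<Longrightarrow> R \<le> r b" unfolding R_def using B(1) ar(2) by auto
        have "norm (\<gamma> (x + t) - \<gamma> x - t *\<^sub>R d) \<le> e * \<bar>t\<bar>" if t: "\<bar>t\<bar> \<le> R" for t
        proof -
          have "\<gamma> (x + t) - \<gamma> x - t *\<^sub>R d = (\<Sum>b\<in>B. \<phi> b (\<gamma> (x + t)) *\<^sub>R b) - (\<Sum>b\<in>B. \<phi> b (\<gamma> x) *\<^sub>R b) - t *\<^sub>R d"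
            using B3[rule_format, of "\<gamma> (x + t)"] B3[rule_format, of "\<gamma> x"] by simp
          also have "\<dots> = (\<Sum>b\<in>B. (\<phi> b (\<gamma> (x + t)) - \<phi> b (\<gamma> x) - a b * t) *\<^sub>R b)"
            by (simp add: d_def scaleR_sum_right sum_subtractf scaleR_left_diff_distrib mult.commute)
          also have "norm \<dots> \<le> (\<Sum>b\<in>B. e' * \<bar>t\<bar> * norm b)"
          proof (rule sum_norm_le)
            fix b assume b: "b \<in> B"
            have "\<bar>\<phi> b (\<gamma> (x + t)) - \<phi> b (\<gamma> x) - a b * t\<bar> \<le> e' * \<bar>t\<bar>"
              using ar(3)[OF b] t R(2)[OF b] by simp
            then show "norm ((\<phi> b (\<gamma> (x + t)) - \<phi> b (\<gamma> x) - a b * t) *\<^sub>R b) \<le> e' * \<bar>t\<bar> * norm b"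
              by (simp add: mult_right_mono)
          qed
          also have "\<dots> = e' * \<bar>t\<bar> * (\<Sum>b\<in>B. norm b)" by (simp add: sum_distrib_left)
          also have "\<dots> \<le> e' * \<bar>t\<bar> * s" using e' by (intro mult_left_mono) (auto simp: s_def)
          also have "\<dots> = e * \<bar>t\<bar>" using s by (simp add: e'_def)
          finally show ?thesis .
        qed
        then show False using no dD R(1) by blast
      qed
    qed
  qed
  then show ?thesis using cD by blast
qed

section \<open>Approximately affine pieces of Lipschitz maps\<close>

lemma lipschitz_constant_nonneg:
  fixes f :: "real^'m \<Rightarrow> 'a::real_normed_vector"
  assumes "\<And>x y. norm (f x - f y) \<le> M * norm (x - y)"
  shows "0 \<le> M"
  using order_trans[OF norm_ge_zero assms[of "axis undefined 1" 0]] by simp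

lemma continuous_on_norm_lipschitz:
  fixes f :: "real^'m \<Rightarrow> 'a::real_normed_vector"
  assumes "\<And>x y. norm (f x - f y) \<le> M * norm (x - y)"
  shows "continuous_on A f"
  using assms lipschitz_constant_nonneg[OF assms]
  by (intro lipschitz_on_continuous_on[of M] lipschitz_onI) (simp_all add: dist_norm)

text \<open>Partial increments with a common error on a set \<open>A\<close> give total increments at the points of \<open>A\<close> near
  which \<open>A\<close> has no large holes. Walk from \<open>x\<close> to \<open>x + h\<close> along the coordinate axes, and at each corner
  pass to a nearby point of \<open>A\<close>, where the increment along the next axis is under control.\<close>

lemma partial_to_total_increment:
  fixes f :: "real^'m \<Rightarrow> 'a::real_normed_vector" and d :: "'m \<Rightarrow> 'a"
  assumes lip: "\<And>x y. norm (f x - f y) \<le> M * norm (x - y)"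
    and A: "\<And>x j t. x \<in> A \<Longrightarrow> \<bar>t\<bar> \<le> r \<Longrightarrow> norm (f (x + t *\<^sub>R axis j 1) - f x - t *\<^sub>R d j) \<le> e * \<bar>t\<bar>"
    and x: "x \<in> A" and h: "norm h \<le> r" and e: "0 \<le> e" and c: "0 \<le> c"
    and near: "\<And>k. 0 < norm k \<Longrightarrow> norm k \<le> norm h \<Longrightarrow> \<exists>y\<in>A. norm (x + k - y) \<le> c * norm k"
  shows "norm (f (x + h) - f x - (\<Sum>j\<in>UNIV. (h $ j) *\<^sub>R d j)) \<le> real CARD('m) * (e + 2 * M * c) * norm h"
proof -
  have M0: "0 \<le> M" using lip by (rule lipschitz_constant_nonneg)
  define p where "p J = (\<chi> i. if i \<in> J then h $ i else 0)" for J
  have pn: "norm (p J) \<le> norm h" for J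
    by (rule norm_le_componentwise_cart) (simp add: p_def)
  have "norm (f (x + p J) - f x - (\<Sum>j\<in>J. (h $ j) *\<^sub>R d j)) \<le> real (card J) * (e + 2 * M * c) * norm h"
    if "finite J" for J
    using that
  proof (induction J rule: finite_induct)
    case empty
    have "p {} = 0" by (simp add: p_def vec_eq_iff)
    then show ?case by simp
  next
    case (insert j J)
    have pj: "p (insert j J) = p J + (h $ j) *\<^sub>R axis j 1"
      using insert.hyps(2) by (auto simp: p_def vec_eq_iff axis_def)
    have hj: "\<bar>h $ j\<bar> \<le> norm h" by (rule component_le_norm_cart)
    obtain y where y: "y \<in> A" "norm (x + p J - y) \<le> c * norm h"
    proof (cases "p J = 0")
      case True
      then show ?thesis using that[of x] x c by simp
    next
      case False
      then obtain y where "y \<in> A" "norm (x + p J - y) \<le> c * norm (p J)" using near[of "p J"] pn by auto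
      moreover have "c * norm (p J) \<le> c * norm h" using pn c by (intro mult_left_mono)
      ultimately show ?thesis using that[of y] by simp
    qed
    let ?t = "(h $ j) *\<^sub>R axis j (1::real)"
    have eq: "f (x + p (insert j J)) - f x - (\<Sum>j\<in>insert j J. (h $ j) *\<^sub>R d j) =
       (f (x + p J) - f x - (\<Sum>j\<in>J. (h $ j) *\<^sub>R d j)) + (f (y + ?t) - f y - (h $ j) *\<^sub>R d j)
        + (f (x + p J + ?t) - f (y + ?t)) + (f y - f (x + p J))"
      using insert.hyps by (simp add: pj algebra_simps)
    have n1: "norm (f (y + ?t) - f y - (h $ j) *\<^sub>R d j) \<le> e * norm h"
    proof -
      have "norm (f (y + ?t) - f y - (h $ j) *\<^sub>R d j) \<le> e * \<bar>h $ j\<bar>" using A[OF y(1)] hj h by auto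
      also have "\<dots> \<le> e * norm h" using hj e by (rule mult_left_mono)
      finally show ?thesis .
    qed
    have My: "M * norm (x + p J - y) \<le> M * (c * norm h)" using y(2) M0 by (rule mult_left_mono)
    have n2: "norm (f (x + p J + ?t) - f (y + ?t)) \<le> M * (c * norm h)"
      using lip[of "x + p J + ?t" "y + ?t"] My by simp
    have n3: "norm (f y - f (x + p J)) \<le> M * (c * norm h)"
      using lip[of "x + p J" y] My by (simp add: norm_minus_commute)
    have "norm (f (x + p (insert j J)) - f x - (\<Sum>j\<in>insert j J. (h $ j) *\<^sub>R d j)) \<le>
       real (card J) * (e + 2 * M * c) * norm h + e * norm h + M * (c * norm h) + M * (c * norm h)"
      unfolding eq by (intro norm_triangle_le add_mono insert.IH n1 n2 n3)
    also have "\<dots> = real (card (insert j J)) * (e + 2 * M * c) * norm h"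
      using insert.hyps by (simp add: algebra_simps)
    finally show ?case .
  qed
  from this[of UNIV] show ?thesis by (simp add: p_def)
qed

text \<open>A quantitative Rademacher theorem: up to a null set, the domain of a Lipschitz map is a countable union of
  closed sets on each of which the map is affine up to the relative error \<open>e\<close>. Linear maps are encoded by the
  images \<open>d\<close> of the coordinate vectors. Almost every point \<open>x\<close> lies in one of the sets \<open>A d k\<close>, on which all
  partial increments up to the length \<open>rr k\<close> are close to those of \<open>d\<close>: for each axis the exceptional set
  meets each parallel to the axis in a null set. Almost every point of \<open>A d k\<close> sees no large holes of
  \<open>A d k\<close>, so that the partial increments combine. The pieces are the sets \<open>E d k\<close>, cut into parts of
  diameter at most \<open>rr k\<close>; they are closed because their defining conditions are.\<close>

lemma lipschitz_affine_pieces: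
  fixes f :: "real^'m \<Rightarrow> 'a::real_normed_vector" and B0 :: "'a set"
  assumes B0: "finite B0" "span B0 = UNIV"
    and lip: "\<And>x y. norm (f x - f y) \<le> M * norm (x - y)" and e: "0 < e"
  obtains F :: "nat \<Rightarrow> (real^'m) set" and L :: "nat \<Rightarrow> real^'m \<Rightarrow> 'a"
  where "\<And>i. closed (F i)" "\<And>i. linear (L i)"
    "\<And>i x y. x \<in> F i \<Longrightarrow> y \<in> F i \<Longrightarrow> norm (f y - f x - L i (y - x)) \<le> e * norm (y - x)"
    "\<And>i v. norm (L i v) \<le> (M + e) * norm v"
    "negligible (UNIV - (\<Union>i. F i))"
proof -
  obtain D :: "'a set" where D1: "countable D" and
    D2: "\<forall>M e (\<gamma> :: real \<Rightarrow> 'a). 0 < e \<longrightarrow> (\<forall>x y. norm (\<gamma> x - \<gamma> y) \<le> M * \<bar>x - y\<bar>) \<longrightarrow>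
      negligible {x. \<not> (\<exists>d\<in>D. \<exists>r>0. \<forall>t. \<bar>t\<bar> \<le> r \<longrightarrow> norm (\<gamma> (x + t) - \<gamma> x - t *\<^sub>R d) \<le> e * \<bar>t\<bar>)}"
    using lipschitz_curve_slopes[OF B0] by (elim exE conjE)
  have M0: "0 \<le> M" using lip by (rule lipschitz_constant_nonneg)
  have contf: "continuous_on UNIV f" using lip by (rule continuous_on_norm_lipschitz)
  have contf': "continuous_on UNIV (\<lambda>x. f (x + v))" for v
    by (rule continuous_on_compose2[OF contf]) (auto intro!: continuous_intros)
  define m where "m = real CARD('m)"
  have m: "0 < m" by (simp add: m_def)
  define e1 where "e1 = e / (2 * m)"
  \<comment> \<open>Over the \<open>m\<close> axes, the errors \<open>e1\<close> of the slopes and the errors \<open>2 * M * c\<close> of the displacements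
    each add up to at most \<open>e / 2\<close>.\<close>
  define c where "c = e / (4 * m * (M + 1))"
  have e1: "0 < e1" using e m by (simp add: e1_def)
  have c: "0 < c" using e m M0 by (simp add: c_def)
  have total: "m * (e1 + 2 * M * c) \<le> e"
  proof -
    have "m * (2 * M * (e / (4 * m * q))) = (e / 2) * (M / q)" if "0 < q" for q
      using m that by (simp add: field_simps)
    then have "m * (2 * M * c) = (e / 2) * (M / (M + 1))" unfolding c_def using M0 by simp
    also have "\<dots> \<le> (e / 2) * 1" using M0 e by (intro mult_left_mono) auto
    finally show ?thesis using m by (simp add: distrib_left e1_def)
  qed
  define rr where "rr k = inverse (real (Suc k))" for k
  have rr: "0 < rr k" for k by (simp add: rr_def)
  define G where "G j d k = {x. \<forall>t. \<bar>t\<bar> \<le> rr k \<longrightarrow> norm (f (x + t *\<^sub>R axis j 1) - f x - t *\<^sub>R d) \<le> e1 * \<bar>t\<bar>}" for j d k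
  have closedG: "closed (G j d k)" for j d k
  proof -
    have eq: "G j d k = (\<Inter>t\<in>{t. \<bar>t\<bar> \<le> rr k}. {x. norm (f (x + t *\<^sub>R axis j 1) - f x - t *\<^sub>R d) \<le> e1 * \<bar>t\<bar>})"
      unfolding G_def by blast
    show ?thesis unfolding eq
      by (intro closed_INT ballI closed_Collect_le continuous_intros contf contf')
  qed
  define L where "L d v = (\<Sum>j\<in>UNIV. (v $ j) *\<^sub>R d j)" for d :: "'m \<Rightarrow> 'a" and v :: "real^'m"
  have linL: "linear (L d)" for d
    by (rule linearI) (simp_all add: L_def scaleR_left_distrib sum.distrib scaleR_sum_right)
  define E where "E d k = {x. \<forall>h. norm h \<le> rr k \<longrightarrow> norm (f (x + h) - f x - L d h) \<le> e * norm h}" for d k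
  have closedE: "closed (E d k)" for d k
  proof -
    have eq: "E d k = (\<Inter>h\<in>{h. norm h \<le> rr k}. {x. norm (f (x + h) - f x - L d h) \<le> e * norm h})"
      unfolding E_def by blast
    show ?thesis unfolding eq
      by (intro closed_INT ballI closed_Collect_le continuous_intros contf contf')
  qed
  define A where "A d k = (\<Inter>j. G j (d j) k)" for d k
  define Dm where "Dm = (UNIV :: 'm set) \<rightarrow>\<^sub>E D"
  have cDm: "countable Dm" unfolding Dm_def using D1 by (intro countable_PiE) auto
  define N1 where "N1 j = UNIV - (\<Union>d\<in>D. \<Union>k. G j d k)" for j
  have N1: "negligible (N1 j)" for j
  proof -
    have N1b: "N1 j \<in> sets borel" unfolding N1_def
      using D1 closedG by (intro sets.Diff sets.countable_UN' borel_closed) auto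
    have "N1 j \<in> null_sets lborel"
    proof (rule null_set_of_null_lines[OF N1b, of "axis j 1"])
      fix x :: "real^'m"
      define \<gamma> where "\<gamma> t = f (x + t *\<^sub>R axis j 1)" for t
      let ?S = "{s. x + s *\<^sub>R axis j 1 \<in> N1 j}"
      have "norm (\<gamma> s - \<gamma> t) \<le> M * \<bar>s - t\<bar>" for s t
        using lip[of "x + s *\<^sub>R axis j 1" "x + t *\<^sub>R axis j 1"]
        by (simp add: \<gamma>_def scaleR_left_diff_distrib[symmetric])
      then have "negligible {s. \<not> (\<exists>d\<in>D. \<exists>r>0. \<forall>t. \<bar>t\<bar> \<le> r \<longrightarrow> norm (\<gamma> (s + t) - \<gamma> s - t *\<^sub>R d) \<le> e1 * \<bar>t\<bar>)}"
        using D2 e1 by blast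
      moreover have "?S \<subseteq> {s. \<not> (\<exists>d\<in>D. \<exists>r>0. \<forall>t. \<bar>t\<bar> \<le> r \<longrightarrow> norm (\<gamma> (s + t) - \<gamma> s - t *\<^sub>R d) \<le> e1 * \<bar>t\<bar>)}"
      proof safe
        fix s d r assume s: "x + s *\<^sub>R axis j 1 \<in> N1 j" and d: "d \<in> D" and r: "(0::real) < r"
          and le: "\<forall>t. \<bar>t\<bar> \<le> r \<longrightarrow> norm (\<gamma> (s + t) - \<gamma> s - t *\<^sub>R d) \<le> e1 * \<bar>t\<bar>"
        obtain k where k: "rr k < r" unfolding rr_def using reals_Archimedean[OF r] by blast
        have "x + s *\<^sub>R axis j 1 \<in> G j d k"
          using le k by (auto simp: G_def \<gamma>_def scaleR_left_distrib add.assoc)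
        then show False using s d by (auto simp: N1_def)
      qed
      ultimately have "negligible ?S" by (rule negligible_subset)
      moreover have "?S \<in> sets borel"
        using measurable_sets[of "\<lambda>s. x + s *\<^sub>R axis j 1" borel borel, OF _ N1b] by (simp add: vimage_def)
      ultimately show "?S \<in> null_sets lborel"
        by (simp add: negligible_iff_null_sets null_sets_def)
    qed
    then show ?thesis by (simp add: negligible_iff_null_sets null_sets_def)
  qed
  define N2 where "N2 d k = {x\<in>A d k. \<forall>r>0. \<exists>h. 0 < norm h \<and> norm h < r \<and> ball (x + h) (c * norm h) \<inter> A d k = {}}" for d k
  have N2: "negligible (N2 d k)" for d k unfolding N2_def by (rule negligible_porous[OF c])
  define N where "N = (\<Union>j. N1 j) \<union> (\<Union>d\<in>Dm. \<Union>k. N2 d k)"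
  have negN: "negligible N" unfolding N_def
    by (intro negligible_Un negligible_countable_Union countable_image cDm) (auto intro: N1 N2 negligible_countable_Union)
  have cover: "\<exists>d\<in>Dm. \<exists>k. x \<in> E d k" if x: "x \<notin> N" for x
  proof -
    have "\<forall>j. \<exists>d k. d \<in> D \<and> x \<in> G j d k" using x unfolding N_def N1_def by blast
    then obtain d k where dk: "\<And>j. d j \<in> D" "\<And>j. x \<in> G j (d j) (k j)" by metis
    define K where "K = Max (range k)"
    have kK: "rr K \<le> rr (k j)" for j
      unfolding rr_def K_def by (intro le_imp_inverse_le) auto
    have xA: "x \<in> A d K" unfolding A_def
    proof (rule INT_I)
      fix j
      show "x \<in> G j (d j) K" unfolding G_def
      proof (intro CollectI allI impI)
        fix t :: real assume "\<bar>t\<bar> \<le> rr K"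
        then have "\<bar>t\<bar> \<le> rr (k j)" using kK[of j] by linarith
        then show "norm (f (x + t *\<^sub>R axis j 1) - f x - t *\<^sub>R d j) \<le> e1 * \<bar>t\<bar>"
          using dk(2)[of j] unfolding G_def by blast
      qed
    qed
    have dDm: "d \<in> Dm" using dk(1) by (auto simp: Dm_def)
    have "x \<notin> N2 d K" using x dDm by (auto simp: N_def)
    then obtain r where r: "r > 0" "\<And>h. 0 < norm h \<Longrightarrow> norm h < r \<Longrightarrow> ball (x + h) (c * norm h) \<inter> A d K \<noteq> {}"
      using xA unfolding N2_def by blast
    obtain q where q: "rr q < min r (rr K)" unfolding rr_def using reals_Archimedean[of "min r (rr K)"] r(1) rr by (auto simp: rr_def)
    have "x \<in> E d q" unfolding E_def
    proof (intro CollectI allI impI)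
      fix h :: "real^'m" assume h: "norm h \<le> rr q"
      have "norm (f (x + h) - f x - (\<Sum>j\<in>UNIV. (h $ j) *\<^sub>R d j)) \<le> real CARD('m) * (e1 + 2 * M * c) * norm h"
      proof (rule partial_to_total_increment[OF lip _ xA])
        show "norm h \<le> rr K" using h q by simp
        fix y j t assume "y \<in> A d K" "\<bar>t\<bar> \<le> rr K"
        then show "norm (f (y + t *\<^sub>R axis j 1) - f y - t *\<^sub>R d j) \<le> e1 * \<bar>t\<bar>"
          by (auto simp: A_def G_def)
      next
        fix v :: "real^'m" assume v: "0 < norm v" "norm v \<le> norm h"
        then have "ball (x + v) (c * norm v) \<inter> A d K \<noteq> {}" using r(2)[of v] h q by simp
        then obtain y where "y \<in> A d K" "dist (x + v) y < c * norm v" by auto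
        then show "\<exists>y\<in>A d K. norm (x + v - y) \<le> c * norm v" by (auto simp: dist_norm intro!: bexI[of _ y])
      qed (use e1 c in auto)
      also have "\<dots> \<le> e * norm h" using total unfolding m_def by (intro mult_right_mono) auto
      finally show "norm (f (x + h) - f x - L d h) \<le> e * norm h" by (simp add: L_def)
    qed
    then show ?thesis using dDm by blast
  qed
  have Lbd: "norm (L d v) \<le> (M + e) * norm v" if x: "x \<in> E d k" for d k x v
  proof (cases "v = 0")
    case True then show ?thesis by (simp add: L_def)
  next
    case False
    define s where "s = rr k / norm v"
    have s: "0 < s" using False rr by (simp add: s_def)
    have "norm (s *\<^sub>R v) \<le> rr k" using False rr[of k] by (simp add: s_def)
    then have "norm (f (x + s *\<^sub>R v) - f x - L d (s *\<^sub>R v)) \<le> e * norm (s *\<^sub>R v)"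
      using x unfolding E_def by blast
    moreover have "norm (f (x + s *\<^sub>R v) - f x) \<le> M * norm (s *\<^sub>R v)" using lip[of "x + s *\<^sub>R v" x] by simp
    moreover have "norm (L d (s *\<^sub>R v)) \<le> norm (f (x + s *\<^sub>R v) - f x) + norm (f (x + s *\<^sub>R v) - f x - L d (s *\<^sub>R v))"
      using norm_triangle_ineq4[of "f (x + s *\<^sub>R v) - f x" "f (x + s *\<^sub>R v) - f x - L d (s *\<^sub>R v)"] by simp
    ultimately have "norm (L d (s *\<^sub>R v)) \<le> (M + e) * norm (s *\<^sub>R v)" by (simp add: distrib_right)
    then have "s * norm (L d v) \<le> s * ((M + e) * norm v)"
      unfolding linear_cmul[OF linL] norm_scaleR using s by (simp only: abs_of_pos mult.left_commute)
    then show ?thesis using s by (simp only: mult_le_cancel_left_pos)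
  qed
  obtain Z :: "(real^'m) set" where Z1: "countable Z" and dense: "\<forall>X. open X \<longrightarrow> X \<noteq> {} \<longrightarrow> (\<exists>z\<in>Z. z \<in> X)"
    using countable_dense_exists by (elim exE conjE)
  have Z2: "\<exists>z\<in>Z. dist z x < e" if "0 < e" for x e
  proof -
    have "\<exists>z\<in>Z. z \<in> ball x e" using dense[rule_format, of "ball x e"] that by simp
    then show ?thesis by (simp add: dist_commute)
  qed
  define Idx where "Idx = Dm \<times> (UNIV :: nat set) \<times> Z"
  have cI: "countable Idx" unfolding Idx_def using cDm Z1 by auto
  have Ine: "Idx \<noteq> {}"
  proof -
    have "D \<noteq> {}"
    proof
      assume "D = {}"
      then have "negligible (UNIV :: real set)" using D2[rule_format, of 1 "\<lambda>_. 0" 0] by simp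
      then show False by simp
    qed
    moreover have "Z \<noteq> {}" using Z2[of 1] by auto
    ultimately show ?thesis by (auto simp: Idx_def Dm_def PiE_eq_empty_iff)
  qed
  define g where "g = from_nat_into Idx"
  have g: "range g = Idx" unfolding g_def using Ine cI by (rule range_from_nat_into)
  define F0 where "F0 p = (case p of (d, k, z) \<Rightarrow> E d k \<inter> cball z (rr k / 2))" for p
  define F where "F i = F0 (g i)" for i
  define L' where "L' i = (if F i = {} then (\<lambda>_. 0) else L (fst (g i)))" for i
  show ?thesis
  proof (rule that[of F L'])
    fix i
    obtain d k z where gi: "g i = (d, k, z)" by (cases "g i") auto
    have Fi: "F i = E d k \<inter> cball z (rr k / 2)" by (simp add: F_def F0_def gi)
    show "closed (F i)" unfolding Fi using closedE by auto
    show "linear (L' i)" by (auto simp: L'_def linL intro!: linearI)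
    show "norm (L' i v) \<le> (M + e) * norm v" for v
      using Lbd[of _ d k v] M0 e by (auto simp: L'_def gi Fi)
    fix x y assume xy: "x \<in> F i" "y \<in> F i"
    have "dist x y \<le> dist x z + dist z y" by (rule dist_triangle)
    then have "norm (y - x) \<le> rr k" using xy unfolding Fi by (simp add: dist_norm norm_minus_commute)
    then have "norm (f (x + (y - x)) - f x - L d (y - x)) \<le> e * norm (y - x)"
      using xy unfolding Fi E_def by blast
    then show "norm (f y - f x - L' i (y - x)) \<le> e * norm (y - x)"
      using xy by (auto simp: L'_def gi)
  next
    have "UNIV - (\<Union>i. F i) \<subseteq> N"
    proof
      fix x assume x: "x \<in> UNIV - (\<Union>i. F i)"
      show "x \<in> N"
      proof (rule ccontr)
        assume "x \<notin> N"
        then obtain d k where dk: "d \<in> Dm" "x \<in> E d k" using cover by blast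
        obtain z where z: "z \<in> Z" "dist z x < rr k / 2" using Z2[of "rr k / 2" x] rr[of k] by auto
        have "(d, k, z) \<in> range g" unfolding g Idx_def using dk z by auto
        then obtain i where "g i = (d, k, z)" by auto
        then have "x \<in> F i" using dk z by (simp add: F_def F0_def)
        then show False using x by blast
      qed
    qed
    then show "negligible (UNIV - (\<Union>i. F i))" using negN negligible_subset by blast
  qed
qed

section \<open>Linear images of Euclidean space\<close>

lemma hausdorff_delta_le_finite_cover:
  fixes E :: "'i \<Rightarrow> 'a::metric_space set"
  assumes m: "0 < m" and K: "finite K" and \<delta>: "0 \<le> \<delta>" and A: "A \<subseteq> (\<Union>k\<in>K. E k)"
    and E: "\<And>k. k \<in> K \<Longrightarrow> bounded (E k)" "\<And>k. k \<in> K \<Longrightarrow> diameter (E k) \<le> \<delta>"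
  shows "hausdorff_delta m \<delta> A \<le> (\<Sum>k\<in>K. ennreal (unit_ball_vol (real m) / 2 ^ m * diameter (E k) ^ m))"
proof -
  let ?w = "\<lambda>E. ennreal (unit_ball_vol (real m) / 2 ^ m * diameter E ^ m)"
  obtain h where h: "bij_betw h {0..<card K} K" using ex_bij_betw_nat_finite[OF K] by blast
  define F where "F i = (if i < card K then E (h i) else {})" for i
  have hK: "h i \<in> K" if "i < card K" for i using h that by (auto simp: bij_betw_def)
  have "A \<subseteq> (\<Union>i. F i)"
  proof
    fix x assume "x \<in> A"
    then obtain k where k: "k \<in> K" "x \<in> E k" using A by blast
    have "k \<in> h ` {0..<card K}" using bij_betw_imp_surj_on[OF h] k(1) by simp
    then obtain i where "i < card K" "h i = k" by auto
    then have "x \<in> F i" using k \<open>h i = k\<close> by (simp add: F_def)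
    then show "x \<in> (\<Union>i. F i)" by blast
  qed
  then have "hausdorff_delta m \<delta> A \<le> (\<Sum>i. ?w (F i))"
    by (rule hausdorff_delta_le_cover) (auto simp: F_def hK E \<delta>)
  also have "\<dots> = (\<Sum>i\<in>{0..<card K}. ?w (F i))"
    by (rule suminf_finite) (auto simp: F_def m)
  also have "\<dots> = (\<Sum>i\<in>{0..<card K}. ?w (E (h i)))" by (intro sum.cong) (auto simp: F_def)
  also have "\<dots> = (\<Sum>k\<in>K. ?w (E k))" by (rule sum.reindex_bij_betw[OF h])
  finally show ?thesis .
qed

text \<open>Subdivide the cube into \<open>n ^ m\<close> cubes of side \<open>1 / n\<close>; the sum of the weights does not grow with \<open>n\<close>.\<close>

lemma hausdorff_measure_half_open_cube:
  "hausdorff_measure CARD('m) {v :: real^'m. \<forall>i. 0 \<le> v $ i \<and> v $ i < 1} < top"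
proof -
  let ?m = "CARD('m)"
  let ?H = "{v :: real^'m. \<forall>i. 0 \<le> v $ i \<and> v $ i < 1}"
  let ?c = "unit_ball_vol (real ?m) / 2 ^ ?m"
  have "hausdorff_delta ?m \<delta> ?H \<le> ennreal (?c * real ?m ^ ?m)" if \<delta>: "\<delta> > 0" for \<delta>
  proof -
    obtain n where n: "real ?m / \<delta> < real n" using reals_Archimedean2 by blast
    have n0: "0 < real n" using n \<delta> by (meson divide_nonneg_pos le_less_trans of_nat_0_le_iff)
    have nd: "real ?m / real n \<le> \<delta>" using n n0 \<delta> by (simp add: field_simps)
    define K where "K = (UNIV :: 'm set) \<rightarrow>\<^sub>E {..<n}"
    define E where "E k = {v :: real^'m. \<forall>i. real (k i) / real n \<le> v $ i \<and> v $ i \<le> (real (k i) + 1) / real n}" for k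
    have cK: "finite K" "card K = n ^ ?m" unfolding K_def by (auto simp: card_PiE intro!: finite_PiE)
    have dE: "dist x y \<le> real ?m / real n" if "x \<in> E k" "y \<in> E k" for x y k
    proof -
      have "dist x y \<le> (\<Sum>i\<in>UNIV. \<bar>(x - y) $ i\<bar>)" unfolding dist_norm by (rule norm_le_l1_cart)
      also have "\<dots> \<le> (\<Sum>i\<in>(UNIV :: 'm set). 1 / real n)"
      proof (rule sum_mono)
        fix i
        have "real (k i) / real n \<le> x $ i" "x $ i \<le> real (k i) / real n + 1 / real n"
             "real (k i) / real n \<le> y $ i" "y $ i \<le> real (k i) / real n + 1 / real n"
          using that by (auto simp: E_def add_divide_distrib)
        then show "\<bar>(x - y) $ i\<bar> \<le> 1 / real n" by (simp add: abs_le_iff)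
      qed
      finally show ?thesis by simp
    qed
    have "hausdorff_delta ?m \<delta> ?H \<le> (\<Sum>k\<in>K. ennreal (?c * diameter (E k) ^ ?m))"
    proof (rule hausdorff_delta_le_finite_cover)
      show "?H \<subseteq> (\<Union>k\<in>K. E k)"
      proof
        fix v :: "real^'m" assume v: "v \<in> ?H"
        define k where "k i = nat \<lfloor>real n * v $ i\<rfloor>" for i
        have k: "real (k i) \<le> real n * v $ i" "real n * v $ i < real (k i) + 1" for i
          using v n0 by (auto simp: k_def)
        have "k i < n" for i
        proof -
          have "real n * v $ i < real n * 1" using v n0 by (intro mult_strict_left_mono) auto
          then have "real (k i) < real n" using k(1)[of i] by linarith
          then show ?thesis by simp
        qed
        then have "k \<in> K" by (auto simp: K_def)
        moreover have "v \<in> E k" using k n0 by (auto simp: E_def field_simps intro: less_imp_le)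
        ultimately show "v \<in> (\<Union>k\<in>K. E k)" by blast
      qed
      show "bounded (E k)" for k unfolding bounded_two_points using dE[of _ k] by blast
      show "diameter (E k) \<le> \<delta>" for k
        using dE[of _ k] nd \<delta> by (intro diameter_le_dist) (auto intro: order_trans)
    qed (use cK \<delta> in auto)
    also have "\<dots> \<le> (\<Sum>k\<in>K. ennreal (?c * (real ?m / real n) ^ ?m))"
    proof (intro sum_mono ennreal_leI mult_left_mono power_mono)
      fix k
      show "diameter (E k) \<le> real ?m / real n" using dE[of _ k] n0 by (intro diameter_le_dist) auto
      show "0 \<le> diameter (E k)"
        by (rule diameter_ge_0) (unfold bounded_two_points, use dE[of _ k] in blast)
    qed auto
    also have "\<dots> = ennreal (real (n ^ ?m)) * ennreal (?c * (real ?m / real n) ^ ?m)"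
      by (simp add: cK(2) ennreal_of_nat_eq_real_of_nat)
    also have "\<dots> = ennreal (real (n ^ ?m) * (?c * (real ?m / real n) ^ ?m))"
      by (rule ennreal_mult[symmetric]) auto
    also have "real (n ^ ?m) * (?c * (real ?m / real n) ^ ?m) = ?c * real ?m ^ ?m"
      using n0 by (simp add: power_divide)
    finally show ?thesis .
  qed
  then have "hausdorff_measure ?m ?H \<le> ennreal (?c * real ?m ^ ?m)"
    unfolding hausdorff_measure_def by (intro SUP_least) auto
  then show ?thesis by (rule le_less_trans) simp
qed

lemma hausdorff_measure_bounded_finite:
  fixes S :: "(real^'m) set"
  assumes "bounded S" shows "hausdorff_measure CARD('m) S < top"
proof -
  let ?H = "{v :: real^'m. \<forall>i. 0 \<le> v $ i \<and> v $ i < 1}"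
  obtain r where r: "0 < r" "\<And>x. x \<in> S \<Longrightarrow> norm x \<le> r" using assms bounded_pos by blast
  \<comment> \<open>Any factor above \<open>2 * r\<close> moves \<open>S\<close> into the half-open cube after scaling and translation.\<close>
  define t where "t = 3 * r"
  have t: "0 < t" using r by (simp add: t_def)
  let ?g = "\<lambda>v :: real^'m. t *\<^sub>R v - (\<chi> i. t / 2)"
  have "S \<subseteq> ?g ` ?H"
  proof
    fix x assume x: "x \<in> S"
    have xi: "\<bar>x $ i\<bar> \<le> r" for i using component_le_norm_cart[of x i] r(2)[OF x] by linarith
    let ?v = "(1 / t) *\<^sub>R (x + (\<chi> i. t / 2))"
    have "0 \<le> ?v $ i \<and> ?v $ i < 1" for i
      using xi[of i] t r(1) by (auto simp: t_def field_simps abs_le_iff)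
    then have "?v \<in> ?H" by blast
    moreover have "?g ?v = x" using t by simp
    ultimately show "x \<in> ?g ` ?H" by (metis (no_types, lifting) image_eqI)
  qed
  then have "hausdorff_measure CARD('m) S \<le> hausdorff_measure CARD('m) (?g ` ?H)"
    by (rule hausdorff_measure_mono)
  also have "\<dots> \<le> ennreal (t ^ CARD('m)) * hausdorff_measure CARD('m) ((\<lambda>x. x) ` ?H)"
  proof (rule hausdorff_measure_compare[OF t])
    fix x y :: "real^'m"
    have "?g x - ?g y = t *\<^sub>R (x - y)" by (simp add: algebra_simps)
    then show "dist (?g x) (?g y) \<le> t * dist x y" using t by (simp add: dist_norm)
  qed
  also have "\<dots> < top" using hausdorff_measure_half_open_cube[where 'm = 'm]
    by (simp add: ennreal_mult_less_top)
  finally show ?thesis .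
qed

lemma emeasure_lborel_cbox_cart:
  fixes a b :: "real^'m"
  assumes "\<And>i. a $ i \<le> b $ i"
  shows "emeasure lborel (cbox a b) = ennreal (\<Prod>i\<in>UNIV. b $ i - a $ i)"
proof -
  have "cbox a b \<noteq> {}" using assms by (auto simp: interval_ne_empty_cart)
  moreover have "emeasure lborel (cbox a b) = ennreal (measure lborel (cbox a b))"
    using emeasure_lborel_cbox_finite[of a b] by (intro emeasure_eq_ennreal_measure) auto
  ultimately show ?thesis by (simp add: content_cbox_cart)
qed

lemma emeasure_unit_cube: "emeasure lborel (cbox 0 (vec 1 :: real^'m)) = 1"
  by (subst emeasure_lborel_cbox_cart) auto

text \<open>Uniqueness of Haar measure by Tonelli's theorem: integrate \<open>indicator Q y * indicator S (x + y)\<close> with respect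
  to \<open>\<nu>\<close> in \<open>x\<close> and Lebesgue measure in \<open>y\<close>. Integrating over \<open>x\<close> first gives \<open>emeasure \<nu> S\<close>, and
  integrating over \<open>y\<close> first, after a translation, a multiple of the Lebesgue measure of \<open>S\<close>.\<close>

lemma translation_invariant_measure_unique:
  fixes \<nu> :: "'n::euclidean_space measure"
  assumes sets: "sets \<nu> = sets borel" and sf: "sigma_finite_measure \<nu>"
    and inv: "\<And>S y. S \<in> sets borel \<Longrightarrow> emeasure \<nu> {x. x + y \<in> S} = emeasure \<nu> S"
    and Q: "Q \<in> sets borel" "emeasure lborel Q = 1" and S: "S \<in> sets borel"
  shows "emeasure \<nu> S = emeasure \<nu> Q * emeasure lborel S"
proof -
  interpret sf: sigma_finite_measure \<nu> by (rule sf)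
  interpret P: pair_sigma_finite \<nu> "lborel :: 'n measure" ..
  have sp: "space \<nu> = UNIV" using sets by (metis sets_eq_imp_space_eq space_borel)
  have [measurable_cong]: "sets \<nu> = sets borel" by (rule sets)
  have shiftl: "(\<integral>\<^sup>+y. f (y + x) \<partial>lborel) = (\<integral>\<^sup>+y. f y \<partial>lborel)"
    if [measurable]: "f \<in> borel_measurable borel" for f :: "'n \<Rightarrow> ennreal" and x
  proof -
    have "(\<integral>\<^sup>+y. f y \<partial>lborel) = (\<integral>\<^sup>+y. f y \<partial>distr lborel borel ((+) x))" by (simp add: lborel_distr_plus)
    also have "\<dots> = (\<integral>\<^sup>+y. f (x + y) \<partial>lborel)" by (intro nn_integral_distr) auto
    finally show ?thesis by (simp add: add.commute)
  qed
  define R where "R = {x. - x \<in> Q}"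
  have R: "R \<in> sets borel"
  proof -
    have "(\<lambda>x :: 'n. - x) -` Q \<inter> space borel \<in> sets borel" using Q(1) by (intro measurable_sets[of _ borel borel]) auto
    then show ?thesis by (simp add: R_def vimage_def)
  qed
  have [measurable]: "Q \<in> sets borel" "R \<in> sets borel" using Q R by auto
  have main: "emeasure \<nu> S = emeasure \<nu> R * emeasure lborel S" if [measurable]: "S \<in> sets borel" for S
  proof -
    have shift: "(\<integral>\<^sup>+x. indicator S (x + y) \<partial>\<nu>) = emeasure \<nu> S" for y
    proof -
      have "(\<lambda>x. x + y) -` S \<inter> space borel \<in> sets borel" using that by (intro measurable_sets[of _ borel borel]) auto
      then have m: "{x. x + y \<in> S} \<in> sets \<nu>" by (simp add: sets vimage_def)
      have "(\<integral>\<^sup>+x. indicator S (x + y) \<partial>\<nu>) = (\<integral>\<^sup>+x. indicator {x. x + y \<in> S} x \<partial>\<nu>)"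
        by (intro nn_integral_cong) (auto simp: indicator_def)
      also have "\<dots> = emeasure \<nu> {x. x + y \<in> S}" using m by (rule nn_integral_indicator)
      finally show ?thesis using inv[OF that] by simp
    qed
    have "emeasure \<nu> S = (\<integral>\<^sup>+y. indicator Q y * emeasure \<nu> S \<partial>lborel)"
      using Q by (simp add: nn_integral_multc)
    also have "\<dots> = (\<integral>\<^sup>+y. \<integral>\<^sup>+x. indicator Q y * indicator S (x + y) \<partial>\<nu> \<partial>lborel)"
      by (intro nn_integral_cong) (simp add: nn_integral_cmult shift)
    also have "\<dots> = (\<integral>\<^sup>+x. \<integral>\<^sup>+y. indicator Q y * indicator S (x + y) \<partial>lborel \<partial>\<nu>)"
      by (rule P.Fubini') measurable
    also have "\<dots> = (\<integral>\<^sup>+x. \<integral>\<^sup>+y. indicator Q (y - x) * indicator S y \<partial>lborel \<partial>\<nu>)"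
    proof (rule nn_integral_cong)
      fix x
      show "(\<integral>\<^sup>+y. indicator Q y * indicator S (x + y) \<partial>lborel) = (\<integral>\<^sup>+y. indicator Q (y - x) * indicator S y \<partial>lborel)"
        using shiftl[of "\<lambda>y. indicator Q (y - x) * indicator S y" x] by (simp add: add.commute)
    qed
    also have "\<dots> = (\<integral>\<^sup>+y. \<integral>\<^sup>+x. indicator Q (y - x) * indicator S y \<partial>\<nu> \<partial>lborel)"
      by (rule P.Fubini'[symmetric]) measurable
    also have "\<dots> = (\<integral>\<^sup>+y. emeasure \<nu> R * indicator S y \<partial>lborel)"
    proof (rule nn_integral_cong)
      fix y
      have "(\<lambda>x. x + - y) -` R \<inter> space borel \<in> sets borel" using R by (intro measurable_sets[of _ borel borel]) auto
      then have m: "{x. x + - y \<in> R} \<in> sets \<nu>" by (simp add: sets vimage_def)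
      have "(\<integral>\<^sup>+x. indicator Q (y - x) * indicator S y \<partial>\<nu>) = (\<integral>\<^sup>+x. indicator {x. x + - y \<in> R} x \<partial>\<nu>) * indicator S y"
        using m by (subst nn_integral_multc[symmetric]) (auto intro!: nn_integral_cong simp: R_def indicator_def)
      also have "(\<integral>\<^sup>+x. indicator {x. x + - y \<in> R} x \<partial>\<nu>) = emeasure \<nu> {x. x + - y \<in> R}"
        using m by (rule nn_integral_indicator)
      also have "\<dots> = emeasure \<nu> R" using R by (rule inv)
      finally show "(\<integral>\<^sup>+x. indicator Q (y - x) * indicator S y \<partial>\<nu>) = emeasure \<nu> R * indicator S y" .
    qed
    also have "\<dots> = emeasure \<nu> R * emeasure lborel S" by (rule nn_integral_cmult_indicator) simp
    finally show ?thesis .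
  qed
  show ?thesis using main[OF S] main[OF Q(1)] Q(2) by simp
qed

text \<open>On a compact set an injective continuous map is a homeomorphism onto its image.\<close>

lemma borel_image_injective_compact:
  fixes f :: "'a::t2_space \<Rightarrow> 'b::t2_space"
  assumes F: "compact F" and f: "continuous_on F f" "inj_on f F" and S: "S \<in> sets borel" "S \<subseteq> F"
  shows "f ` S \<in> sets borel"
proof -
  let ?g = "inv_into F f"
  have cF: "compact (f ` F)" using f(1) F by (rule compact_continuous_image)
  have cg: "continuous_on (f ` F) ?g"
    by (rule continuous_on_inv[OF f(1) F]) (use f(2) in auto)
  have "?g \<in> borel_measurable (restrict_space borel (f ` F))"
    using cg by (rule borel_measurable_continuous_on_restrict)
  then have "?g -` S \<inter> space (restrict_space borel (f ` F)) \<in> sets (restrict_space borel (f ` F))"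
    using S(1) by (rule measurable_sets)
  then have "?g -` S \<inter> f ` F \<in> sets borel"
    using cF by (subst (asm) sets_restrict_space_iff) (auto simp: borel_compact)
  moreover have "?g -` S \<inter> f ` F = f ` S"
  proof safe
    fix x assume "?g (f x) \<in> S" "x \<in> F"
    then show "f x \<in> f ` S" using f(2) by simp
  next
    fix x assume "x \<in> S"
    then show "f x \<in> ?g -` S" "f x \<in> f ` F" using S(2) f(2) by auto
  qed
  ultimately show ?thesis by simp
qed

lemma linear_bounded_below_inj:
  fixes h :: "'b::real_normed_vector \<Rightarrow> 'c::real_normed_vector"
  assumes h: "linear h" and \<sigma>: "0 < \<sigma>" "\<And>v. \<sigma> * norm v \<le> norm (h v)"
  shows "inj h"
proof (rule linear_injective_0[OF h, THEN iffD2], intro allI impI)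
  fix v assume "h v = 0"
  then have "\<sigma> * norm v \<le> 0" using \<sigma>(2)[of v] by simp
  then show "v = 0" using \<sigma>(1) by (simp add: mult_le_0_iff)
qed

lemma borel_linear_image:
  fixes h :: "real^'m \<Rightarrow> 'b::real_normed_vector"
  assumes h: "linear h" and \<sigma>: "0 < \<sigma>" "\<And>v. \<sigma> * norm v \<le> norm (h v)" and S: "S \<in> sets borel"
  shows "h ` S \<in> sets borel"
proof -
  have "inj h" using h \<sigma> by (rule linear_bounded_below_inj)
  have "continuous_on UNIV h"
    using h by (simp add: linear_conv_bounded_linear linear_continuous_on)
  have "h ` (S \<inter> cball 0 (real n)) \<in> sets borel" for n
  proof (rule borel_image_injective_compact[of "cball 0 (real n)"])
    show "continuous_on (cball 0 (real n)) h" using \<open>continuous_on UNIV h\<close> continuous_on_subset by blast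
    show "inj_on h (cball 0 (real n))" using \<open>inj h\<close> inj_on_subset by blast
  qed (use S in auto)
  then have "(\<Union>n. h ` (S \<inter> cball 0 (real n))) \<in> sets borel" by (intro sets.countable_UN) auto
  moreover have "(\<Union>n. h ` (S \<inter> cball 0 (real n))) = h ` S"
  proof safe
    fix x assume "x \<in> S"
    obtain n where "norm x \<le> real n" using real_arch_simple by blast
    then show "h x \<in> (\<Union>n. h ` (S \<inter> cball 0 (real n)))" using \<open>x \<in> S\<close> by (auto intro!: exI[of _ n])
  qed auto
  ultimately show ?thesis by simp
qed

text \<open>The Jacobian of an injective linear map \<open>h\<close> is the Hausdorff measure of the image of the unit cube: pulled
  back by \<open>h\<close>, Hausdorff measure is a translation invariant measure on Euclidean space.\<close>

lemma hausdorff_measure_linear_image: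
  fixes h :: "real^'m \<Rightarrow> 'b::real_normed_vector"
  assumes h: "linear h" and \<sigma>: "0 < \<sigma>" "\<And>v. \<sigma> * norm v \<le> norm (h v)" and S: "S \<in> sets borel"
  shows "hausdorff_measure CARD('m) (h ` S) =
    hausdorff_measure CARD('m) (h ` cbox 0 (vec 1)) * emeasure lborel S"
proof -
  let ?m = "CARD('m)"
  have inj: "inj h" using h \<sigma> by (rule linear_bounded_below_inj)
  obtain C0 where C0: "\<And>x. norm (h x) \<le> C0 * norm x" using linear_bounded[OF h] by blast
  define C where "C = \<bar>C0\<bar> + 1"
  have C: "0 < C" "\<And>x. norm (h x) \<le> C * norm x"
  proof -
    show "0 < C" by (simp add: C_def)
    fix x :: "real^'m"
    have "C0 * norm x \<le> C * norm x" by (intro mult_right_mono) (auto simp: C_def)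
    then show "norm (h x) \<le> C * norm x" using C0[of x] by linarith
  qed
  have bor: "h ` S \<in> sets borel" if "S \<in> sets borel" for S using borel_linear_image[OF h \<sigma> that] .
  let ?R = "restrict_space (hausdorff_borel ?m) (range h)"
  have rb: "range h \<in> sets borel" using bor[of UNIV] by simp
  have vim: "inv h -` S \<inter> range h = h ` S" for S using inj by auto
  define \<nu> where "\<nu> = distr ?R borel (inv h)"
  have meas: "inv h \<in> measurable ?R borel"
  proof (rule measurableI)
    fix S :: "(real^'m) set" assume "S \<in> sets borel"
    then show "inv h -` S \<inter> space ?R \<in> sets ?R"
      using bor[of S] rb by (auto simp: space_restrict_space vim sets_restrict_space_iff)
  qed simp
  have em: "emeasure \<nu> S = hausdorff_measure ?m (h ` S)" if S: "S \<in> sets borel" for S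
  proof -
    have "emeasure \<nu> S = emeasure ?R (inv h -` S \<inter> space ?R)"
      unfolding \<nu>_def by (rule emeasure_distr[OF meas S])
    also have "inv h -` S \<inter> space ?R = h ` S" by (simp add: space_restrict_space vim)
    also have "emeasure ?R (h ` S) = emeasure (hausdorff_borel ?m) (h ` S)"
      using rb by (intro emeasure_restrict_space) auto
    also have "\<dots> = hausdorff_measure ?m (h ` S)"
      using bor[OF S] by (intro emeasure_hausdorff_borel) auto
    finally show ?thesis .
  qed
  have "emeasure \<nu> S = emeasure \<nu> (cbox 0 (vec 1)) * emeasure lborel S"
  proof (rule translation_invariant_measure_unique)
    show "sets \<nu> = sets borel" by (simp add: \<nu>_def)
    show "sigma_finite_measure \<nu>"
    proof
      show "\<exists>A. countable A \<and> A \<subseteq> sets \<nu> \<and> \<Union>A = space \<nu> \<and> (\<forall>a\<in>A. emeasure \<nu> a \<noteq> \<infinity>)"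
      proof (intro exI[of _ "range (\<lambda>n. cball 0 (real n))"] conjI ballI)
        show "\<Union>(range (\<lambda>n. cball (0 :: real^'m) (real n))) = space \<nu>"
          using real_arch_simple by (auto simp: \<nu>_def)
        fix a assume "a \<in> range (\<lambda>n. cball (0 :: real^'m) (real n))"
        then obtain n where a: "a = cball (0 :: real^'m) (real n)" by blast
        have "hausdorff_measure ?m (h ` a) \<le> ennreal (C ^ ?m) * hausdorff_measure ?m ((\<lambda>x. x) ` a)"
        proof (rule hausdorff_measure_compare[OF C(1)])
          fix x y
          show "dist (h x) (h y) \<le> C * dist x y"
            using C(2)[of "x - y"] by (simp add: dist_norm linear_diff[OF h])
        qed
        also have "\<dots> < top" using hausdorff_measure_bounded_finite[of a] a by (simp add: ennreal_mult_less_top)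
        finally show "emeasure \<nu> a \<noteq> \<infinity>" using a by (simp add: em)
      qed (auto simp: \<nu>_def)
    qed
    fix S :: "(real^'m) set" and y assume S: "S \<in> sets borel"
    have m: "{x. x + y \<in> S} \<in> sets borel"
      using measurable_sets[of "\<lambda>x. x + y" borel borel S] S by (simp add: vimage_def)
    have img: "S = (\<lambda>x. x + y) ` {x. x + y \<in> S}"
      by (auto simp: image_iff intro!: exI[of _ "_ - y"])
    have "hausdorff_measure ?m (h ` {x. x + y \<in> S}) \<le> ennreal (1 ^ ?m) * hausdorff_measure ?m ((\<lambda>x. h (x + y)) ` {x. x + y \<in> S})"
      by (rule hausdorff_measure_compare) (auto simp: dist_norm linear_diff[OF h, symmetric])
    moreover have "hausdorff_measure ?m ((\<lambda>x. h (x + y)) ` {x. x + y \<in> S}) \<le> ennreal (1 ^ ?m) * hausdorff_measure ?m (h ` {x. x + y \<in> S})"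
      by (rule hausdorff_measure_compare) (auto simp: dist_norm linear_diff[OF h, symmetric])
    moreover have "(\<lambda>x. h (x + y)) ` {x. x + y \<in> S} = h ` S"
      by (subst (2) img) (simp only: image_image)
    ultimately show "emeasure \<nu> {x. x + y \<in> S} = emeasure \<nu> S" using em[OF S] em[OF m] by simp
  qed (use S emeasure_unit_cube in auto)
  then show ?thesis using S by (simp add: em)
qed

text \<open>The image measure is translation invariant, and the unit ball fixes the constant.\<close>

lemma emeasure_orthogonal_image:
  fixes T :: "real^'m \<Rightarrow> real^'m"
  assumes T: "orthogonal_transformation T" and S: "S \<in> sets borel"
  shows "emeasure lborel (T ` S) = emeasure lborel S"
proof -
  define I where "I = inv T"
  have I: "orthogonal_transformation I" unfolding I_def using T by (rule orthogonal_transformation_inv)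
  have TI: "T (I x) = x" "I (T x) = x" for x
    unfolding I_def using orthogonal_transformation_bij[OF T] by (auto simp: bij_is_surj surj_f_inv_f bij_is_inj inv_f_f)
  have linI: "linear I" using I by (rule orthogonal_transformation_linear)
  have [measurable]: "I \<in> borel_measurable borel"
    using linI by (intro borel_measurable_continuous_onI linear_continuous_on) (simp add: linear_conv_bounded_linear)
  define \<nu> where "\<nu> = distr lborel borel I"
  have em: "emeasure \<nu> S = emeasure lborel (T ` S)" if "S \<in> sets borel" for S
  proof -
    have "I -` S = T ` S" using TI by (auto simp: image_iff intro: exI[of _ "I _"]) (metis TI(1))
    then show ?thesis unfolding \<nu>_def using that by (subst emeasure_distr) auto
  qed
  have bij: "T ` cball 0 r = cball 0 r" for r
  proof -
    have "norm (T x) = norm x" "norm (I x) = norm x" for x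
      using T I by (auto simp: orthogonal_transformation)
    then show ?thesis using TI by (auto simp: image_iff intro!: bexI[of _ "I _"])
  qed
  have nuc: "emeasure \<nu> (cball 0 r) = emeasure lborel (cball (0 :: real^'m) r)" for r by (simp add: em bij)
  have inv: "emeasure \<nu> S = emeasure \<nu> (cbox 0 (vec 1)) * emeasure lborel S" if "S \<in> sets borel" for S
  proof (rule translation_invariant_measure_unique)
    show "sigma_finite_measure \<nu>"
    proof
      show "\<exists>A. countable A \<and> A \<subseteq> sets \<nu> \<and> \<Union>A = space \<nu> \<and> (\<forall>a\<in>A. emeasure \<nu> a \<noteq> \<infinity>)"
      proof (intro exI[of _ "range (\<lambda>n. cball 0 (real n))"] conjI ballI)
        show "\<Union>(range (\<lambda>n. cball (0 :: real^'m) (real n))) = space \<nu>"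
          using real_arch_simple by (auto simp: \<nu>_def)
        fix a assume "a \<in> range (\<lambda>n. cball (0 :: real^'m) (real n))"
        then obtain n where "a = cball (0 :: real^'m) (real n)" by blast
        then show "emeasure \<nu> a \<noteq> \<infinity>"
          using emeasure_compact_finite[OF compact_cball, of "0 :: real^'m" "real n"] by (simp add: nuc)
      qed (auto simp: \<nu>_def)
    qed
    fix S :: "(real^'m) set" and y assume S: "S \<in> sets borel"
    have m: "{x. x + y \<in> S} \<in> sets borel"
      using measurable_sets[of "\<lambda>x. x + y" borel borel S] S by (simp add: vimage_def)
    have "emeasure \<nu> {x. x + y \<in> S} = emeasure lborel (I -` {x. x + y \<in> S})"
      unfolding \<nu>_def using m by (subst emeasure_distr) auto
    also have "I -` {x. x + y \<in> S} = (+) (T y) -` (I -` S)"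
      using TI by (auto simp: linear_add[OF linI] add.commute)
    also have "emeasure lborel \<dots> = emeasure (distr lborel borel ((+) (T y))) (I -` S)"
      using S measurable_sets[of I borel borel S] by (subst emeasure_distr) auto
    also have "\<dots> = emeasure lborel (I -` S)" by (simp add: lborel_distr_plus)
    also have "\<dots> = emeasure \<nu> S" unfolding \<nu>_def using S by (subst emeasure_distr) auto
    finally show "emeasure \<nu> {x. x + y \<in> S} = emeasure \<nu> S" .
  qed (use that emeasure_unit_cube in \<open>auto simp: \<nu>_def\<close>)
  let ?b = "emeasure lborel (cball (0 :: real^'m) 1)"
  have b: "?b \<noteq> top" "?b \<noteq> 0"
  proof -
    have "0 < unit_ball_vol (real CARD('m))" by (rule unit_ball_vol_pos) simp
    then have "unit_ball_vol (real CARD('m)) \<noteq> 0" by (rule less_imp_neq[THEN not_sym])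
    then show "?b \<noteq> 0" by (simp add: emeasure_cball)
  qed (use emeasure_compact_finite[OF compact_cball, of "0 :: real^'m" 1] in \<open>simp add: less_top\<close>)
  have eq: "?b = emeasure \<nu> (cbox 0 (vec 1)) * ?b" using inv[of "cball 0 1"] by (simp add: nuc)
  have "emeasure \<nu> (cbox 0 (vec 1)) = (emeasure \<nu> (cbox 0 (vec 1)) * ?b) / ?b"
    by (rule mult_divide_eq_ennreal[symmetric]) (use b in auto)
  also have "\<dots> = ?b / ?b" by (simp only: eq[symmetric])
  also have "\<dots> = 1" using b by (intro ennreal_divide_self) (auto simp: less_top)
  finally have "emeasure \<nu> (cbox 0 (vec 1)) = 1" .
  then show ?thesis using inv[OF S] em[OF S] by simp
qed

section \<open>Thin images\<close>

text \<open>Images that are thin in one direction have small measure, at a rate that is linear in the thickness \<open>a\<close>. Rotate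
  so that the first axis points in the short direction \<open>u\<close>, and rescale this axis by \<open>a\<close> and the others by
  \<open>b\<close>. The resulting map \<open>R\<close> of Euclidean space multiplies volume by \<open>a * b ^ (CARD('m) - 1)\<close>, and \<open>g\<close> is
  Lipschitz relative to \<open>R\<close> with constant \<open>CARD('m)\<close>. The lemma takes the place of the continuity of the
  Jacobian at degenerate linear maps.\<close>

lemma hausdorff_measure_thin_image:
  fixes g :: "real^'m \<Rightarrow> 'b::metric_space" and P :: "real^'m \<Rightarrow> 'c::real_normed_vector"
  assumes P: "linear P" and u: "norm u = 1" "norm (P u) + \<tau> \<le> a"
    and b: "\<And>v. norm (P v) + \<tau> * norm v \<le> b * norm v" and ab: "0 < a" "0 < b" and \<tau>: "0 \<le> \<tau>"
    and S: "S \<in> sets borel"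
    and g: "\<And>x y. x \<in> S \<Longrightarrow> y \<in> S \<Longrightarrow> dist (g x) (g y) \<le> norm (P (x - y)) + \<tau> * norm (x - y)"
  shows "hausdorff_measure CARD('m) (g ` S) \<le> ennreal (real CARD('m) ^ CARD('m) * (a * b ^ (CARD('m) - 1))) *
     hausdorff_measure CARD('m) (cbox 0 (vec 1 :: real^'m)) * emeasure lborel S"
proof -
  let ?m = "CARD('m)"
  let ?Q = "cbox 0 (vec 1 :: real^'m)"
  define j0 :: 'm where "j0 = undefined"
  have na: "norm (axis j0 1 :: real^'m) = 1" by simp
  obtain T :: "real^'m \<Rightarrow> real^'m" where T: "orthogonal_transformation T" "T (axis j0 1) = u"
    by (rule orthogonal_transformation_exists_1[OF na u(1)])
  define I where "I = inv T"
  have I: "orthogonal_transformation I" unfolding I_def using T(1) by (rule orthogonal_transformation_inv)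
  have TI: "T (I x) = x" "I (T x) = x" for x
    unfolding I_def using orthogonal_transformation_bij[OF T(1)]
    by (auto simp: bij_is_surj surj_f_inv_f bij_is_inj inv_f_f)
  have linI: "linear I" and linT: "linear T" using I T by (auto intro: orthogonal_transformation_linear)
  have nT: "norm (T x) = norm x" and nI: "norm (I x) = norm x" for x
    using T(1) I by (auto simp: orthogonal_transformation)
  define wt where "wt j = (if j = j0 then a else b)" for j
  have wt: "0 < wt j" for j using ab by (simp add: wt_def)
  define R where "R v = (\<chi> j. wt j * (I v $ j))" for v
  have linR: "linear R"
    by (rule linearI) (simp_all add: R_def vec_eq_iff linear_add[OF linI] linear_cmul[OF linI] algebra_simps)
  define \<sigma> where "\<sigma> = min a b"
  have \<sigma>: "0 < \<sigma>" using ab by (simp add: \<sigma>_def)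
  have Rlow: "\<sigma> * norm v \<le> norm (R v)" for v
  proof -
    have "norm (\<sigma> *\<^sub>R I v) \<le> norm (R v)"
    proof (rule norm_le_componentwise_cart)
      fix i
      have "\<sigma> \<le> wt i" by (simp add: \<sigma>_def wt_def)
      then have "\<sigma> * \<bar>I v $ i\<bar> \<le> wt i * \<bar>I v $ i\<bar>" by (intro mult_right_mono) auto
      then show "norm ((\<sigma> *\<^sub>R I v) $ i) \<le> norm (R v $ i)" using \<sigma> wt[of i] by (simp add: R_def abs_mult)
    qed
    then show ?thesis using \<sigma> nI by simp
  qed
  have key: "norm (P v) + \<tau> * norm v \<le> real ?m * norm (R v)" for v
  proof -
    let ?w = "I v"
    have "v = T (\<Sum>j\<in>UNIV. ?w $ j *\<^sub>R axis j 1)"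
      using basis_expansion[of ?w] TI by (simp add: scalar_mult_eq_scaleR)
    then have v: "v = (\<Sum>j\<in>UNIV. ?w $ j *\<^sub>R T (axis j 1))"
      by (simp add: linear_sum[OF linT] linear_cmul[OF linT])
    have "norm (P v) \<le> (\<Sum>j\<in>UNIV. \<bar>?w $ j\<bar> * norm (P (T (axis j 1))))"
      by (subst v) (simp add: linear_sum[OF P] linear_cmul[OF P] sum_norm_le)
    moreover have "norm v \<le> (\<Sum>j\<in>UNIV. \<bar>?w $ j\<bar> * norm (T (axis j (1::real))))"
      by (subst (1) v) (simp add: sum_norm_le)
    then have "\<tau> * norm v \<le> \<tau> * (\<Sum>j\<in>UNIV. \<bar>?w $ j\<bar> * norm (T (axis j (1::real))))"
      using \<tau> by (rule mult_left_mono)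
    ultimately have "norm (P v) + \<tau> * norm v \<le>
        (\<Sum>j\<in>UNIV. \<bar>?w $ j\<bar> * norm (P (T (axis j 1)))) + \<tau> * (\<Sum>j\<in>UNIV. \<bar>?w $ j\<bar> * norm (T (axis j (1::real))))"
      by (rule add_mono)
    also have "\<dots> = (\<Sum>j\<in>UNIV. \<bar>?w $ j\<bar> * (norm (P (T (axis j 1))) + \<tau> * norm (T (axis j 1))))"
      by (simp add: sum_distrib_left sum.distrib algebra_simps)
    also have "\<dots> \<le> (\<Sum>j\<in>UNIV. \<bar>?w $ j\<bar> * wt j)"
    proof (intro sum_mono mult_left_mono)
      fix j
      show "norm (P (T (axis j 1))) + \<tau> * norm (T (axis j 1)) \<le> wt j"
      proof (cases "j = j0")
        case True then show ?thesis using u T(2) by (simp add: wt_def)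
      next
        case False then show ?thesis using b[of "T (axis j 1)"] by (simp add: wt_def nT)
      qed
    qed auto
    also have "\<dots> = (\<Sum>j\<in>UNIV. \<bar>R v $ j\<bar>)"
      using wt by (intro sum.cong) (auto simp: R_def abs_mult less_imp_le)
    also have "\<dots> \<le> (\<Sum>j\<in>(UNIV :: 'm set). norm (R v))" by (intro sum_mono component_le_norm_cart)
    finally show ?thesis by simp
  qed
  have 1: "hausdorff_measure ?m (g ` S) \<le> ennreal (real ?m ^ ?m) * hausdorff_measure ?m (R ` S)"
  proof (rule hausdorff_measure_compare)
    fix x y assume "x \<in> S" "y \<in> S"
    then have "dist (g x) (g y) \<le> norm (P (x - y)) + \<tau> * norm (x - y)" by (rule g)
    also have "\<dots> \<le> real ?m * norm (R (x - y))" by (rule key)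
    finally show "dist (g x) (g y) \<le> real ?m * dist (R x) (R y)" by (simp add: dist_norm linear_diff[OF linR])
  qed simp
  have 2: "hausdorff_measure ?m (R ` S) = hausdorff_measure ?m (R ` ?Q) * emeasure lborel S" if "S \<in> sets borel" for S
    using hausdorff_measure_linear_image[OF linR \<sigma> Rlow that] .
  let ?box = "cbox 0 (\<chi> j. 1 / wt j) :: (real^'m) set"
  have "compact (T ` ?box)"
    by (rule compact_continuous_image) (use linT in \<open>auto simp: linear_conv_bounded_linear intro: linear_continuous_on\<close>)
  then have Tb: "T ` ?box \<in> sets borel" by (rule borel_compact)
  have RT: "R ` (T ` ?box) = ?Q"
  proof
    show "R ` (T ` ?box) \<subseteq> ?Q"
    proof safe
      fix z :: "real^'m" assume z: "z \<in> ?box"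
      have "0 \<le> wt j * z $ j \<and> wt j * z $ j \<le> 1" for j
      proof -
        have "0 \<le> z $ j" "z $ j \<le> 1 / wt j" using z by (auto simp: mem_box_cart)
        then show ?thesis using mult_left_mono[of "z $ j" "1 / wt j" "wt j"] wt[of j] by simp
      qed
      then show "R (T z) \<in> ?Q" by (simp add: R_def TI mem_box_cart)
    qed
    show "?Q \<subseteq> R ` (T ` ?box)"
    proof
      fix v :: "real^'m" assume v: "v \<in> ?Q"
      let ?z = "\<chi> j. v $ j / wt j"
      have "?z \<in> ?box" using v wt by (auto simp: mem_box_cart less_imp_le divide_right_mono)
      moreover have "R (T ?z) = v"
      proof (rule vec_eq_iff[THEN iffD2], rule allI)
        fix j
        have "wt j \<noteq> 0" using wt[of j] by simp
        then show "R (T ?z) $ j = v $ j" by (simp add: R_def TI)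
      qed
      ultimately show "v \<in> R ` (T ` ?box)" by (intro image_eqI[of _ R "T ?z"] imageI) simp_all
    qed
  qed
  have prod: "(\<Prod>j\<in>UNIV. 1 / wt j) = 1 / (a * b ^ (?m - 1))"
  proof -
    have "(\<Prod>j\<in>UNIV. wt j) = wt j0 * (\<Prod>j\<in>UNIV - {j0}. wt j)" by (rule prod.remove) auto
    also have "(\<Prod>j\<in>UNIV - {j0}. wt j) = (\<Prod>j\<in>UNIV - {j0}. b)" by (rule prod.cong) (auto simp: wt_def)
    also have "\<dots> = b ^ (?m - 1)" by (simp add: card_Diff_singleton)
    finally have "(\<Prod>j\<in>UNIV. wt j) = a * b ^ (?m - 1)" by (simp add: wt_def)
    then show ?thesis by (simp add: prod_dividef)
  qed
  have "emeasure lborel ?box = ennreal (\<Prod>j\<in>UNIV. 1 / wt j)"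
    using wt by (subst emeasure_lborel_cbox_cart) (auto simp: less_imp_le)
  then have Tv: "emeasure lborel (T ` ?box) = ennreal (1 / (a * b ^ (?m - 1)))"
    using emeasure_orthogonal_image[OF T(1), of ?box] prod by simp
  have pos: "0 < a * b ^ (?m - 1)" using ab by simp
  have "hausdorff_measure ?m ?Q = hausdorff_measure ?m (R ` ?Q) * ennreal (1 / (a * b ^ (?m - 1)))"
    using 2[OF Tb] unfolding RT Tv .
  then have "hausdorff_measure ?m ?Q * ennreal (a * b ^ (?m - 1)) =
     hausdorff_measure ?m (R ` ?Q) * (ennreal (1 / (a * b ^ (?m - 1))) * ennreal (a * b ^ (?m - 1)))"
    by (simp only: mult.assoc)
  also have "ennreal (1 / (a * b ^ (?m - 1))) * ennreal (a * b ^ (?m - 1)) = 1"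
  proof -
    have "ennreal (1 / p) * ennreal p = 1" if "0 < p" for p
      using that by (simp add: ennreal_mult[symmetric])
    then show ?thesis using pos by blast
  qed
  finally have 3: "hausdorff_measure ?m (R ` ?Q) = ennreal (a * b ^ (?m - 1)) * hausdorff_measure ?m ?Q"
    by (simp add: mult.commute)
  have "hausdorff_measure ?m (g ` S) \<le>
      ennreal (real ?m ^ ?m) * (ennreal (a * b ^ (?m - 1)) * hausdorff_measure ?m ?Q * emeasure lborel S)"
    using 1 unfolding 2[OF S] 3 .
  also have "\<dots> = ennreal (real ?m ^ ?m * (a * b ^ (?m - 1))) * hausdorff_measure ?m ?Q * emeasure lborel S"
    using ab by (simp add: ennreal_mult mult.assoc)
  finally show ?thesis .
qed

lemma hausdorff_measure_lipschitz_null_image: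
  fixes f :: "real^'m \<Rightarrow> 'b::metric_space"
  assumes lip: "\<And>x y. dist (f x) (f y) \<le> M * dist x y" and M: "0 \<le> M" and Z: "negligible Z"
  shows "hausdorff_measure CARD('m) (f ` Z) = 0"
proof -
  have "Z \<in> null_sets lebesgue" using Z by (simp add: negligible_iff_null_sets)
  then obtain Z' where Z': "Z' \<in> null_sets lborel" "Z \<subseteq> Z'"
    by (metis null_sets_completion_iff2)
  have "hausdorff_measure CARD('m) (f ` Z) \<le> hausdorff_measure CARD('m) (f ` Z')"
    using Z'(2) by (intro hausdorff_measure_mono image_mono)
  also have "\<dots> \<le> ennreal ((M + 1) ^ CARD('m)) * hausdorff_measure CARD('m) ((\<lambda>x. x) ` Z')"
  proof (rule hausdorff_measure_compare)
    fix x y :: "real^'m"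
    have "M * dist x y \<le> (M + 1) * dist x y" by (intro mult_right_mono) auto
    then show "dist (f x) (f y) \<le> (M + 1) * dist x y" using lip[of x y] by linarith
  qed (use M in simp)
  also have "hausdorff_measure CARD('m) ((\<lambda>x. x) ` Z') =
      hausdorff_measure CARD('m) ((\<lambda>x. x) ` cbox 0 (vec 1 :: real^'m)) * emeasure lborel Z'"
    using Z'(1) by (intro hausdorff_measure_linear_image[of _ 1]) (auto intro: linearI)
  also have "\<dots> = 0" using Z'(1) by auto
  finally show ?thesis by simp
qed

lemma exists_unit_vector_small_image:
  assumes "linear (P :: real^'m \<Rightarrow> 'c::real_normed_vector)" "\<not> (\<forall>v. s * norm v \<le> norm (P v))"
  obtains u where "norm u = 1" "norm (P u) < s"
proof -
  obtain v where v: "norm (P v) < s * norm v" using assms(2) by (auto simp: not_le)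
  have nz: "norm v \<noteq> 0"
  proof
    assume "norm v = 0"
    then show False using v by simp
  qed
  let ?u = "(1 / norm v) *\<^sub>R v"
  have "norm (P ?u) = norm (P v) / norm v" by (simp add: linear_cmul[OF assms(1)])
  also have "\<dots> < s" using v nz by (simp add: divide_less_eq)
  finally show ?thesis using nz by (intro that[of ?u]) auto
qed

text \<open>On a piece where \<open>f\<close> is affine up to the relative error \<open>s\<^sup>2\<close>, its linear part \<open>L i\<close> either satisfies
  \<open>s * norm v \<le> norm (L i v)\<close>, and then \<open>f\<close> is injective on the piece and nearly isometric to \<open>L i\<close>, or it
  nearly collapses a direction, and then the image of the piece is thin. The first kind is made disjoint in the
  image, by removing from \<open>C\<close> what earlier pieces cover; the second kind is made disjoint in the domain, so that
  its images have total measure of the order of \<open>s\<close>. The choice of the relative error as the square of the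
  threshold makes the errors on pieces of the first kind small relative to \<open>L i\<close>.\<close>

lemma lipschitz_image_near_affine_pieces:
  fixes f :: "real^'m \<Rightarrow> 'a::real_normed_vector" and B0 :: "'a set"
  assumes B0: "finite B0" "span B0 = UNIV"
    and lip: "\<And>x y. norm (f x - f y) \<le> M * norm (x - y)" and M: "0 \<le> M"
    and K: "compact K" and C: "C \<in> sets borel" "C \<subseteq> f ` K" and s: "0 < s" "s < 1"
  obtains I :: "nat set" and S :: "nat \<Rightarrow> (real^'m) set" and L :: "nat \<Rightarrow> real^'m \<Rightarrow> 'a"
  where "\<And>i. S i \<in> sets borel" "\<And>i. S i \<subseteq> K" "disjoint_family S" "\<And>i. i \<notin> I \<Longrightarrow> S i = {}"
    "\<And>i. linear (L i)" "\<And>i v. norm (L i v) \<le> (M + s\<^sup>2) * norm v" "\<And>i v. i \<in> I \<Longrightarrow> s * norm v \<le> norm (L i v)"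
    "\<And>i x y. x \<in> S i \<Longrightarrow> y \<in> S i \<Longrightarrow> norm (f y - f x - L i (y - x)) \<le> s\<^sup>2 * norm (y - x)"
    "disjoint_family (\<lambda>i. f ` S i)" "\<And>i. f ` S i \<in> sets borel" "\<And>i. f ` S i \<subseteq> C"
    "hausdorff_measure CARD('m) (C - (\<Union>i. f ` S i)) \<le>
      ennreal (real CARD('m) ^ CARD('m) * ((s + s\<^sup>2) * (M + 2 * s\<^sup>2) ^ (CARD('m) - 1))) *
      hausdorff_measure CARD('m) (cbox 0 (vec 1 :: real^'m)) * emeasure lborel K"
proof -
  let ?m = "CARD('m)"
  have s2: "0 < s\<^sup>2" using s by simp
  obtain F :: "nat \<Rightarrow> (real^'m) set" and L :: "nat \<Rightarrow> real^'m \<Rightarrow> 'a" where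
    F: "\<And>i. closed (F i)" and linL: "\<And>i. linear (L i)" and
    FL: "\<And>i x y. x \<in> F i \<Longrightarrow> y \<in> F i \<Longrightarrow> norm (f y - f x - L i (y - x)) \<le> s\<^sup>2 * norm (y - x)" and
    Lbd: "\<And>i v. norm (L i v) \<le> (M + s\<^sup>2) * norm v" and
    neg: "negligible (UNIV - (\<Union>i. F i))"
    by (rule lipschitz_affine_pieces[OF B0 lip s2]) (rule that)
  have contf: "continuous_on A f" for A using lip by (rule continuous_on_norm_lipschitz)
  have fm: "f \<in> borel_measurable borel" using contf by (rule borel_measurable_continuous_onI)
  define I where "I = {i. \<forall>v. s * norm v \<le> norm (L i v)}"
  define G where "G i = F i \<inter> K" for i
  have G: "compact (G i)" for i unfolding G_def using F K by (simp add: closed_Int_compact)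
  have cfG: "f ` G i \<in> sets borel" for i
    by (rule borel_compact[OF compact_continuous_image[OF contf G]])
  have injf: "inj_on f (G i)" if i: "i \<in> I" for i
  proof (rule inj_onI)
    fix x y assume xy: "x \<in> G i" "y \<in> G i" "f x = f y"
    then have "norm (L i (y - x)) \<le> s\<^sup>2 * norm (y - x)" using FL[of x i y] by (simp add: G_def)
    moreover have "s * norm (y - x) \<le> norm (L i (y - x))" using i by (simp add: I_def)
    moreover have "s\<^sup>2 * norm (y - x) = s * (s * norm (y - x))" by (simp add: power2_eq_square)
    ultimately have "s * norm (y - x) \<le> s * (s * norm (y - x))" by linarith
    then have "norm (y - x) \<le> s * norm (y - x)" using s by (simp only: mult_le_cancel_left_pos)
    then have "(1 - s) * norm (y - x) \<le> 0" by (simp add: algebra_simps)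
    then show "x = y" using s by (simp add: mult_le_0_iff)
  qed
  \<comment> \<open>The images of the pieces with a nondegenerate linear part, made disjoint in the image.\<close>
  define C' where "C' i = (if i \<in> I then C \<inter> f ` G i - (\<Union>j\<in>I \<inter> {..<i}. f ` G j) else {})" for i
  define S where "S i = (if i \<in> I then G i \<inter> f -` C' i else {})" for i
  have C'b: "C' i \<in> sets borel" for i
    unfolding C'_def using C(1) cfG by (auto intro!: sets.Diff sets.Int sets.finite_UN)
  have fS: "f ` S i = C' i" for i unfolding S_def C'_def by auto
  have Sb: "S i \<in> sets borel" for i
    using measurable_sets[OF fm C'b[of i]] borel_compact[OF G[of i]] by (auto simp: S_def)
  have dfC': "disjoint_family C'" by (rule disjoint_family_natI) (auto simp: C'_def)
  then have dfC: "disjoint_family (\<lambda>i. f ` S i)" unfolding fS .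
  have dfS: "disjoint_family S"
  proof (unfold disjoint_family_on_def, intro ballI impI)
    fix i j :: nat assume "i \<noteq> j"
    then have "f ` S i \<inter> f ` S j = {}" using dfC unfolding disjoint_family_on_def by simp
    then show "S i \<inter> S j = {}" by blast
  qed
  \<comment> \<open>The pieces with a nearly degenerate linear part, made disjoint in the domain.\<close>
  define W where "W i = (if i \<in> I then {} else G i - (\<Union>j<i. G j))" for i
  have Wb: "W i \<in> sets borel" for i
    unfolding W_def using borel_compact[OF G] by (auto intro!: sets.Diff sets.finite_UN)
  have dfW: "disjoint_family W" by (rule disjoint_family_natI) (auto simp: W_def)
  have WK: "(\<Union>i. W i) \<subseteq> K" by (auto simp: W_def G_def)
  let ?\<kappa> = "ennreal (real ?m ^ ?m * ((s + s\<^sup>2) * (M + 2 * s\<^sup>2) ^ (?m - 1)))"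
  let ?HQ = "hausdorff_measure ?m (cbox 0 (vec 1 :: real^'m))"
  have HW: "hausdorff_measure ?m (f ` W i) \<le> ?\<kappa> * ?HQ * emeasure lborel (W i)" for i
  proof (cases "i \<in> I")
    case True then show ?thesis by (simp add: W_def hausdorff_measure_empty)
  next
    case False
    then obtain u where u: "norm u = 1" "norm (L i u) < s"
      using exists_unit_vector_small_image[OF linL[of i]] unfolding I_def by blast
    show ?thesis
    proof (rule hausdorff_measure_thin_image[OF linL[of i] u(1), of "s\<^sup>2"])
      show "norm (L i u) + s\<^sup>2 \<le> s + s\<^sup>2" using u by simp
      show "norm (L i v) + s\<^sup>2 * norm v \<le> (M + 2 * s\<^sup>2) * norm v" for v
        using Lbd[of i v] by (simp add: algebra_simps)
      show "0 < s + s\<^sup>2" "0 < M + 2 * s\<^sup>2" using s M s2 by (auto intro: add_pos_pos add_nonneg_pos)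
      fix x y assume "x \<in> W i" "y \<in> W i"
      then have "norm (f x - f y - L i (x - y)) \<le> s\<^sup>2 * norm (x - y)"
        using False FL[of y i x] by (auto simp: W_def G_def)
      then show "dist (f x) (f y) \<le> norm (L i (x - y)) + s\<^sup>2 * norm (x - y)"
        using norm_triangle_sub[of "f x - f y" "L i (x - y)"] by (simp add: dist_norm)
    qed (use Wb s2 in auto)
  qed
  have rest: "C - (\<Union>i. f ` S i) \<subseteq> (\<Union>i. f ` W i) \<union> f ` (UNIV - (\<Union>i. F i))"
  proof
    fix x assume x: "x \<in> C - (\<Union>i. f ` S i)"
    then have "x \<in> f ` K" using C(2) by auto
    then obtain z where z: "z \<in> K" "x = f z" by (elim imageE)
    show "x \<in> (\<Union>i. f ` W i) \<union> f ` (UNIV - (\<Union>i. F i))"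
    proof (cases "\<exists>i. z \<in> G i")
      case False
      then have "z \<in> UNIV - (\<Union>i. F i)" using z(1) by (auto simp: G_def)
      then show ?thesis using z(2) by blast
    next
      case True
      define i where "i = (LEAST i. z \<in> G i)"
      have zi: "z \<in> G i" unfolding i_def using True by (rule LeastI_ex)
      have least: "z \<notin> G j" if "j < i" for j using that unfolding i_def by (rule not_less_Least)
      have "i \<notin> I"
      proof
        assume i: "i \<in> I"
        then have ex: "\<exists>k. k \<in> I \<and> x \<in> f ` G k" using zi z(2) by blast
        define k where "k = (LEAST k. k \<in> I \<and> x \<in> f ` G k)"
        have k: "k \<in> I" "x \<in> f ` G k" using LeastI_ex[OF ex] unfolding k_def by auto
        have "\<not> (j \<in> I \<and> x \<in> f ` G j)" if "j < k" for j
          using that unfolding k_def by (rule not_less_Least)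
        then have "x \<in> C' k" using k x by (auto simp: C'_def)
        then show False using x unfolding fS by blast
      qed
      then have "z \<in> W i" using zi least by (auto simp: W_def)
      then show ?thesis using z(2) by blast
    qed
  qed
  have "hausdorff_measure ?m (C - (\<Union>i. f ` S i)) \<le>
     hausdorff_measure ?m (\<Union>i. f ` W i) + hausdorff_measure ?m (f ` (UNIV - (\<Union>i. F i)))"
    by (rule order_trans[OF hausdorff_measure_mono[OF rest] hausdorff_measure_Un]) simp
  also have "hausdorff_measure ?m (f ` (UNIV - (\<Union>i. F i))) = 0"
    by (rule hausdorff_measure_lipschitz_null_image[OF _ M neg]) (simp add: dist_norm lip)
  also have "hausdorff_measure ?m (\<Union>i. f ` W i) \<le> (\<Sum>i. ?\<kappa> * ?HQ * emeasure lborel (W i))"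
    by (rule order_trans[OF hausdorff_measure_UN suminf_le[OF HW summableI summableI]])
  also have "\<dots> = ?\<kappa> * ?HQ * (\<Sum>i. emeasure lborel (W i))" by (rule ennreal_suminf_cmult)
  also have "(\<Sum>i. emeasure lborel (W i)) = emeasure lborel (\<Union>i. W i)"
    using Wb dfW by (intro suminf_emeasure) auto
  also have "?\<kappa> * ?HQ * emeasure lborel (\<Union>i. W i) \<le> ?\<kappa> * ?HQ * emeasure lborel K"
    using WK borel_compact[OF K] by (intro mult_left_mono emeasure_mono) auto
  finally have fin: "hausdorff_measure ?m (C - (\<Union>i. f ` S i)) \<le> ?\<kappa> * ?HQ * emeasure lborel K"
    by (simp add: mult_left_mono)
  show ?thesis
  proof (rule that[of S I L])
    show "S i \<subseteq> K" for i by (auto simp: S_def G_def)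
    show "norm (f y - f x - L i (y - x)) \<le> s\<^sup>2 * norm (y - x)" if "x \<in> S i" "y \<in> S i" for i x y
      using that FL[of x i y] by (auto simp: S_def G_def split: if_splits)
    show "f ` S i \<subseteq> C" for i unfolding fS C'_def by auto
    show "f ` S i \<in> sets borel" for i unfolding fS by (rule C'b)
    show "S i = {}" if "i \<notin> I" for i using that by (simp add: S_def)
    show "s * norm v \<le> norm (L i v)" if "i \<in> I" for i v using that by (simp add: I_def)
  qed (fact Sb dfS linL Lbd dfC fin)+
qed

section \<open>Measurable dependence on the linear map\<close>

lemma bounded_diameter_infdist_neighbourhood:
  fixes E :: "'a::metric_space set"
  assumes E: "bounded E" "E \<noteq> {}" and r: "0 < r"
  shows "bounded {y. infdist y E < r}" "diameter {y. infdist y E < r} \<le> diameter E + 2 * r"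
proof -
  have d: "dist x y \<le> diameter E + 2 * r" if x: "infdist x E < r" and y: "infdist y E < r" for x y
  proof -
    obtain a where a: "a \<in> E" "dist x a < r" using x E(2) by (auto simp: infdist_def cINF_less_iff)
    obtain b where b: "b \<in> E" "dist y b < r" using y E(2) by (auto simp: infdist_def cINF_less_iff)
    have "dist a b \<le> diameter E" by (rule diameter_bounded_bound[OF E(1) a(1) b(1)])
    moreover have "dist x y \<le> dist x a + dist a b + dist y b"
      using dist_triangle[of x y a] dist_triangle[of a y b] by (simp add: dist_commute)
    ultimately show ?thesis using a(2) b(2) by linarith
  qed
  then show "bounded {y. infdist y E < r}" unfolding bounded_two_points by blast
  show "diameter {y. infdist y E < r} \<le> diameter E + 2 * r"
    using d r diameter_ge_0[OF E(1)] by (intro diameter_le_dist) auto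
qed

text \<open>Covering sets may be enlarged to open sets at an arbitrarily small cost.\<close>

lemma hausdorff_delta_compact_open_neighbourhood:
  fixes C :: "'a::metric_space set"
  assumes m: "0 < m" and C: "hausdorff_delta m \<delta> C < a" and \<delta>: "\<delta> < \<delta>'"
  obtains V where "open V" "C \<subseteq> V" "hausdorff_delta m \<delta>' V < a"
proof -
  define k where "k = unit_ball_vol (real m) / 2 ^ m"
  obtain E where E0: "C \<subseteq> (\<Union>i. E i)" "\<And>i. bounded (E i)" "\<And>i. diameter (E i) \<le> \<delta>"
    "(\<Sum>i. ennreal (unit_ball_vol (real m) / 2 ^ m * diameter (E i) ^ m)) < a"
    by (rule hausdorff_delta_cover_less[OF C]) (rule that)
  note E = E0[folded k_def]
  let ?s = "\<Sum>i. ennreal (k * diameter (E i) ^ m)"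
  obtain e where e: "0 < e" "?s + ennreal e < a"
  proof -
    obtain t where t: "?s < t" "t < a" using dense[OF E(4)] by blast
    have "t \<noteq> top" using t(2) by (auto simp: top_unique dest: less_le_trans)
    have st: "?s \<noteq> top" using t(1) by (auto simp: top_unique dest: less_le_trans)
    obtain s' where s': "?s = ennreal s'" "0 \<le> s'" using st by (cases ?s) auto
    obtain t' where t': "t = ennreal t'" "0 \<le> t'" using \<open>t \<noteq> top\<close> by (cases t) auto
    have "s' < t'" using t(1) s' t' by (simp add: ennreal_less_iff)
    then show ?thesis using t(2) s' t' by (intro that[of "t' - s'"]) (auto simp flip: ennreal_plus)
  qed
  define F where "F i r = (if E i = {} then {} else {y. infdist y (E i) < r})" for i r
  have Fb: "bounded (F i r)" "diameter (F i r) \<le> diameter (E i) + 2 * r" if "0 < r" for i r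
    using bounded_diameter_infdist_neighbourhood[OF E(2) _ that] that by (auto simp: F_def)
  have "\<exists>r>0. 2 * r \<le> \<delta>' - \<delta> \<and> k * (diameter (E i) + 2 * r) ^ m \<le> k * diameter (E i) ^ m + e * (1/2) ^ Suc i" for i
  proof -
    have "((\<lambda>r. k * (diameter (E i) + 2 * r) ^ m) \<longlongrightarrow> k * (diameter (E i) + 2 * 0) ^ m) (at_right 0)"
      by (intro tendsto_intros)
    moreover have "k * (diameter (E i) + 2 * 0) ^ m < k * diameter (E i) ^ m + e * (1/2) ^ Suc i" using e by simp
    ultimately have "\<forall>\<^sub>F r in at_right 0. k * (diameter (E i) + 2 * r) ^ m < k * diameter (E i) ^ m + e * (1/2) ^ Suc i"
      by (rule order_tendstoD(2))
    moreover have "\<forall>\<^sub>F r in at_right 0. r < (\<delta>' - \<delta>) / 2 \<and> (0::real) < r"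
      using \<delta> eventually_at_right[of "0::real" 1] by (intro eventually_conj eventually_at_right_less)
        (auto simp: eventually_at_right_field intro!: exI[of _ "(\<delta>' - \<delta>) / 2"])
    ultimately have "\<forall>\<^sub>F r in at_right (0::real). 0 < r \<and> 2 * r \<le> \<delta>' - \<delta> \<and>
        k * (diameter (E i) + 2 * r) ^ m \<le> k * diameter (E i) ^ m + e * (1/2) ^ Suc i"
      by eventually_elim auto
    then show ?thesis using eventually_happens trivial_limit_at_right_real by blast
  qed
  then obtain r where r: "\<And>i. 0 < r i" "\<And>i. 2 * r i \<le> \<delta>' - \<delta>"
      "\<And>i. k * (diameter (E i) + 2 * r i) ^ m \<le> k * diameter (E i) ^ m + e * (1/2) ^ Suc i"
    by metis
  define V where "V = (\<Union>i. F i (r i))"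
  have "open (F i (r i))" for i
    unfolding F_def by (auto intro!: open_Collect_less continuous_intros)
  then have "open V" unfolding V_def by blast
  moreover have "C \<subseteq> V"
  proof
    fix x assume "x \<in> C"
    then obtain i where i: "x \<in> E i" using E(1) by blast
    then have "x \<in> F i (r i)" using r(1)[of i] by (auto simp: F_def)
    then show "x \<in> V" by (auto simp: V_def)
  qed
  moreover have "hausdorff_delta m \<delta>' V < a"
  proof -
    have k0: "0 \<le> k" by (simp add: k_def)
    have dE: "0 \<le> diameter (E i)" for i by (rule diameter_ge_0[OF E(2)])
    have "hausdorff_delta m \<delta>' V \<le> (\<Sum>i. ennreal (k * diameter (F i (r i)) ^ m))"
      unfolding k_def
    proof (rule hausdorff_delta_le_cover)
      show "diameter (F i (r i)) \<le> \<delta>'" for i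
        using Fb(2)[OF r(1)[of i], of i] E(3)[of i] r(2)[of i] by linarith
    qed (auto simp: V_def Fb(1) r(1))
    also have "\<dots> \<le> (\<Sum>i. ennreal (k * diameter (E i) ^ m) + ennreal (e * (1/2) ^ Suc i))"
    proof (rule suminf_le[OF _ summableI summableI])
      fix i
      have "k * diameter (F i (r i)) ^ m \<le> k * (diameter (E i) + 2 * r i) ^ m"
        using Fb[OF r(1)[of i], of i] k0 by (intro mult_left_mono power_mono diameter_ge_0) auto
      also note r(3)[of i]
      finally have "ennreal (k * diameter (F i (r i)) ^ m) \<le> ennreal (k * diameter (E i) ^ m + e * (1/2) ^ Suc i)"
        by (rule ennreal_leI)
      also have "\<dots> = ennreal (k * diameter (E i) ^ m) + ennreal (e * (1/2) ^ Suc i)"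
        using k0 dE e by (intro ennreal_plus) auto
      finally show "ennreal (k * diameter (F i (r i)) ^ m) \<le> \<dots>" .
    qed
    also have "\<dots> = ?s + (\<Sum>i. ennreal (e * (1/2) ^ Suc i))" by (rule suminf_add[OF summableI summableI, symmetric])
    also have "(\<Sum>i. ennreal (e * (1/2) ^ Suc i)) = ennreal e" using e(1) by (rule suminf_ennreal_half_powers)
    finally show ?thesis using e(2) by (rule le_less_trans)
  qed
  ultimately show ?thesis by (rule that)
qed

text \<open>For compact \<open>C\<close> a cover of one image by open sets also covers the images under all nearby linear maps. Hence
  a small value of \<open>hausdorff_delta\<close> persists nearby at every larger scale, and taking the infimum \<open>G n\<close> over
  all scales strictly below \<open>1 / (n + 1)\<close> gives an upper semicontinuous function. Hausdorff measure is the
  supremum of the \<open>G n\<close>.\<close>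

lemma hausdorff_measure_image_borel_measurable_compact:
  fixes C :: "'a::real_normed_vector set"
  assumes m: "0 < m" and C: "compact C"
  shows "(\<lambda>\<pi> :: 'a \<Rightarrow>\<^sub>L 'b::real_normed_vector. hausdorff_measure m (blinfun_apply \<pi> ` C)) \<in> borel_measurable borel"
proof -
  define U where "U \<delta> a = {\<pi> :: 'a \<Rightarrow>\<^sub>L 'b. hausdorff_delta m \<delta> (blinfun_apply \<pi> ` C) < a}" for \<delta> a
  have nbhd: "\<exists>e>0. ball \<pi> e \<subseteq> U \<delta>' a" if \<pi>: "\<pi> \<in> U \<delta> a" and \<delta>: "\<delta> < \<delta>'" for \<pi> \<delta> \<delta>' a
  proof -
    obtain V where V: "open V" "blinfun_apply \<pi> ` C \<subseteq> V" "hausdorff_delta m \<delta>' V < a"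
      using hausdorff_delta_compact_open_neighbourhood[OF m _ \<delta>, of "blinfun_apply \<pi> ` C" a] \<pi>
      unfolding U_def by blast
    have cC: "compact (blinfun_apply \<pi> ` C)"
      using C by (intro compact_continuous_image) (auto intro: continuous_intros)
    obtain e where e: "0 < e" "(\<Union>x\<in>blinfun_apply \<pi> ` C. cball x e) \<subseteq> V"
      using compact_subset_open_imp_cball_epsilon_subset[OF cC V(1,2)] by blast
    obtain R where R: "0 < R" "\<And>x. x \<in> C \<Longrightarrow> norm x \<le> R"
      using compact_imp_bounded[OF C] bounded_pos by blast
    have "ball \<pi> (e / R) \<subseteq> U \<delta>' a"
    proof
      fix \<rho> assume \<rho>: "\<rho> \<in> ball \<pi> (e / R)"
      have "blinfun_apply \<rho> ` C \<subseteq> V"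
      proof safe
        fix x assume x: "x \<in> C"
        have "norm (blinfun_apply (\<pi> - \<rho>) x) \<le> norm (\<pi> - \<rho>) * norm x" by (rule norm_blinfun)
        also have "\<dots> \<le> (e / R) * R"
          using \<rho> R(1) R(2)[OF x] e(1) by (intro mult_mono) (auto simp: dist_norm)
        finally have "dist (blinfun_apply \<pi> x) (blinfun_apply \<rho> x) \<le> e"
          using R(1) by (simp add: dist_norm blinfun.diff_left)
        then have "blinfun_apply \<rho> x \<in> cball (blinfun_apply \<pi> x) e" by simp
        then show "blinfun_apply \<rho> x \<in> V" using e(2) x by blast
      qed
      then have "hausdorff_delta m \<delta>' (blinfun_apply \<rho> ` C) \<le> hausdorff_delta m \<delta>' V" by (rule hausdorff_delta_mono)
      then show "\<rho> \<in> U \<delta>' a" using V(3) by (simp add: U_def)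
    qed
    moreover have "0 < e / R" using e R by simp
    ultimately show ?thesis by blast
  qed
  define G where "G n \<pi> = (INF d\<in>{0<..<inverse (real (Suc n))}. hausdorff_delta m d (blinfun_apply \<pi> ` C))" for n and \<pi> :: "'a \<Rightarrow>\<^sub>L 'b"
  have Gm: "G n \<in> borel_measurable borel" for n
  proof (rule borel_measurableI_less)
    fix a :: ennreal
    have "open {\<pi>. G n \<pi> < a}"
    proof (rule openI)
      fix \<pi> assume "\<pi> \<in> {\<pi>. G n \<pi> < a}"
      then obtain d where d: "0 < d" "d < inverse (real (Suc n))" "\<pi> \<in> U d a"
        unfolding G_def U_def by (auto simp: INF_less_iff)
      obtain d' where d': "d < d'" "d' < inverse (real (Suc n))" using dense[OF d(2)] by blast
      obtain e where e: "0 < e" "ball \<pi> e \<subseteq> U d' a" using nbhd[OF d(3) d'(1)] by blast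
      have "U d' a \<subseteq> {\<pi>. G n \<pi> < a}"
        unfolding U_def G_def using d(1) d' by (auto simp: INF_less_iff intro!: bexI[of _ d'])
      then show "\<exists>e>0. ball \<pi> e \<subseteq> {\<pi>. G n \<pi> < a}" using e by blast
    qed
    then show "{\<pi> \<in> space borel. G n \<pi> < a} \<in> sets borel" by simp
  qed
  have "hausdorff_measure m (blinfun_apply \<pi> ` C) = (SUP n. G n \<pi>)" for \<pi> :: "'a \<Rightarrow>\<^sub>L 'b"
  proof (rule antisym)
    have "hausdorff_delta m (inverse (real (Suc n))) (blinfun_apply \<pi> ` C) \<le> G n \<pi>" for n
      unfolding G_def by (intro INF_greatest hausdorff_delta_antimono) auto
    then show "hausdorff_measure m (blinfun_apply \<pi> ` C) \<le> (SUP n. G n \<pi>)"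
      unfolding hausdorff_measure_seq by (intro SUP_mono) blast
    show "(SUP n. G n \<pi>) \<le> hausdorff_measure m (blinfun_apply \<pi> ` C)"
    proof (rule SUP_least)
      fix n
      let ?d = "inverse (real (Suc n)) / 2"
      have "?d \<in> {0<..<inverse (real (Suc n))}" by simp
      then have "G n \<pi> \<le> hausdorff_delta m ?d (blinfun_apply \<pi> ` C)" unfolding G_def by (rule INF_lower)
      also have "\<dots> \<le> hausdorff_measure m (blinfun_apply \<pi> ` C)" by (rule hausdorff_delta_le_measure) simp
      finally show "G n \<pi> \<le> hausdorff_measure m (blinfun_apply \<pi> ` C)" .
    qed
  qed
  moreover have "(\<lambda>\<pi>. SUP n. G n \<pi>) \<in> borel_measurable borel" using Gm by measurable
  ultimately show ?thesis by simp
qed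

lemma hausdorff_measure_blinfun_image:
  "hausdorff_measure m (blinfun_apply \<pi> ` A) \<le> ennreal ((norm \<pi> + 1) ^ m) * hausdorff_measure m A"
proof -
  have "hausdorff_measure m (blinfun_apply \<pi> ` A) \<le> ennreal ((norm \<pi> + 1) ^ m) * hausdorff_measure m ((\<lambda>x. x) ` A)"
  proof (rule hausdorff_measure_compare)
    show "0 < norm \<pi> + 1" by (simp add: add_nonneg_pos)
    fix x y
    have "norm (blinfun_apply \<pi> (x - y)) \<le> norm \<pi> * norm (x - y)" by (rule norm_blinfun)
    also have "\<dots> \<le> (norm \<pi> + 1) * norm (x - y)" by (intro mult_right_mono) auto
    finally show "dist (blinfun_apply \<pi> x) (blinfun_apply \<pi> y) \<le> (norm \<pi> + 1) * dist x y"
      by (simp add: dist_norm blinfun.diff_right)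
  qed
  then show ?thesis by simp
qed

text \<open>Null sets stay null under linear maps, so only an increasing sequence of compact sets matters.\<close>

lemma hausdorff_measure_image_borel_measurable:
  fixes A :: "'a::real_normed_vector set"
  assumes m: "0 < m" and D: "\<And>i::nat. compact (D i)" "(\<Union>i. D i) \<subseteq> A"
    and null: "hausdorff_measure m (A - (\<Union>i. D i)) = 0"
  shows "(\<lambda>\<pi> :: 'a \<Rightarrow>\<^sub>L 'b::real_normed_vector. hausdorff_measure m (blinfun_apply \<pi> ` A)) \<in> borel_measurable borel"
proof -
  define K where "K n = (\<Union>i\<le>n. D i)" for n :: nat
  have K: "compact (K n)" for n unfolding K_def using D(1) by (intro compact_UN) auto
  have KD: "(\<Union>n. K n) = (\<Union>i. D i)" unfolding K_def by auto
  have "hausdorff_measure m (blinfun_apply \<pi> ` A) = (SUP n. hausdorff_measure m (blinfun_apply \<pi> ` K n))"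
    for \<pi> :: "'a \<Rightarrow>\<^sub>L 'b"
  proof -
    have bK: "blinfun_apply \<pi> ` K n \<in> sets borel" for n
      using K by (intro borel_compact compact_continuous_image) (auto intro: continuous_intros)
    have U: "(\<Union>n. blinfun_apply \<pi> ` K n) = blinfun_apply \<pi> ` (\<Union>i. D i)" unfolding KD[symmetric] by blast
    have "blinfun_apply \<pi> ` A = blinfun_apply \<pi> ` (\<Union>i. D i) \<union> blinfun_apply \<pi> ` (A - (\<Union>i. D i))"
      using D(2) by blast
    then have "hausdorff_measure m (blinfun_apply \<pi> ` A) \<le>
      hausdorff_measure m (blinfun_apply \<pi> ` (\<Union>i. D i)) + hausdorff_measure m (blinfun_apply \<pi> ` (A - (\<Union>i. D i)))"
      using hausdorff_measure_Un[OF m] by metis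
    also have "hausdorff_measure m (blinfun_apply \<pi> ` (A - (\<Union>i. D i))) = 0"
      using hausdorff_measure_blinfun_image[of m \<pi> "A - (\<Union>i. D i)"] null by simp
    finally have "hausdorff_measure m (blinfun_apply \<pi> ` A) = hausdorff_measure m (\<Union>n. blinfun_apply \<pi> ` K n)"
      unfolding U using D(2) by (intro antisym) (auto intro!: hausdorff_measure_mono)
    also have "\<dots> = emeasure (hausdorff_borel m) (\<Union>n. blinfun_apply \<pi> ` K n)"
      using bK by (intro emeasure_hausdorff_borel[symmetric] m) auto
    also have "\<dots> = (SUP n. emeasure (hausdorff_borel m) (blinfun_apply \<pi> ` K n))"
      using bK by (intro SUP_emeasure_incseq[symmetric]) (auto simp: incseq_def K_def, fastforce)
    also have "\<dots> = (SUP n. hausdorff_measure m (blinfun_apply \<pi> ` K n))"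
      using bK by (simp add: emeasure_hausdorff_borel m)
    finally show ?thesis .
  qed
  moreover have "(\<lambda>\<pi> :: 'a \<Rightarrow>\<^sub>L 'b. SUP n. hausdorff_measure m (blinfun_apply \<pi> ` K n)) \<in> borel_measurable borel"
    using hausdorff_measure_image_borel_measurable_compact[OF m K] by measurable
  ultimately show ?thesis by simp
qed

section \<open>Extension of Lipschitz maps\<close>

text \<open>McShane's extension.\<close>

lemma lipschitz_extension_real:
  fixes \<phi> :: "'b::metric_space \<Rightarrow> real"
  assumes E: "E \<noteq> {}" and lip: "\<And>x y. x \<in> E \<Longrightarrow> y \<in> E \<Longrightarrow> \<bar>\<phi> x - \<phi> y\<bar> \<le> C * dist x y" and C: "0 \<le> C"
  obtains g where "\<And>x. x \<in> E \<Longrightarrow> g x = \<phi> x" "\<And>x y. \<bar>g x - g y\<bar> \<le> C * dist x y"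
proof -
  define g where "g x = (INF z\<in>E. \<phi> z + C * dist x z)" for x
  obtain z0 where z0: "z0 \<in> E" using E by blast
  have low: "\<phi> z0 - C * dist x z0 \<le> \<phi> z + C * dist x z" if "z \<in> E" for x z
  proof -
    have "\<phi> z0 - \<phi> z \<le> C * dist z0 z" using lip[OF z0 that] by linarith
    also have "\<dots> \<le> C * (dist x z0 + dist x z)"
      using C dist_triangle[of z0 z x] by (intro mult_left_mono) (auto simp: dist_commute)
    finally show ?thesis by (simp add: distrib_left)
  qed
  have bdd: "bdd_below ((\<lambda>z. \<phi> z + C * dist x z) ` E)" for x
    using low by (intro bdd_belowI2)
  have one: "g x \<le> g y + C * dist x y" for x y
  proof -
    have "g x - C * dist x y \<le> (INF z\<in>E. \<phi> z + C * dist y z)"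
    proof (rule cINF_greatest[OF E])
      fix z assume z: "z \<in> E"
      have "g x \<le> \<phi> z + C * dist x z" unfolding g_def by (rule cINF_lower[OF bdd z])
      also have "C * dist x z \<le> C * (dist x y + dist y z)" using C dist_triangle by (intro mult_left_mono) auto
      finally show "g x - C * dist x y \<le> \<phi> z + C * dist y z" by (simp add: distrib_left)
    qed
    then show ?thesis by (simp add: g_def)
  qed
  have "g x = \<phi> x" if x: "x \<in> E" for x
  proof (rule antisym)
    have "g x \<le> \<phi> x + C * dist x x" unfolding g_def by (rule cINF_lower[OF bdd x])
    then show "g x \<le> \<phi> x" by simp
    show "\<phi> x \<le> g x" unfolding g_def
    proof (rule cINF_greatest[OF E])
      fix z assume "z \<in> E"
      then show "\<phi> x \<le> \<phi> z + C * dist x z" using lip[OF x, of z] by linarith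
    qed
  qed
  moreover have "\<bar>g x - g y\<bar> \<le> C * dist x y" for x y
    using one[of x y] one[of y x] by (simp add: dist_commute abs_le_iff)
  ultimately show ?thesis by (rule that)
qed

lemma lipschitz_extension_finite_dimensional:
  fixes f :: "'b::metric_space \<Rightarrow> 'a::real_normed_vector" and B0 :: "'a set"
  assumes B0: "finite B0" "span B0 = UNIV" and f: "C-lipschitz_on E f"
  shows "\<exists>g M. 0 \<le> M \<and> (\<forall>x y. norm (g x - g y) \<le> M * dist x y) \<and> (\<forall>x\<in>E. g x = f x)"
proof (cases "E = {}")
  case True
  then show ?thesis by (intro exI[of _ "\<lambda>_. 0"] exI[of _ 0]) auto
next
  case False
  obtain B :: "'a set" and \<phi> K where B: "finite B" "K > 0" and B3: "\<forall>x. x = (\<Sum>b\<in>B. \<phi> b x *\<^sub>R b)"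
      and B4: "\<forall>b\<in>B. \<forall>x y. \<bar>\<phi> b x - \<phi> b y\<bar> \<le> K * norm (x - y)"
    using finite_dimensional_coordinates[OF B0] by (elim exE conjE)
  have C: "0 \<le> C" using f by (rule lipschitz_on_nonneg)
  have "\<exists>g. (\<forall>x\<in>E. g x = \<phi> b (f x)) \<and> (\<forall>x y. \<bar>g x - g y\<bar> \<le> (K * C) * dist x y)" if b: "b \<in> B" for b
  proof (rule lipschitz_extension_real[OF False, of "\<lambda>x. \<phi> b (f x)" "K * C"])
    fix x y assume xy: "x \<in> E" "y \<in> E"
    have "\<bar>\<phi> b (f x) - \<phi> b (f y)\<bar> \<le> K * norm (f x - f y)" using B4 b by blast
    also have "\<dots> \<le> K * (C * dist x y)" using lipschitz_onD[OF f xy] B(2) by (intro mult_left_mono) (auto simp: dist_norm)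
    finally show "\<bar>\<phi> b (f x) - \<phi> b (f y)\<bar> \<le> K * C * dist x y" by simp
  next
    fix g assume "\<And>x. x \<in> E \<Longrightarrow> g x = \<phi> b (f x)" "\<And>x y. \<bar>g x - g y\<bar> \<le> K * C * dist x y"
    then show ?thesis by (intro exI[of _ g]) auto
  qed (use B(2) C in simp)
  then obtain g where g: "\<And>b x. b \<in> B \<Longrightarrow> x \<in> E \<Longrightarrow> g b x = \<phi> b (f x)"
      "\<And>b x y. b \<in> B \<Longrightarrow> \<bar>g b x - g b y\<bar> \<le> (K * C) * dist x y"
    by metis
  define G where "G x = (\<Sum>b\<in>B. g b x *\<^sub>R b)" for x
  define M where "M = K * C * (\<Sum>b\<in>B. norm b)"
  have "norm (G x - G y) \<le> M * dist x y" for x y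
  proof -
    have "G x - G y = (\<Sum>b\<in>B. (g b x - g b y) *\<^sub>R b)" by (simp add: G_def sum_subtractf scaleR_left_diff_distrib)
    also have "norm \<dots> \<le> (\<Sum>b\<in>B. (K * C * dist x y) * norm b)"
      by (rule sum_norm_le) (simp add: g(2) mult_right_mono)
    also have "\<dots> = M * dist x y" by (simp add: M_def sum_distrib_left sum_distrib_right algebra_simps)
    finally show ?thesis .
  qed
  moreover have "G x = f x" if "x \<in> E" for x
  proof -
    have "G x = (\<Sum>b\<in>B. \<phi> b (f x) *\<^sub>R b)" unfolding G_def using g(1) that by (intro sum.cong) auto
    then show ?thesis using B3[rule_format, of "f x"] by simp
  qed
  moreover have "0 \<le> M" unfolding M_def using B(2) C by (intro mult_nonneg_nonneg sum_nonneg) auto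
  ultimately show ?thesis by blast
qed

section \<open>Density contractors on Lipschitz images\<close>

text \<open>The first summand is the area formula up to a factor; it governs the case that \<open>\<pi> \<circ> L\<close> expands by at least
  \<open>s\<close>. Otherwise \<open>\<pi> \<circ> L\<close> nearly collapses a direction, the image is thin, and the second summand bounds it.\<close>

lemma hausdorff_measure_blinfun_piece:
  fixes f :: "real^'m \<Rightarrow> 'a::real_normed_vector" and \<pi> :: "'a \<Rightarrow>\<^sub>L 'b::real_normed_vector"
  assumes L: "linear L" and S: "S \<in> sets borel" and s: "0 < s" and N: "0 \<le> N"
    and near: "\<And>x y. x \<in> S \<Longrightarrow> y \<in> S \<Longrightarrow> norm (f y - f x - L (y - x)) \<le> s\<^sup>2 * norm (y - x)"
    and Lbd: "\<And>v. norm (L v) \<le> N * norm v"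
  shows "hausdorff_measure CARD('m) (blinfun_apply \<pi> ` f ` S) \<le>
    ennreal ((1 + norm \<pi> * s) ^ CARD('m)) *
      (hausdorff_measure CARD('m) (blinfun_apply \<pi> ` L ` cbox 0 (vec 1)) * emeasure lborel S) +
    ennreal (real CARD('m) ^ CARD('m) * ((s + norm \<pi> * s\<^sup>2) * (norm \<pi> * N + norm \<pi> * s\<^sup>2 + 1) ^ (CARD('m) - 1))) *
      hausdorff_measure CARD('m) (cbox 0 (vec 1 :: real^'m)) * emeasure lborel S"
    (is "?lhs \<le> ?A + ?B")
proof -
  let ?P = "\<lambda>v. blinfun_apply \<pi> (L v)"
  let ?g = "\<lambda>x. blinfun_apply \<pi> (f x)"
  have linP: "linear ?P"
    by (rule linearI) (simp_all add: linear_add[OF L] linear_cmul[OF L] blinfun.add_right blinfun.scaleR_right)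
  have lhs: "?lhs = hausdorff_measure CARD('m) (?g ` S)" by (simp add: image_image)
  have g: "dist (?g x) (?g y) \<le> norm (?P (x - y)) + norm \<pi> * s\<^sup>2 * norm (x - y)" if "x \<in> S" "y \<in> S" for x y
  proof -
    have "blinfun_apply \<pi> (f x - f y) = ?P (x - y) + blinfun_apply \<pi> (f x - f y - L (x - y))"
      by (simp add: blinfun.diff_right)
    then have "dist (?g x) (?g y) \<le> norm (?P (x - y)) + norm (blinfun_apply \<pi> (f x - f y - L (x - y)))"
      using norm_triangle_ineq[of "?P (x - y)" "blinfun_apply \<pi> (f x - f y - L (x - y))"]
      by (simp add: dist_norm blinfun.diff_right)
    also have "norm (blinfun_apply \<pi> (f x - f y - L (x - y))) \<le> norm \<pi> * norm (f x - f y - L (x - y))"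
      by (rule norm_blinfun)
    also have "\<dots> \<le> norm \<pi> * (s\<^sup>2 * norm (x - y))" using near[OF that(2,1)] by (intro mult_left_mono) auto
    finally show ?thesis by (simp add: mult.assoc)
  qed
  show ?thesis
  proof (cases "\<forall>v. s * norm v \<le> norm (?P v)")
    case True
    have "?lhs \<le> ennreal ((1 + norm \<pi> * s) ^ CARD('m)) * hausdorff_measure CARD('m) (?P ` S)"
      unfolding lhs
    proof (rule hausdorff_measure_compare)
      show "0 < 1 + norm \<pi> * s" using s by (simp add: add_pos_nonneg)
      fix x y assume xy: "x \<in> S" "y \<in> S"
      have "norm \<pi> * s\<^sup>2 * norm (x - y) = norm \<pi> * s * (s * norm (x - y))" by (simp add: power2_eq_square)
      also have "\<dots> \<le> norm \<pi> * s * norm (?P (x - y))" using True s by (intro mult_left_mono) auto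
      finally have "dist (?g x) (?g y) \<le> (1 + norm \<pi> * s) * norm (?P (x - y))"
        using g[OF xy] by (simp add: distrib_right)
      then show "dist (?g x) (?g y) \<le> (1 + norm \<pi> * s) * dist (?P x) (?P y)"
        by (simp add: dist_norm linear_diff[OF linP])
    qed
    also have "hausdorff_measure CARD('m) (?P ` S) = hausdorff_measure CARD('m) (?P ` cbox 0 (vec 1)) * emeasure lborel S"
      using True by (intro hausdorff_measure_linear_image[OF linP s _ S]) auto
    finally have "?lhs \<le> ?A" by (simp add: image_image)
    then show ?thesis by (rule order_trans) simp
  next
    case False
    then obtain u where u: "norm u = 1" "norm (?P u) < s"
      using exists_unit_vector_small_image[OF linP] by blast
    have "hausdorff_measure CARD('m) (?g ` S) \<le> ?B"
    proof (rule hausdorff_measure_thin_image[OF linP u(1), of "norm \<pi> * s\<^sup>2"])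
      show "norm (?P u) + norm \<pi> * s\<^sup>2 \<le> s + norm \<pi> * s\<^sup>2" using u by simp
      show "norm (?P v) + norm \<pi> * s\<^sup>2 * norm v \<le> (norm \<pi> * N + norm \<pi> * s\<^sup>2 + 1) * norm v" for v
      proof -
        have "norm (?P v) \<le> norm \<pi> * norm (L v)" by (rule norm_blinfun)
        also have "\<dots> \<le> norm \<pi> * (N * norm v)" using Lbd by (intro mult_left_mono) auto
        finally have "norm (?P v) \<le> norm \<pi> * N * norm v" by (simp add: mult.assoc)
        moreover have "0 \<le> norm v" by simp
        ultimately show ?thesis unfolding distrib_right by linarith
      qed
      show "0 < s + norm \<pi> * s\<^sup>2" using s by (intro add_pos_nonneg) auto
      show "0 < norm \<pi> * N + norm \<pi> * s\<^sup>2 + 1" using N by (intro add_nonneg_pos add_nonneg_nonneg) auto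
    qed (use S g in auto)
    then show ?thesis unfolding lhs by (rule order_trans) simp
  qed
qed

lemma le_liminf_of_perturbed_bound:
  fixes H :: ennreal and h :: "nat \<Rightarrow> ennreal" and c e :: "nat \<Rightarrow> real"
  assumes c: "c \<longlonglongrightarrow> 1" "\<And>n. 0 \<le> c n" and e: "e \<longlonglongrightarrow> 0" "\<And>n. 0 \<le> e n"
    and H: "\<And>n. H \<le> ennreal (c n) * h n + ennreal (e n)"
  shows "H \<le> liminf h"
  unfolding le_Liminf_iff
proof (intro allI impI)
  fix y assume "y < H"
  then obtain r where r: "y < r" "r < H" using dense by blast
  have "r \<noteq> top" using r(2) by (auto simp: top_unique dest: less_le_trans)
  then obtain r' where r': "r = ennreal r'" "0 \<le> r'" by (cases r) auto
  have "(\<lambda>n. ennreal (c n * r' + e n)) \<longlonglongrightarrow> ennreal (1 * r' + 0)"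
    by (intro tendsto_ennrealI tendsto_intros c e)
  then have "\<forall>\<^sub>F n in sequentially. ennreal (c n * r' + e n) < H"
    using r(2) r' by (intro order_tendstoD(2)) auto
  then show "\<forall>\<^sub>F n in sequentially. y < h n"
  proof eventually_elim
    case (elim n)
    show ?case
    proof (rule ccontr)
      assume "\<not> y < h n"
      then have "h n \<le> ennreal r'" using r(1) r' by simp
      then have "ennreal (c n) * h n + ennreal (e n) \<le> ennreal (c n) * ennreal r' + ennreal (e n)"
        by (intro add_mono mult_left_mono) auto
      also have "\<dots> = ennreal (c n * r' + e n)" using c(2)[of n] e(2)[of n] r'(2) by (simp add: ennreal_mult ennreal_plus)
      finally show False using H[of n] elim by (meson leD order_trans)
    qed
  qed
qed

text \<open>The error in \<open>density_contractor_approximation\<close>, with \<open>p\<close> the norm of the linear map and \<open>q\<close> the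
  Hausdorff measure of the parameter set. The first summand comes from the pieces on which the composition with
  the linear map is thin, the second from those on which \<open>f\<close> itself is thin. All that matters is that it
  tends to zero with \<open>s\<close> for fixed \<open>p\<close>; it is not uniform in \<open>p\<close>.\<close>

definition approximation_error :: "nat \<Rightarrow> real \<Rightarrow> real \<Rightarrow> real \<Rightarrow> real \<Rightarrow> real" where
  "approximation_error m M q p s =
     (real m ^ m * ((s + p * s\<^sup>2) * (p * (M + s\<^sup>2) + p * s\<^sup>2 + 1) ^ (m - 1)) +
      (p + 1) ^ m * (real m ^ m * ((s + s\<^sup>2) * (M + 2 * s\<^sup>2) ^ (m - 1)))) * q"

lemma borel_measurable_density_contractor:
  assumes "density_contractor m W \<mu>" "f \<in> borel_measurable borel"
  shows "f \<in> borel_measurable \<mu>"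
proof -
  have "sets \<mu> = sets (restrict_space borel (Hom_rank m))" using assms(1) by (simp add: density_contractor_def)
  then have "borel_measurable \<mu> = borel_measurable (restrict_space borel (Hom_rank m))"
    by (intro measurable_cong_sets) auto
  then show ?thesis using measurable_restrict_space1[OF assms(2)] by blast
qed

lemma density_contractor_integral_le:
  assumes dc: "density_contractor m W \<mu>" and V: "V \<in> grassmannian m" and A: "A \<in> sets borel" "A \<subseteq> V"
  shows "(\<integral>\<^sup>+\<pi>. hausdorff_measure m (blinfun_apply \<pi> ` A) \<partial>\<mu>) \<le> hausdorff_measure m A"
proof -
  have "\<forall>V\<in>grassmannian m. \<forall>A\<in>sets borel. A \<subseteq> V \<longrightarrow>
      (\<integral>\<^sup>+\<pi>. hausdorff_measure m (blinfun_apply \<pi> ` A) \<partial>\<mu>) \<le> hausdorff_measure m A \<and>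
      (V = W \<longrightarrow> (\<integral>\<^sup>+\<pi>. hausdorff_measure m (blinfun_apply \<pi> ` A) \<partial>\<mu>) = hausdorff_measure m A)"
    using dc unfolding density_contractor_def by (elim conjE)
  from conjunct1[OF mp[OF bspec[OF bspec[OF this V] A(1)] A(2)]] show ?thesis .
qed

text \<open>The function \<open>h\<close> is the area formula of \<open>\<pi> \<circ> f\<close> with the derivative of \<open>f\<close> replaced by the linear parts
  \<open>L i\<close> of affine pieces of accuracy \<open>s\<close>. Its integral involves only the planes \<open>range (L i)\<close>, to which the defining
  inequality of the density contractor applies.\<close>

lemma density_contractor_approximation:
  fixes f :: "real^'m \<Rightarrow> 'a::real_normed_vector" and B0 W :: "'a set"
  assumes B0: "finite B0" "span B0 = UNIV" and dc: "density_contractor CARD('m) W \<mu>"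
    and lip: "\<And>x y. norm (f x - f y) \<le> M * norm (x - y)" and M: "0 \<le> M"
    and K: "compact K" and C: "C \<in> sets borel" "C \<subseteq> f ` K" and s: "0 < s" "s < 1"
  shows "\<exists>h :: ('a \<Rightarrow>\<^sub>L 'a) \<Rightarrow> ennreal. h \<in> borel_measurable borel \<and>
    (\<forall>\<pi>. hausdorff_measure CARD('m) (blinfun_apply \<pi> ` C) \<le> ennreal ((1 + norm \<pi> * s) ^ CARD('m)) * h \<pi> +
      ennreal (approximation_error CARD('m) M
        (enn2real (hausdorff_measure CARD('m) (cbox 0 (vec 1 :: real^'m)) * emeasure lborel K)) (norm \<pi>) s)) \<and>
    (\<integral>\<^sup>+\<pi>. h \<pi> \<partial>\<mu>) \<le> ennreal ((1 / (1 - s)) ^ CARD('m)) * hausdorff_measure CARD('m) C"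
proof -
  let ?m = "CARD('m)"
  let ?H = "hausdorff_measure ?m"
  let ?Q = "cbox 0 (vec 1 :: real^'m)"
  let ?q = "enn2real (?H ?Q * emeasure lborel K)"
  obtain I :: "nat set" and S :: "nat \<Rightarrow> (real^'m) set" and L :: "nat \<Rightarrow> real^'m \<Rightarrow> 'a" where
    S: "\<And>i. S i \<in> sets borel" "\<And>i. S i \<subseteq> K" "disjoint_family S" "\<And>i. i \<notin> I \<Longrightarrow> S i = {}" and
    L: "\<And>i. linear (L i)" "\<And>i v. norm (L i v) \<le> (M + s\<^sup>2) * norm v" "\<And>i v. i \<in> I \<Longrightarrow> s * norm v \<le> norm (L i v)" and
    near: "\<And>i x y. x \<in> S i \<Longrightarrow> y \<in> S i \<Longrightarrow> norm (f y - f x - L i (y - x)) \<le> s\<^sup>2 * norm (y - x)" and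
    fS: "disjoint_family (\<lambda>i. f ` S i)" "\<And>i. f ` S i \<in> sets borel" "\<And>i. f ` S i \<subseteq> C" and
    rest: "?H (C - (\<Union>i. f ` S i)) \<le>
      ennreal (real ?m ^ ?m * ((s + s\<^sup>2) * (M + 2 * s\<^sup>2) ^ (?m - 1))) * ?H ?Q * emeasure lborel K"
    by (rule lipschitz_image_near_affine_pieces[OF B0 lip M K C s]) (rule that)
  define q where "q = ?q"
  have q0: "0 \<le> q" by (simp add: q_def)
  have q: "?H ?Q * emeasure lborel K = ennreal q"
    unfolding q_def
  proof -
    have "?H ?Q < top" by (rule hausdorff_measure_bounded_finite) simp
    moreover have "emeasure lborel K < top" using emeasure_compact_finite[OF K] by simp
    ultimately have "?H ?Q * emeasure lborel K < top" by (simp add: ennreal_mult_less_top)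
    then show "?H ?Q * emeasure lborel K = ennreal ?q" by (rule ennreal_enn2real[symmetric])
  qed
  have LQ: "compact (L i ` ?Q)" for i
    using L(1)[of i] by (intro compact_continuous_image linear_continuous_on) (auto simp: linear_conv_bounded_linear)
  define J where "J i \<pi> = ?H (blinfun_apply \<pi> ` L i ` ?Q)" for i and \<pi> :: "'a \<Rightarrow>\<^sub>L 'a"
  have Jm: "J i \<in> borel_measurable borel" for i
    unfolding J_def by (rule hausdorff_measure_image_borel_measurable_compact[OF _ LQ]) simp
  define h where "h \<pi> = (\<Sum>i. J i \<pi> * emeasure lborel (S i))" for \<pi>
  have hm: "h \<in> borel_measurable borel" unfolding h_def using Jm by measurable
  have sumS: "(\<Sum>i. emeasure lborel (S i)) \<le> emeasure lborel K"
  proof -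
    have "(\<Sum>i. emeasure lborel (S i)) = emeasure lborel (\<Union>i. S i)"
      using S(1,3) by (intro suminf_emeasure) auto
    also have "\<dots> \<le> emeasure lborel K" using S(2) borel_compact[OF K] by (intro emeasure_mono) auto
    finally show ?thesis .
  qed
  have bound: "?H (blinfun_apply \<pi> ` C) \<le> ennreal ((1 + norm \<pi> * s) ^ ?m) * h \<pi> +
      ennreal (approximation_error ?m M ?q (norm \<pi>) s)" for \<pi> :: "'a \<Rightarrow>\<^sub>L 'a"
  proof -
    define e1 where "e1 = real ?m ^ ?m * ((s + norm \<pi> * s\<^sup>2) * (norm \<pi> * (M + s\<^sup>2) + norm \<pi> * s\<^sup>2 + 1) ^ (?m - 1))"
    define e2 where "e2 = real ?m ^ ?m * ((s + s\<^sup>2) * (M + 2 * s\<^sup>2) ^ (?m - 1))"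
    define c where "c = ennreal ((1 + norm \<pi> * s) ^ ?m)"
    have e12: "0 \<le> e1" "0 \<le> e2" using s M by (auto simp: e1_def e2_def intro!: mult_nonneg_nonneg add_nonneg_nonneg zero_le_power)
    have piece: "?H (blinfun_apply \<pi> ` f ` S i) \<le> c * (J i \<pi> * emeasure lborel (S i)) + ennreal e1 * ?H ?Q * emeasure lborel (S i)" for i
      unfolding c_def e1_def J_def
      by (rule hausdorff_measure_blinfun_piece[OF L(1) S(1) s(1) _ near L(2)]) (use M in auto)
    have "blinfun_apply \<pi> ` C \<subseteq> (\<Union>i. blinfun_apply \<pi> ` f ` S i) \<union> blinfun_apply \<pi> ` (C - (\<Union>i. f ` S i))" by blast
    then have "?H (blinfun_apply \<pi> ` C) \<le> ?H (\<Union>i. blinfun_apply \<pi> ` f ` S i) + ?H (blinfun_apply \<pi> ` (C - (\<Union>i. f ` S i)))"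
      by (rule order_trans[OF hausdorff_measure_mono hausdorff_measure_Un]) simp
    also have "\<dots> \<le> (c * h \<pi> + ennreal e1 * (?H ?Q * emeasure lborel K)) + ennreal ((norm \<pi> + 1) ^ ?m * e2) * (?H ?Q * emeasure lborel K)"
    proof (rule add_mono)
      have "?H (\<Union>i. blinfun_apply \<pi> ` f ` S i) \<le>
          (\<Sum>i. c * (J i \<pi> * emeasure lborel (S i)) + ennreal e1 * ?H ?Q * emeasure lborel (S i))"
        by (rule order_trans[OF hausdorff_measure_UN suminf_le[OF piece summableI summableI]])
      also have "\<dots> = (\<Sum>i. c * (J i \<pi> * emeasure lborel (S i))) + (\<Sum>i. ennreal e1 * ?H ?Q * emeasure lborel (S i))"
        by (rule suminf_add[OF summableI summableI, symmetric])
      also have "(\<Sum>i. c * (J i \<pi> * emeasure lborel (S i))) = c * h \<pi>" unfolding h_def by (rule ennreal_suminf_cmult)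
      also have "(\<Sum>i. ennreal e1 * ?H ?Q * emeasure lborel (S i)) = ennreal e1 * ?H ?Q * (\<Sum>i. emeasure lborel (S i))"
        by (rule ennreal_suminf_cmult)
      also have "c * h \<pi> + \<dots> \<le> c * h \<pi> + ennreal e1 * ?H ?Q * emeasure lborel K"
        using sumS by (intro add_left_mono mult_left_mono) auto
      finally show "?H (\<Union>i. blinfun_apply \<pi> ` f ` S i) \<le> c * h \<pi> + ennreal e1 * (?H ?Q * emeasure lborel K)"
        by (simp only: mult.assoc)
      have "?H (blinfun_apply \<pi> ` (C - (\<Union>i. f ` S i))) \<le> ennreal ((norm \<pi> + 1) ^ ?m) * ?H (C - (\<Union>i. f ` S i))"
        by (rule hausdorff_measure_blinfun_image)
      also have "\<dots> \<le> ennreal ((norm \<pi> + 1) ^ ?m) * (ennreal e2 * ?H ?Q * emeasure lborel K)"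
        using rest unfolding e2_def by (intro mult_left_mono) auto
      also have "\<dots> = ennreal ((norm \<pi> + 1) ^ ?m * e2) * (?H ?Q * emeasure lborel K)"
        using e12 by (simp add: ennreal_mult mult.assoc)
      finally show "?H (blinfun_apply \<pi> ` (C - (\<Union>i. f ` S i))) \<le> \<dots>" .
    qed
    also have "\<dots> = c * h \<pi> + (ennreal e1 * ennreal q + ennreal ((norm \<pi> + 1) ^ ?m * e2) * ennreal q)"
      unfolding q by (simp only: add.assoc)
    also have "ennreal e1 * ennreal q + ennreal ((norm \<pi> + 1) ^ ?m * e2) * ennreal q =
        ennreal ((e1 + (norm \<pi> + 1) ^ ?m * e2) * q)"
    proof -
      have "0 \<le> (norm \<pi> + 1) ^ ?m * e2" using e12 by (intro mult_nonneg_nonneg) auto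
      then show ?thesis using e12 q0 unfolding distrib_right[symmetric] by (simp add: ennreal_mult ennreal_plus)
    qed
    finally show ?thesis unfolding approximation_error_def e1_def e2_def c_def q_def .
  qed
  have integral: "(\<integral>\<^sup>+\<pi>. h \<pi> \<partial>\<mu>) \<le> ennreal ((1 / (1 - s)) ^ ?m) * ?H C"
  proof -
    have Jmu: "J i \<in> borel_measurable \<mu>" for i by (rule borel_measurable_density_contractor[OF dc Jm])
    have "(\<integral>\<^sup>+\<pi>. h \<pi> \<partial>\<mu>) = (\<Sum>i. \<integral>\<^sup>+\<pi>. J i \<pi> * emeasure lborel (S i) \<partial>\<mu>)"
      unfolding h_def by (rule nn_integral_suminf) (rule borel_measurable_times_ennreal[OF Jmu borel_measurable_const])
    also have "\<dots> = (\<Sum>i. (\<integral>\<^sup>+\<pi>. J i \<pi> \<partial>\<mu>) * emeasure lborel (S i))"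
      using Jmu by (simp add: nn_integral_multc)
    also have "\<dots> \<le> (\<Sum>i. ennreal ((1 / (1 - s)) ^ ?m) * ?H (f ` S i))"
    proof (rule suminf_le[OF _ summableI summableI])
      fix i
      show "(\<integral>\<^sup>+\<pi>. J i \<pi> \<partial>\<mu>) * emeasure lborel (S i) \<le> ennreal ((1 / (1 - s)) ^ ?m) * ?H (f ` S i)"
      proof (cases "i \<in> I")
        case False then show ?thesis by (simp add: S(4))
      next
        case True
        have "inj (L i)" by (rule linear_bounded_below_inj[OF L(1) s(1) L(3)[OF True]])
        then have "inj_on (L i) X" for X by (rule inj_on_subset) simp
        then have ind: "independent (L i ` Basis)"
          by (intro linear_independent_injective_image[OF L(1) independent_Basis])
        have sp: "span (L i ` Basis) = range (L i)" by (simp add: linear_span_image[OF L(1)])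
        have "dim (range (L i)) = card (L i ` (Basis :: (real^'m) set))"
          by (rule dim_eq_card[OF _ ind]) (simp only: sp[symmetric] span_span)
        also have "\<dots> = ?m" using \<open>inj (L i)\<close> by (simp add: card_image inj_on_subset)
        finally have V: "range (L i) \<in> grassmannian ?m"
          using linear_subspace_image[OF L(1) subspace_UNIV] by (simp add: grassmannian_def)
        have "L i ` ?Q \<in> sets borel" by (rule borel_compact[OF LQ])
        then have "(\<integral>\<^sup>+\<pi>. J i \<pi> \<partial>\<mu>) \<le> ?H (L i ` ?Q)"
          unfolding J_def by (rule density_contractor_integral_le[OF dc V]) (rule image_mono, simp)
        then have "(\<integral>\<^sup>+\<pi>. J i \<pi> \<partial>\<mu>) * emeasure lborel (S i) \<le> ?H (L i ` ?Q) * emeasure lborel (S i)"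
          by (rule mult_right_mono) simp
        also have "\<dots> = ?H (L i ` S i)"
          by (rule hausdorff_measure_linear_image[OF L(1) s(1) L(3)[OF True] S(1), symmetric])
        also have "\<dots> \<le> ennreal ((1 / (1 - s)) ^ ?m) * ?H (f ` S i)"
        proof (rule hausdorff_measure_compare)
          show "0 < 1 / (1 - s)" using s by simp
          fix x y assume xy: "x \<in> S i" "y \<in> S i"
          have "norm (L i (x - y)) \<le> norm (f x - f y) + norm (f x - f y - L i (x - y))"
            using norm_triangle_ineq4[of "f x - f y" "f x - f y - L i (x - y)"] by simp
          also have "norm (f x - f y - L i (x - y)) \<le> s\<^sup>2 * norm (x - y)" by (rule near[OF xy(2,1)])
          also have "s\<^sup>2 * norm (x - y) = s * (s * norm (x - y))" by (simp add: power2_eq_square)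
          also have "\<dots> \<le> s * norm (L i (x - y))" using L(3)[OF True] s by (intro mult_left_mono) auto
          finally have "(1 - s) * norm (L i (x - y)) \<le> norm (f x - f y)" by (simp add: algebra_simps)
          then have "(1 - s) * dist (L i x) (L i y) \<le> dist (f x) (f y)" by (simp add: dist_norm linear_diff[OF L(1)])
          then show "dist (L i x) (L i y) \<le> 1 / (1 - s) * dist (f x) (f y)" using s by (simp add: field_simps)
        qed
        finally show ?thesis .
      qed
    qed
    also have "\<dots> = ennreal ((1 / (1 - s)) ^ ?m) * (\<Sum>i. ?H (f ` S i))" by (rule ennreal_suminf_cmult)
    also have "(\<Sum>i. ?H (f ` S i)) = (\<Sum>i. emeasure (hausdorff_borel ?m) (f ` S i))"
      using fS(2) by (simp add: emeasure_hausdorff_borel)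
    also have "\<dots> = emeasure (hausdorff_borel ?m) (\<Union>i. f ` S i)"
      using fS(1,2) by (intro suminf_emeasure) auto
    also have "\<dots> \<le> emeasure (hausdorff_borel ?m) C" using fS(3) C(1) by (intro emeasure_mono) auto
    also have "emeasure (hausdorff_borel ?m) C = ?H C" using C(1) by (intro emeasure_hausdorff_borel) auto
    finally show ?thesis by (simp add: mult_left_mono)
  qed
  show ?thesis using hm bound integral by blast
qed

text \<open>As the accuracy \<open>s\<close> of the pieces tends to zero, the approximations bound \<open>\<H>\<^sup>m(\<pi>(C))\<close> from above in the limit
  for each single \<open>\<pi>\<close>, and Fatou's lemma exchanges the limit with the integral. No bound that is uniform in
  \<open>\<pi>\<close> enters, as \<open>norm \<pi> ^ m\<close> may fail to be integrable.\<close>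

lemma density_contractor_lipschitz_image:
  fixes f :: "real^'m \<Rightarrow> 'a::real_normed_vector" and B0 W :: "'a set"
  assumes B0: "finite B0" "span B0 = UNIV" and dc: "density_contractor CARD('m) W \<mu>"
    and lip: "\<And>x y. norm (f x - f y) \<le> M * norm (x - y)" and M: "0 \<le> M"
    and K: "compact K" and C: "C \<in> sets borel" "C \<subseteq> f ` K"
  shows "(\<integral>\<^sup>+\<pi>. hausdorff_measure CARD('m) (blinfun_apply \<pi> ` C) \<partial>\<mu>) \<le> hausdorff_measure CARD('m) C"
proof -
  let ?m = "CARD('m)"
  let ?H = "hausdorff_measure ?m"
  define q where "q = enn2real (?H (cbox 0 (vec 1 :: real^'m)) * emeasure lborel K)"
  have q0: "0 \<le> q" by (simp add: q_def)
  \<comment> \<open>The shift by two keeps \<open>s n\<close> strictly below \<open>1\<close>.\<close>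
  define s where "s n = inverse (real (Suc (Suc n)))" for n
  have s: "0 < s n" "s n < 1" for n by (auto simp: s_def inverse_less_1_iff)
  have s0: "s \<longlonglongrightarrow> 0"
    unfolding s_def using LIMSEQ_inverse_real_of_nat LIMSEQ_Suc by blast
  define P where "P n h \<longleftrightarrow> h \<in> borel_measurable borel \<and>
    (\<forall>\<pi>. ?H (blinfun_apply \<pi> ` C) \<le> ennreal ((1 + norm \<pi> * s n) ^ ?m) * h \<pi> +
      ennreal (approximation_error ?m M q (norm \<pi>) (s n))) \<and>
    (\<integral>\<^sup>+\<pi>. h \<pi> \<partial>\<mu>) \<le> ennreal ((1 / (1 - s n)) ^ ?m) * ?H C" for n and h :: "('a \<Rightarrow>\<^sub>L 'a) \<Rightarrow> ennreal"
  have "\<exists>h. P n h" for n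
    unfolding P_def q_def by (rule density_contractor_approximation[OF B0 dc lip M K C s])
  then obtain h where Ph: "\<And>n. P n (h n)" by metis
  have hm: "h n \<in> borel_measurable borel" for n using Ph[of n] by (simp add: P_def)
  have hb: "?H (blinfun_apply \<pi> ` C) \<le> ennreal ((1 + norm \<pi> * s n) ^ ?m) * h n \<pi> +
      ennreal (approximation_error ?m M q (norm \<pi>) (s n))" for n \<pi> using Ph[of n] by (simp add: P_def)
  have hi: "(\<integral>\<^sup>+\<pi>. h n \<pi> \<partial>\<mu>) \<le> ennreal ((1 / (1 - s n)) ^ ?m) * ?H C" for n using Ph[of n] by (simp add: P_def)
  have "?H (blinfun_apply \<pi> ` C) \<le> liminf (\<lambda>n. h n \<pi>)" for \<pi> :: "'a \<Rightarrow>\<^sub>L 'a"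
  proof (rule le_liminf_of_perturbed_bound[OF _ _ _ _ hb])
    have "(\<lambda>n. (1 + norm \<pi> * s n) ^ ?m) \<longlonglongrightarrow> (1 + norm \<pi> * 0) ^ ?m" by (intro tendsto_intros s0)
    then show "(\<lambda>n. (1 + norm \<pi> * s n) ^ ?m) \<longlonglongrightarrow> 1" by simp
    show "0 \<le> (1 + norm \<pi> * s n) ^ ?m" for n using s(1)[of n] by (intro zero_le_power add_nonneg_nonneg) auto
    \<comment> \<open>A polynomial in \<open>s\<close> that vanishes at zero.\<close>
    have "(\<lambda>n. approximation_error ?m M q (norm \<pi>) (s n)) \<longlonglongrightarrow> approximation_error ?m M q (norm \<pi>) 0"
      unfolding approximation_error_def by (intro tendsto_intros s0)
    then show "(\<lambda>n. approximation_error ?m M q (norm \<pi>) (s n)) \<longlonglongrightarrow> 0" by (simp add: approximation_error_def)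
    show "0 \<le> approximation_error ?m M q (norm \<pi>) (s n)" for n
      unfolding approximation_error_def using s(1)[of n] M q0
      by (intro mult_nonneg_nonneg add_nonneg_nonneg zero_le_power) auto
  qed
  then have "(\<integral>\<^sup>+\<pi>. ?H (blinfun_apply \<pi> ` C) \<partial>\<mu>) \<le> (\<integral>\<^sup>+\<pi>. liminf (\<lambda>n. h n \<pi>) \<partial>\<mu>)"
    by (intro nn_integral_mono) auto
  also have "\<dots> \<le> liminf (\<lambda>n. \<integral>\<^sup>+\<pi>. h n \<pi> \<partial>\<mu>)"
    by (rule nn_integral_liminf) (rule borel_measurable_density_contractor[OF dc hm])
  also have "\<dots> \<le> liminf (\<lambda>n. ennreal ((1 / (1 - s n)) ^ ?m) * ?H C)"
    by (rule Liminf_mono[OF always_eventually]) (simp add: hi)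
  also have "\<dots> = ?H C"
  proof -
    have "?H C \<le> ?H (f ` K)" by (rule hausdorff_measure_mono[OF C(2)])
    also have "\<dots> \<le> ennreal ((M + 1) ^ ?m) * ?H ((\<lambda>x. x) ` K)"
    proof (rule hausdorff_measure_compare)
      fix x y :: "real^'m"
      have "M * norm (x - y) \<le> (M + 1) * norm (x - y)" by (intro mult_right_mono) auto
      then show "dist (f x) (f y) \<le> (M + 1) * dist x y" using lip[of x y] by (simp add: dist_norm)
    qed (use M in simp)
    also have "\<dots> < top" using hausdorff_measure_bounded_finite[OF compact_imp_bounded[OF K]] by (simp add: ennreal_mult_less_top)
    finally obtain t where t: "?H C = ennreal t" "0 \<le> t" by (cases "?H C") auto
    have "(\<lambda>n. ennreal ((1 / (1 - s n)) ^ ?m * t)) \<longlonglongrightarrow> ennreal ((1 / (1 - 0)) ^ ?m * t)"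
      by (intro tendsto_ennrealI tendsto_intros s0) simp
    moreover have "ennreal ((1 / (1 - s n)) ^ ?m * t) = ennreal ((1 / (1 - s n)) ^ ?m) * ?H C" for n
      using t s(2)[of n] by (simp add: ennreal_mult)
    ultimately have "(\<lambda>n. ennreal ((1 / (1 - s n)) ^ ?m) * ?H C) \<longlonglongrightarrow> ?H C" using t by simp
    then show ?thesis by (intro lim_imp_Liminf) auto
  qed
  finally show ?thesis .
qed

text \<open>A Lebesgue measurable set is a countable union of compact sets up to a null set, and Lipschitz maps
  preserve compact sets and null sets.\<close>

lemma lipschitz_image_sigma_compact:
  fixes f :: "real^'m \<Rightarrow> 'a::real_normed_vector"
  assumes lip: "\<And>x y. norm (f x - f y) \<le> M * norm (x - y)" and M: "0 \<le> M"
    and K: "compact K" and C: "C \<in> sets borel" "C \<subseteq> f ` K"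
  shows "\<exists>D :: nat \<Rightarrow> 'a set. (\<forall>i. compact (D i)) \<and> (\<Union>i. D i) \<subseteq> C \<and> hausdorff_measure CARD('m) (C - (\<Union>i. D i)) = 0"
proof -
  have contf: "continuous_on A f" for A using lip by (rule continuous_on_norm_lipschitz)
  have fm: "f \<in> borel_measurable borel" using contf by (rule borel_measurable_continuous_onI)
  define S where "S = K \<inter> f -` C"
  have "S \<in> sets borel" unfolding S_def using measurable_sets[OF fm C(1)] borel_compact[OF K] by auto
  then have "S \<in> sets lebesgue" by simp
  then obtain F T where FT: "fsigma F" "T \<in> null_sets lebesgue" "F \<union> T = S"
    by (rule lebesgue_set_almost_fsigma)
  obtain E :: "nat \<Rightarrow> (real^'m) set" where E: "range E \<subseteq> Collect compact" "F = \<Union>(range E)"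
    using FT(1) unfolding fsigma_Union_compact by (elim exE conjE)
  have cE: "compact (E i)" for i using E(1) by auto
  have fS: "f ` S = C" unfolding S_def using C(2) by auto
  have sub: "(\<Union>i. f ` E i) \<subseteq> C" using E(2) FT(3) fS by blast
  have "C - (\<Union>i. f ` E i) \<subseteq> f ` T" using E(2) FT(3) fS by blast
  then have "hausdorff_measure CARD('m) (C - (\<Union>i. f ` E i)) \<le> hausdorff_measure CARD('m) (f ` T)"
    by (rule hausdorff_measure_mono)
  also have "\<dots> = 0"
    by (rule hausdorff_measure_lipschitz_null_image[OF _ M]) (use FT(2) in \<open>auto simp: dist_norm lip negligible_iff_null_sets\<close>)
  finally have "hausdorff_measure CARD('m) (C - (\<Union>i. f ` E i)) = 0" by simp
  moreover have "compact (f ` E i)" for i by (rule compact_continuous_image[OF contf cE])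
  ultimately show ?thesis using sub by (intro exI[of _ "\<lambda>i. f ` E i"]) blast
qed

section \<open>Density contractors on rectifiable sets\<close>

theorem theorem5p13:
  fixes W A :: "'a::real_normed_vector set"
    and \<mu> :: "('a \<Rightarrow>\<^sub>L 'a) measure"
  assumes "\<exists>B :: 'a set. finite B \<and> span B = UNIV"
    and "CARD('m::finite) \<in> {1..dim (UNIV :: 'a set) - 1}"
    and "W \<in> grassmannian CARD('m)"
    and "density_contractor CARD('m) W \<mu>"
    and "A \<in> sets borel"
    and "countably_rectifiable TYPE('m) A"
  shows "(\<integral>\<^sup>+\<pi>. hausdorff_measure CARD('m) (blinfun_apply \<pi> ` A) \<partial>\<mu>) \<le> hausdorff_measure CARD('m) A
    \<and> (A \<subseteq> W \<longrightarrow>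
        (\<integral>\<^sup>+\<pi>. hausdorff_measure CARD('m) (blinfun_apply \<pi> ` A) \<partial>\<mu>) = hausdorff_measure CARD('m) A)
    \<and> (\<lambda>\<pi>. hausdorff_measure CARD('m) (blinfun_apply \<pi> ` A))
        \<in> borel_measurable (restrict_space borel (Hom_rank CARD('m)))"
proof -
  let ?m = "CARD('m)"
  let ?H = "hausdorff_measure ?m"
  obtain B0 :: "'a set" where B0: "finite B0" "span B0 = UNIV" using assms(1) by blast
  obtain E :: "nat \<Rightarrow> (real^'m) set" and f :: "nat \<Rightarrow> real^'m \<Rightarrow> 'a" where
    E: "\<forall>k. bounded (E k) \<and> (\<exists>L. L-lipschitz_on (E k) (f k))" and null: "?H (A - (\<Union>k. f k ` E k)) = 0"
    using assms(6) unfolding countably_rectifiable_def by blast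
  have "\<exists>g M. 0 \<le> M \<and> (\<forall>x y. norm (g x - g y) \<le> M * dist x y) \<and> (\<forall>x\<in>E k. g x = f k x)" for k
  proof -
    obtain L where "L-lipschitz_on (E k) (f k)" using E by blast
    then show ?thesis by (rule lipschitz_extension_finite_dimensional[OF B0])
  qed
  then obtain g M where M: "\<And>k. 0 \<le> M k" and g: "\<And>k x y. norm (g k x - g k y) \<le> M k * dist x y"
      and gf: "\<And>k x. x \<in> E k \<Longrightarrow> g k x = f k x"
    by metis
  have lip: "norm (g k x - g k y) \<le> M k * norm (x - y)" for k x y using g[of k x y] by (simp add: dist_norm)
  define K where "K k = closure (E k)" for k
  have K: "compact (K k)" for k unfolding K_def using E by (simp add: compact_closure)
  have contg: "continuous_on S (g k)" for S k using lip[of k] by (rule continuous_on_norm_lipschitz)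
  have gK: "g k ` K k \<in> sets borel" for k
    by (rule borel_compact[OF compact_continuous_image[OF contg K]])
  \<comment> \<open>Disjoint Borel parts of \<open>A\<close>, each in a single Lipschitz image of a compact set.\<close>
  define C where "C k = A \<inter> g k ` K k - (\<Union>j<k. g j ` K j)" for k
  have Cb: "C k \<in> sets borel" for k
    unfolding C_def using assms(5) gK by (auto intro!: sets.Diff sets.Int sets.finite_UN)
  have CK: "C k \<subseteq> g k ` K k" for k unfolding C_def by blast
  have disj: "disjoint_family C" by (rule disjoint_family_natI) (auto simp: C_def)
  have CA: "(\<Union>k. C k) \<subseteq> A" unfolding C_def by blast
  have "A - (\<Union>k. C k) \<subseteq> A - (\<Union>k. f k ` E k)"
  proof
    fix x assume x: "x \<in> A - (\<Union>k. C k)"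
    have "x \<notin> f k ` E k" for k
    proof
      assume "x \<in> f k ` E k"
      then obtain z where z: "x = f k z" "z \<in> E k" by (elim imageE)
      have "z \<in> K k" unfolding K_def using z(2) closure_subset by (rule rev_subsetD)
      moreover have "x = g k z" using z gf by simp
      ultimately have ex: "\<exists>k. x \<in> g k ` K k" by blast
      define j where "j = (LEAST k. x \<in> g k ` K k)"
      have "x \<in> g j ` K j" unfolding j_def using ex by (rule LeastI_ex)
      moreover have "x \<notin> g i ` K i" if "i < j" for i using that unfolding j_def by (rule not_less_Least)
      ultimately have "x \<in> C j" using x by (auto simp: C_def)
      then show False using x by blast
    qed
    then show "x \<in> A - (\<Union>k. f k ` E k)" using x by blast
  qed
  then have "?H (A - (\<Union>k. C k)) \<le> ?H (A - (\<Union>k. f k ` E k))" by (rule hausdorff_measure_mono)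
  then have nullC: "?H (A - (\<Union>k. C k)) = 0" using null by simp
  have "\<exists>D :: nat \<Rightarrow> 'a set. (\<forall>i. compact (D i)) \<and> (\<Union>i. D i) \<subseteq> C k \<and> ?H (C k - (\<Union>i. D i)) = 0" for k
    by (rule lipschitz_image_sigma_compact[OF lip M K Cb CK])
  then obtain D :: "nat \<Rightarrow> nat \<Rightarrow> 'a set" where D: "\<And>k i. compact (D k i)" "\<And>k. (\<Union>i. D k i) \<subseteq> C k"
      "\<And>k. ?H (C k - (\<Union>i. D k i)) = 0"
    by metis
  have Cmeas: "(\<lambda>\<pi> :: 'a \<Rightarrow>\<^sub>L 'a. ?H (blinfun_apply \<pi> ` C k)) \<in> borel_measurable borel" for k
    by (rule hausdorff_measure_image_borel_measurable[OF _ D]) simp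
  have Ameas: "(\<lambda>\<pi> :: 'a \<Rightarrow>\<^sub>L 'a. ?H (blinfun_apply \<pi> ` A)) \<in> borel_measurable borel"
  proof -
    define D' where "D' n = (case prod_decode n of (k, i) \<Rightarrow> D k i)" for n
    have U: "(\<Union>n. D' n) = (\<Union>k. \<Union>i. D k i)"
    proof (intro equalityI subsetI)
      fix x assume "x \<in> (\<Union>n. D' n)"
      then obtain n where "x \<in> D' n" by blast
      then show "x \<in> (\<Union>k. \<Union>i. D k i)" unfolding D'_def by (auto split: prod.splits)
    next
      fix x assume "x \<in> (\<Union>k. \<Union>i. D k i)"
      then obtain k i where "x \<in> D k i" by blast
      then have "x \<in> D' (prod_encode (k, i))" by (simp add: D'_def)
      then show "x \<in> (\<Union>n. D' n)" by blast
    qed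
    have "A - (\<Union>n. D' n) \<subseteq> (A - (\<Union>k. C k)) \<union> (\<Union>k. C k - (\<Union>i. D k i))" unfolding U by blast
    then have "?H (A - (\<Union>n. D' n)) \<le> ?H (A - (\<Union>k. C k)) + ?H (\<Union>k. C k - (\<Union>i. D k i))"
      by (rule order_trans[OF hausdorff_measure_mono hausdorff_measure_Un]) simp
    also have "\<dots> = 0" using nullC hausdorff_measure_UN_null[of ?m "\<lambda>k. C k - (\<Union>i. D k i)"] D(3) by simp
    finally have n0: "?H (A - (\<Union>n. D' n)) = 0" by simp
    have "(\<Union>n. D' n) \<subseteq> A" unfolding U using D(2) CA by blast
    moreover have "compact (D' n)" for n unfolding D'_def using D(1) by (simp split: prod.split)
    ultimately show ?thesis using n0 by (intro hausdorff_measure_image_borel_measurable[of _ D']) auto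
  qed
  have "(\<integral>\<^sup>+\<pi>. ?H (blinfun_apply \<pi> ` A) \<partial>\<mu>) \<le> (\<integral>\<^sup>+\<pi>. (\<Sum>k. ?H (blinfun_apply \<pi> ` C k)) \<partial>\<mu>)"
  proof (rule nn_integral_mono)
    fix \<pi> :: "'a \<Rightarrow>\<^sub>L 'a"
    have "blinfun_apply \<pi> ` A \<subseteq> (\<Union>k. blinfun_apply \<pi> ` C k) \<union> blinfun_apply \<pi> ` (A - (\<Union>k. C k))" by blast
    then have "?H (blinfun_apply \<pi> ` A) \<le> ?H (\<Union>k. blinfun_apply \<pi> ` C k) + ?H (blinfun_apply \<pi> ` (A - (\<Union>k. C k)))"
      by (rule order_trans[OF hausdorff_measure_mono hausdorff_measure_Un]) simp
    also have "?H (blinfun_apply \<pi> ` (A - (\<Union>k. C k))) = 0"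
      using hausdorff_measure_blinfun_image[of ?m \<pi> "A - (\<Union>k. C k)"] nullC by simp
    also have "?H (\<Union>k. blinfun_apply \<pi> ` C k) + 0 \<le> (\<Sum>k. ?H (blinfun_apply \<pi> ` C k))"
      using hausdorff_measure_UN[of ?m "\<lambda>k. blinfun_apply \<pi> ` C k"] by simp
    finally show "?H (blinfun_apply \<pi> ` A) \<le> (\<Sum>k. ?H (blinfun_apply \<pi> ` C k))" .
  qed
  also have "\<dots> = (\<Sum>k. \<integral>\<^sup>+\<pi>. ?H (blinfun_apply \<pi> ` C k) \<partial>\<mu>)"
    by (rule nn_integral_suminf) (rule borel_measurable_density_contractor[OF assms(4) Cmeas])
  also have "\<dots> \<le> (\<Sum>k. ?H (C k))"
    by (rule suminf_le[OF _ summableI summableI]) (rule density_contractor_lipschitz_image[OF B0 assms(4) lip M K Cb CK])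
  also have "\<dots> = (\<Sum>k. emeasure (hausdorff_borel ?m) (C k))" using Cb by (simp add: emeasure_hausdorff_borel)
  also have "\<dots> = emeasure (hausdorff_borel ?m) (\<Union>k. C k)" using Cb disj by (intro suminf_emeasure) auto
  also have "\<dots> \<le> emeasure (hausdorff_borel ?m) A" using CA assms(5) by (intro emeasure_mono) auto
  also have "\<dots> = ?H A" using assms(5) by (intro emeasure_hausdorff_borel) auto
  finally have ineq: "(\<integral>\<^sup>+\<pi>. ?H (blinfun_apply \<pi> ` A) \<partial>\<mu>) \<le> ?H A" .
  have eq: "A \<subseteq> W \<longrightarrow> (\<integral>\<^sup>+\<pi>. ?H (blinfun_apply \<pi> ` A) \<partial>\<mu>) = ?H A"
    using assms(3,4,5) unfolding density_contractor_def by blast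
  show ?thesis using ineq eq measurable_restrict_space1[OF Ameas] by blast
qed

end
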